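(* Let $P$ be a finite poset that is decomposed into two disjoint chains $a_1<\cdots<a_p$ and $b_1<\cdots<b_q$ with $p,q\ge1$ (elements of different chains may be comparable), and let $\mathcal{A}$ be the set of pairs $(i,j)$, $0\le i\le p$, $0\le j\le q$, such that $\{a_1,\ldots,a_i,b_1,\ldots,b_j\}$ is a poset ideal of $P$. Put $k=p+1$, $m=q$ and, for $0\le i\le p$, with the convention $t_0=1$, $$f_{i+1}(x,t)=\sum_{j:\,(i,j)\in\mathcal{A}}x_{i,j}\,t_j .$$ Let $\mathcal{S}$ be the set of standard monomials defined in the context, and let $\{u_1,\ldots,u_r\}$ be obtained from $\mathcal{S}$ by replacing each $x_{i,j}$ by $\partial_{ij}=\partial/\partial x_{i,j}$. Set $Q=\prod_{j=1}^kf_j(x,t)^{\alpha_j}\,t^\gamma$ and $Q'=Q|_{\alpha_i=\gamma_j=1}$. Then, when $\alpha_i,\gamma_j$ are generic complex numbers (and $x$ lies outside of an analytic set), the set of rational forms $$\frac{u_i\bullet Q}{Q}\,dt_1\cdots dt_m,\qquad i=1,\ldots,r,$$ is a basis of the twisted cohomology group $H^m(\Omega^\bullet( *Q'),\nabla)$.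
   Context: A poset ideal of $P$ is a subset $\alpha\subseteq P$ such that $a\in\alpha$, $b\in P$, $b\le a$ imply $b\in\alpha$. The matrix $A$ representing $P$ has one column for each $(i,j)\in\mathcal{A}$, namely $\binom{e_{i+1}}{e'_j}$, with $e_1,\ldots,e_{p+1}$ the standard unit vectors of $\mathbf{Z}^{p+1}$, $e'_1,\ldots,e'_q$ those of $\mathbf{Z}^q$, and $e'_0=0$. The polynomials $f_1,\ldots,f_k$ are the generic sparse polynomials associated with this matrix. $\mathcal{S}$: for $0\le i\le p$ let $j_i^\sharp$ be the smallest integer with $(i,j_i^\sharp)\in\mathcal{A}$. For $0\le j\le q$ let $i_j^\flat$ be the smallest integer with $(i_j^\flat,j)\in\mathcal{A}$. $\mathcal{S}$ is the set of monomials $x_{i_1,j_1}\cdots x_{i_\rho,j_\rho}$, $\rho=0,1,2,\ldots$, with each $(i_h,j_h)\in\mathcal{A}\setminus(\{(i,j_i^\sharp):0\le i\le p\}\cup\{(i_j^\flat,j):0\le j\le q\})$, $0<i_1<\cdots<i_\rho\le p$ and $0<j_1<\cdots<j_\rho\le q$. $t=(t_1,\ldots,t_m)$, $t^\gamma=\prod_{j=1}^mt_j^{\gamma_j}$, $x=(x_{i,j})_{(i,j)\in\mathcal{A}}$, and $u\bullet Q$ is the action of the differential operator $u$ on $Q$. $Q'=t_1\cdots t_m\prod_jf_j(x,t)$. For fixed $x$, $\Omega^\bullet( *Q')$ is the complex of rational differential forms in $t$ on $\mathbf{C}^m$ with poles at most along $\{t: Q'(x,t)=0\}$, with differential $\nabla=d+\sum_{j=1}^m\left(\frac{\partial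 Q}{\partial t_j}/Q\right)dt_j\wedge$, where $d$ is the exterior derivative in $t$. "Generic complex numbers" means that $(\alpha,\gamma)\in\mathbf{C}^{k+m}$ lies outside a countable union of proper analytic subsets. "$x$ outside of an analytic set" means outside a proper analytic subset of the $x$-space. *)

theory Defs
  imports "HOL-Complex_Analysis.Complex_Analysis"
begin

section \<open>Analytic subsets of coordinate spaces\<close>

text \<open>
  For a finite index set \<open>I\<close>, the space \<open>\<complex>\<^sup>I\<close> is the set of extensional functions on \<open>I\<close>; this is
  the carrier of \<^term>\<open>product_topology (\<lambda>_. euclidean) I\<close>, its usual topology.
\<close>

abbreviation cspace :: "'i set \<Rightarrow> ('i \<Rightarrow> complex) set"
  where "cspace I \<equiv> (\<Pi>\<^sub>E i\<in>I. UNIV)"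

definition holomorphic_in :: "'i set \<Rightarrow> ('i \<Rightarrow> complex) set \<Rightarrow> (('i \<Rightarrow> complex) \<Rightarrow> complex) \<Rightarrow> bool"
  where "holomorphic_in I U f \<longleftrightarrow>
    continuous_map (subtopology (product_topology (\<lambda>_. euclidean) I) U) euclidean f \<and>
    (\<forall>z\<in>U. \<forall>i\<in>I. (\<lambda>w. f (z(i := w))) field_differentiable at (z i))"

definition analytic_subset :: "'i set \<Rightarrow> ('i \<Rightarrow> complex) set \<Rightarrow> bool"
  where "analytic_subset I V \<longleftrightarrow> V \<subseteq> cspace I \<and>
    (\<forall>z\<in>cspace I. \<exists>U F. openin (product_topology (\<lambda>_. euclidean) I) U \<and> z \<in> U \<and>
       finite F \<and> (\<forall>f\<in>F. holomorphic_in I U f) \<and> V \<inter> U = {w \<in> U. \<forall>f\<in>F. f w = 0})"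

definition proper_analytic_subset :: "'i set \<Rightarrow> ('i \<Rightarrow> complex) set \<Rightarrow> bool"
  where "proper_analytic_subset I V \<longleftrightarrow> analytic_subset I V \<and> V \<noteq> cspace I"


section \<open>Rational differential forms and twisted cohomology\<close>

inductive poly_fun :: "nat \<Rightarrow> ((nat \<Rightarrow> complex) \<Rightarrow> complex) \<Rightarrow> bool" for m :: nat
  where
    poly_fun_const: "poly_fun m (\<lambda>t. c)"
  | poly_fun_coord: "j \<in> {1..m} \<Longrightarrow> poly_fun m (\<lambda>t. t j)"
  | poly_fun_add: "poly_fun m g \<Longrightarrow> poly_fun m h \<Longrightarrow> poly_fun m (\<lambda>t. g t + h t)"
  | poly_fun_mult: "poly_fun m g \<Longrightarrow> poly_fun m h \<Longrightarrow> poly_fun m (\<lambda>t. g t * h t)"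

definition compl_locus :: "nat \<Rightarrow> ((nat \<Rightarrow> complex) \<Rightarrow> complex) \<Rightarrow> (nat \<Rightarrow> complex) set"
  where "compl_locus m s = {t \<in> cspace {1..m}. s t \<noteq> 0}"

text \<open>
  A rational function on \<open>\<complex>\<^sup>m\<close> with poles at most along \<open>{s = 0}\<close> is identified with the function it
  defines on the complement of \<open>{s = 0}\<close>, extended by 0, so that equality of rational functions is
  equality in HOL.
\<close>

definition rational_fun ::
    "nat \<Rightarrow> ((nat \<Rightarrow> complex) \<Rightarrow> complex) \<Rightarrow> ((nat \<Rightarrow> complex) \<Rightarrow> complex) \<Rightarrow> bool"
  where "rational_fun m s g \<longleftrightarrow>
    (\<exists>h N. poly_fun m h \<and> g = (\<lambda>t. if t \<in> compl_locus m s then h t / s t ^ N else 0))"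

text \<open>
  A form \<open>\<omega>\<close> stands for the sum of \<open>\<omega> K dt\<^sub>K\<close> over \<open>K \<subseteq> {1..m}\<close>, where
  \<open>dt\<^sub>K = dt\<^bsub>k\<^sub>1\<^esub> \<and> \<dots> \<and> dt\<^bsub>k\<^sub>n\<^esub>\<close> if \<open>K = {k\<^sub>1 < \<dots> < k\<^sub>n}\<close>.
\<close>

type_synonym form = "nat set \<Rightarrow> (nat \<Rightarrow> complex) \<Rightarrow> complex"

definition rational_forms :: "nat \<Rightarrow> ((nat \<Rightarrow> complex) \<Rightarrow> complex) \<Rightarrow> nat \<Rightarrow> form set"
  where "rational_forms m s n =
    {\<omega>. \<forall>K. if K \<subseteq> {1..m} \<and> card K = n then rational_fun m s (\<omega> K) else \<omega> K = (\<lambda>t. 0)}"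

text \<open>
  The operator \<open>\<nabla> = d + \<Sum>\<^sub>j \<theta>\<^sub>j dt\<^sub>j \<and>\<close>. The sign comes from
  \<open>dt\<^sub>j \<and> dt\<^bsub>K - {j}\<^esub> = (-1)\<^sup>e dt\<^sub>K\<close> for \<open>j \<in> K\<close>, where \<open>e\<close> is the number of elements of \<open>K\<close> below \<open>j\<close>.
\<close>

definition twisted_diff ::
    "nat \<Rightarrow> ((nat \<Rightarrow> complex) \<Rightarrow> complex) \<Rightarrow> (nat \<Rightarrow> (nat \<Rightarrow> complex) \<Rightarrow> complex) \<Rightarrow> form \<Rightarrow> form"
  where "twisted_diff m s \<theta> \<omega> = (\<lambda>K t.
    if K \<subseteq> {1..m} \<and> t \<in> compl_locus m s
    then \<Sum>j\<in>K. (- 1) ^ card {i \<in> K. i < j} *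
           (deriv (\<lambda>w. \<omega> (K - {j}) (t(j := w))) (t j) + \<theta> j t * \<omega> (K - {j}) t)
    else 0)"

definition closed_forms ::
    "nat \<Rightarrow> ((nat \<Rightarrow> complex) \<Rightarrow> complex) \<Rightarrow> (nat \<Rightarrow> (nat \<Rightarrow> complex) \<Rightarrow> complex) \<Rightarrow> nat \<Rightarrow> form set"
  where "closed_forms m s \<theta> n = {\<omega> \<in> rational_forms m s n. twisted_diff m s \<theta> \<omega> = (\<lambda>K t. 0)}"

definition exact_forms ::
    "nat \<Rightarrow> ((nat \<Rightarrow> complex) \<Rightarrow> complex) \<Rightarrow> (nat \<Rightarrow> (nat \<Rightarrow> complex) \<Rightarrow> complex) \<Rightarrow> nat \<Rightarrow> form set"
  where "exact_forms m s \<theta> n =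
    (case n of 0 \<Rightarrow> {\<lambda>K t. 0} | Suc l \<Rightarrow> twisted_diff m s \<theta> ` rational_forms m s l)"

definition cohomology_class ::
    "nat \<Rightarrow> ((nat \<Rightarrow> complex) \<Rightarrow> complex) \<Rightarrow> (nat \<Rightarrow> (nat \<Rightarrow> complex) \<Rightarrow> complex) \<Rightarrow> nat
      \<Rightarrow> form \<Rightarrow> form set"
  where "cohomology_class m s \<theta> n \<omega> =
    {\<eta> \<in> closed_forms m s \<theta> n. (\<lambda>K t. \<eta> K t - \<omega> K t) \<in> exact_forms m s \<theta> n}"

definition cohomology ::
    "nat \<Rightarrow> ((nat \<Rightarrow> complex) \<Rightarrow> complex) \<Rightarrow> (nat \<Rightarrow> (nat \<Rightarrow> complex) \<Rightarrow> complex) \<Rightarrow> nat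
      \<Rightarrow> form set set"
  where "cohomology m s \<theta> n = cohomology_class m s \<theta> n ` closed_forms m s \<theta> n"

definition form_lincomb :: "'u set \<Rightarrow> ('u \<Rightarrow> complex) \<Rightarrow> ('u \<Rightarrow> form) \<Rightarrow> form"
  where "form_lincomb S c \<omega> = (\<lambda>K t. \<Sum>u\<in>S. c u * \<omega> u K t)"

text \<open>
  The classes of the family \<open>\<omega>\<close> over \<open>S\<close> are a \<open>\<complex>\<close>-basis of \<^term>\<open>cohomology m s \<theta> n\<close>: linearly
  independent and spanning. Linear combinations of classes are the classes of linear combinations
  of representatives.
\<close>

definition cohomology_basis ::
    "nat \<Rightarrow> ((nat \<Rightarrow> complex) \<Rightarrow> complex) \<Rightarrow> (nat \<Rightarrow> (nat \<Rightarrow> complex) \<Rightarrow> complex) \<Rightarrow> nat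
      \<Rightarrow> 'u set \<Rightarrow> ('u \<Rightarrow> form) \<Rightarrow> bool"
  where "cohomology_basis m s \<theta> n S \<omega> \<longleftrightarrow>
    finite S \<and> (\<forall>u\<in>S. \<omega> u \<in> closed_forms m s \<theta> n) \<and>
    (\<forall>c. cohomology_class m s \<theta> n (form_lincomb S c \<omega>) = cohomology_class m s \<theta> n (\<lambda>K t. 0)
       \<longrightarrow> (\<forall>u\<in>S. c u = 0)) \<and>
    (\<forall>X\<in>cohomology m s \<theta> n. \<exists>c. X = cohomology_class m s \<theta> n (form_lincomb S c \<omega>))"

definition top_form ::
    "nat \<Rightarrow> ((nat \<Rightarrow> complex) \<Rightarrow> complex) \<Rightarrow> ((nat \<Rightarrow> complex) \<Rightarrow> complex) \<Rightarrow> form"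
  where "top_form m s g =
    (\<lambda>K t. if K = {1..m} \<and> t \<in> compl_locus m s then g t else 0)"


section \<open>The multivalued function \<open>Q\<close>\<close>

text \<open>
  In this section \<open>f j x t\<close>, \<open>1 \<le> j \<le> k\<close>, are the polynomials \<open>f\<^sub>j(x, t)\<close>, with \<open>t = (t\<^sub>1, \<dots>, t\<^sub>m)\<close>.
  \<open>Q_reduced\<close> is \<open>Q'\<close>.
\<close>

definition Q_reduced ::
    "nat \<Rightarrow> nat \<Rightarrow> (nat \<Rightarrow> ('v \<Rightarrow> complex) \<Rightarrow> (nat \<Rightarrow> complex) \<Rightarrow> complex)
      \<Rightarrow> ('v \<Rightarrow> complex) \<Rightarrow> (nat \<Rightarrow> complex) \<Rightarrow> complex"
  where "Q_reduced k m f x t = (\<Prod>j\<in>{1..m}. t j) * (\<Prod>j\<in>{1..k}. f j x t)"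

text \<open>
  \<open>Q = \<Prod>\<^sub>j f\<^sub>j(x,t)\<^bsup>\<alpha>\<^sub>j\<^esup> t\<^sup>\<gamma>\<close> is multivalued. Near a point \<open>(x\<^sub>0, t\<^sub>0)\<close> where \<open>Q'\<close> does not vanish, every
  branch of \<open>Q\<close> is a nonzero constant multiple of the holomorphic function
  \<open>Q_branch k m f \<alpha> \<gamma> x\<^sub>0 t\<^sub>0\<close>, which takes the value 1 at \<open>(x\<^sub>0, t\<^sub>0)\<close>. Hence for every differential
  operator \<open>u\<close> the value of \<open>(u \<bullet> Q) / Q\<close> at \<open>(x\<^sub>0, t\<^sub>0)\<close> does not depend on the branch and
  is obtained by applying \<open>u\<close> to \<open>Q_branch k m f \<alpha> \<gamma> x\<^sub>0 t\<^sub>0\<close> and evaluating at \<open>(x\<^sub>0, t\<^sub>0)\<close>.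
\<close>

definition Q_branch ::
    "nat \<Rightarrow> nat \<Rightarrow> (nat \<Rightarrow> ('v \<Rightarrow> complex) \<Rightarrow> (nat \<Rightarrow> complex) \<Rightarrow> complex)
      \<Rightarrow> (nat \<Rightarrow> complex) \<Rightarrow> (nat \<Rightarrow> complex)
      \<Rightarrow> ('v \<Rightarrow> complex) \<Rightarrow> (nat \<Rightarrow> complex) \<Rightarrow> ('v \<Rightarrow> complex) \<Rightarrow> (nat \<Rightarrow> complex) \<Rightarrow> complex"
  where "Q_branch k m f \<alpha> \<gamma> x\<^sub>0 t\<^sub>0 x t =
    (\<Prod>j\<in>{1..k}. (f j x t / f j x\<^sub>0 t\<^sub>0) powr \<alpha> j) * (\<Prod>j\<in>{1..m}. (t j / t\<^sub>0 j) powr \<gamma> j)"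

text \<open>The rational functions \<open>(\<partial>Q/\<partial>t\<^sub>j) / Q\<close>.\<close>

definition Q_twist ::
    "nat \<Rightarrow> nat \<Rightarrow> (nat \<Rightarrow> ('v \<Rightarrow> complex) \<Rightarrow> (nat \<Rightarrow> complex) \<Rightarrow> complex)
      \<Rightarrow> (nat \<Rightarrow> complex) \<Rightarrow> (nat \<Rightarrow> complex)
      \<Rightarrow> ('v \<Rightarrow> complex) \<Rightarrow> nat \<Rightarrow> (nat \<Rightarrow> complex) \<Rightarrow> complex"
  where "Q_twist k m f \<alpha> \<gamma> x j t =
    deriv (\<lambda>w. Q_branch k m f \<alpha> \<gamma> x t x (t(j := w))) (t j)"

definition partial_x :: "'v \<Rightarrow> (('v \<Rightarrow> complex) \<Rightarrow> complex) \<Rightarrow> ('v \<Rightarrow> complex) \<Rightarrow> complex"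
  where "partial_x v F = (\<lambda>x. deriv (\<lambda>w. F (x(v := w))) (x v))"

text \<open>
  \<open>(u \<bullet> Q) / Q\<close>, where \<open>u\<close> is the product of the \<open>\<partial>/\<partial>x\<^sub>v\<close> with \<open>v\<close> in the given list.
\<close>

definition Q_quotient ::
    "nat \<Rightarrow> nat \<Rightarrow> (nat \<Rightarrow> ('v \<Rightarrow> complex) \<Rightarrow> (nat \<Rightarrow> complex) \<Rightarrow> complex)
      \<Rightarrow> (nat \<Rightarrow> complex) \<Rightarrow> (nat \<Rightarrow> complex)
      \<Rightarrow> ('v \<Rightarrow> complex) \<Rightarrow> 'v list \<Rightarrow> (nat \<Rightarrow> complex) \<Rightarrow> complex"
  where "Q_quotient k m f \<alpha> \<gamma> x u t =
    foldr partial_x u (\<lambda>x'. Q_branch k m f \<alpha> \<gamma> x t x' t) x"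


section \<open>Posets decomposed into two chains\<close>

definition poset_ideal :: "'a::order set \<Rightarrow> 'a set \<Rightarrow> bool"
  where "poset_ideal P I \<longleftrightarrow> I \<subseteq> P \<and> (\<forall>a\<in>I. \<forall>b\<in>P. b \<le> a \<longrightarrow> b \<in> I)"

definition ideal_pairs ::
    "'a::order set \<Rightarrow> nat \<Rightarrow> (nat \<Rightarrow> 'a) \<Rightarrow> nat \<Rightarrow> (nat \<Rightarrow> 'a) \<Rightarrow> (nat \<times> nat) set"
  where "ideal_pairs P p a q b =
    {(i, j). i \<le> p \<and> j \<le> q \<and> poset_ideal P (a ` {1..i} \<union> b ` {1..j})}"

text \<open>\<open>chain_poly A (i + 1)\<close> is \<open>f\<^bsub>i+1\<^esub> = \<Sum>\<^sub>j x\<^bsub>i,j\<^esub> t\<^sub>j\<close>, with \<open>t\<^sub>0 = 1\<close>.\<close>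

definition chain_poly ::
    "(nat \<times> nat) set \<Rightarrow> nat \<Rightarrow> (nat \<times> nat \<Rightarrow> complex) \<Rightarrow> (nat \<Rightarrow> complex) \<Rightarrow> complex"
  where "chain_poly A n x t =
    (\<Sum>j | (n - 1, j) \<in> A. x (n - 1, j) * (if j = 0 then 1 else t j))"

definition j_sharp :: "(nat \<times> nat) set \<Rightarrow> nat \<Rightarrow> nat"
  where "j_sharp A i = (LEAST j. (i, j) \<in> A)"

definition i_flat :: "(nat \<times> nat) set \<Rightarrow> nat \<Rightarrow> nat"
  where "i_flat A j = (LEAST i. (i, j) \<in> A)"

text \<open>
  The monomial \<open>x\<^bsub>i\<^sub>1,j\<^sub>1\<^esub> \<cdots> x\<^bsub>i\<^sub>\<rho>,j\<^sub>\<rho>\<^esub>\<close> with \<open>i\<^sub>1 < \<cdots> < i\<^sub>\<rho>\<close> is encoded by the list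
  \<open>[(i\<^sub>1, j\<^sub>1), \<dots>, (i\<^sub>\<rho>, j\<^sub>\<rho>)]\<close>; as the indices increase, distinct lists give distinct monomials.
\<close>

definition standard_monomials :: "nat \<Rightarrow> nat \<Rightarrow> (nat \<times> nat) set \<Rightarrow> (nat \<times> nat) list set"
  where "standard_monomials p q A =
    {u. set u \<subseteq> A - ((\<lambda>i. (i, j_sharp A i)) ` {0..p} \<union> (\<lambda>j. (i_flat A j, j)) ` {0..q}) \<and>
        set u \<subseteq> {0<..p} \<times> {0<..q} \<and>
        sorted_wrt (\<lambda>(i, j) (i', j'). i < i' \<and> j < j') u}"

end

theory Submission
  imports Defs "HOL-Library.Function_Algebras" "HOL-Library.Multiset"
begin

text \<open>
  Up to factors depending on \<open>\<alpha>\<close>, the functions \<open>t\<^sup>a f\<^sup>-\<^sup>b\<close> are indexed by \<open>(b, a) \<in> \<int>\<^bsup>p+1+q\<^esup>\<close>, and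
  the top cohomology is the space of all finite combinations of such indices modulo the images of
  \<open>p + 1 + q\<close> commuting contiguity operators: those of the rows express \<open>f\<^sub>i f\<^sub>i\<^sup>-\<^sup>1 = 1\<close>, those of the
  columns are \<open>\<nabla>\<^sub>j t\<^sub>j\<close>. Their leading parts are the row and column sums
  \<open>\<Sum>\<^sub>j x\<^sub>i\<^sub>j y\<^sub>i\<^sub>j\<close>, \<open>\<Sum>\<^sub>i x\<^sub>i\<^sub>j y\<^sub>i\<^sub>j\<close> in the toric ring of the products \<open>y\<^sub>i\<^sub>j = s\<^sub>i t\<^sub>j\<close>, \<open>(i, j) \<in> \<A>\<close>.

  For \<open>x\<^sub>i\<^sub>j = \<epsilon>\<^bsup>(i-j)\<^sup>2\<^esup>\<close> and \<open>\<epsilon> \<rightarrow> 0\<close> the toric ring degenerates to the ring of chains, in which products of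
  incomparable pairs vanish; there a direct rewriting shows that \<open>\<S>\<close> spans modulo the row and column
  sums, so it does so for all \<open>x\<close> outside a hypersurface. Assigning to a standard monomial a monotone
  lattice path shows that the semigroup has enough elements in each degree for the toric ring, and
  each of its translates, to be free with basis \<open>\<S>\<close> over the polynomial ring of the operators. Finally
  the facet inequalities of the cone have values outside \<open>\<int>\<close> at generic exponents, so that
  every index can be moved into the cone by the relations, and the quotients for all translates of
  the cone agree.
\<close>

section \<open>Linear algebra of complex functions\<close>


text \<open>Spanning is an open condition, so it passes from degenerate to generic coefficients.
  Independence modulo relations does not pass that way, because the space of relations may grow; it
  is obtained by counting. A relation in cohomology may run through exponents far outside the cone,
  where no degree is available. It involves finitely many exponents, however, so it lives in one
  translate of the cone. The counting there concerns the translated copy of S. Since S itself also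
  spans the translate modulo relations, a relation inside S would leave a spanning set that is too
  small by one. Spanning is required in all degrees, yet the exceptional x must form one
  hypersurface. This works because S has no element of degree above p, so the degrees up to p + 1
  decide. The weight (i - j)^2 is strictly lowered by uncrossing a pair, so each degree has one
  minimal monomial, and it is a chain. The Gamma factors attached to the powers of the f_i make the
  contiguity operators commute with coefficients that are linear in the exponent.\<close>

definition cscale :: "complex \<Rightarrow> ('v \<Rightarrow> complex) \<Rightarrow> 'v \<Rightarrow> complex"
  where "cscale c g = (\<lambda>v. c * g v)"

lemma cscale_apply [simp]: "cscale c g v = c * g v"
  by (simp add: cscale_def)

global_interpretation fs: vector_space "cscale :: complex \<Rightarrow> ('v \<Rightarrow> complex) \<Rightarrow> 'v \<Rightarrow> complex"
  by unfold_locales (auto simp: cscale_def fun_eq_iff algebra_simps)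

definition delta :: "'v \<Rightarrow> 'v \<Rightarrow> complex"
  where "delta v = (\<lambda>w. of_bool (w = v))"

lemma delta_apply: "delta v w = of_bool (w = v)"
  by (simp add: delta_def)

lemma sum_fun_apply: "(\<Sum>i\<in>I. f i) x = (\<Sum>i\<in>I. f i x)" for f :: "'i \<Rightarrow> 'x \<Rightarrow> 'b::comm_monoid_add"
  by (induction I rule: infinite_finite_induct) auto

lemma inj_delta: "inj delta"
  by (rule injI) (metis delta_apply of_bool_eq(1,2) zero_neq_one)

lemma independent_delta: "fs.independent (delta ` X)"
proof
  assume "fs.dependent (delta ` X)"
  then obtain v where v: "v \<in> X" "delta v \<in> fs.span (delta ` X - {delta v})"
    by (auto simp: fs.dependent_def)
  have "fs.span (delta ` X - {delta v}) \<subseteq> {g. g v = 0}"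
    by (rule fs.span_minimal) (auto simp: fs.subspace_def delta_apply)
  with v have "delta v v = 0"
    by auto
  then show False
    by (simp add: delta_apply)
qed

text \<open>The only dimension count of the development; the independence of the standard monomials
  will contradict it.\<close>

lemma card_le_of_delta_in_span:
  assumes "finite G" and "\<And>v. v \<in> X \<Longrightarrow> delta v \<in> fs.span G"
  shows "card X \<le> card G"
proof -
  have "card (delta ` X) \<le> card G"
    using fs.independent_span_bound[OF assms(1) independent_delta, of X] assms(2) by auto
  moreover have "card (delta ` X) = card X"
    by (rule card_image) (meson inj_delta inj_on_subset subset_UNIV)
  ultimately show ?thesis by simp
qed

lemma span_image_explicit:
  assumes "finite J"
  shows "x \<in> fs.span (f ` J) \<longleftrightarrow> (\<exists>s. x = (\<Sum>j\<in>J. cscale (s j) (f j)))"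
proof
  show "\<exists>s. x = (\<Sum>j\<in>J. cscale (s j) (f j))" if "x \<in> fs.span (f ` J)"
    using that
  proof (induction rule: fs.span_induct_alt)
    case base
    show ?case by (rule exI[of _ "\<lambda>_. 0"]) auto
  next
    case (step c x y)
    then obtain j s where j: "j \<in> J" "x = f j" and s: "y = (\<Sum>j\<in>J. cscale (s j) (f j))"
      by blast
    have "cscale c x + y = (\<Sum>i\<in>J. cscale ((s(j := s j + c)) i) (f i))"
      unfolding s j(2) using assms j(1)
      by (simp add: sum.remove[of J j] fs.scale_left_distrib algebra_simps)
    then show ?case by blast
  qed
  show "x \<in> fs.span (f ` J)" if "\<exists>s. x = (\<Sum>j\<in>J. cscale (s j) (f j))"
    using that by (blast intro: fs.span_sum fs.span_scale fs.span_base)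
qed

text \<open>Solvability of a finite linear system is the form in which spanning can be followed
  along a parameter. Testing on \<open>I\<close> alone loses nothing because the \<open>f j\<close>
  vanish elsewhere.\<close>

lemma span_image_iff:
  assumes "finite I" "finite J" and supp: "\<And>j i. j \<in> J \<Longrightarrow> i \<notin> I \<Longrightarrow> f j i = 0"
  shows "(\<forall>i\<in>I. delta i \<in> fs.span (f ` J)) \<longleftrightarrow> (\<forall>g. \<exists>s. \<forall>i\<in>I. g i = (\<Sum>j\<in>J. s j * f j i))"
proof
  assume L: "\<forall>i\<in>I. delta i \<in> fs.span (f ` J)"
  show "\<forall>g. \<exists>s. \<forall>i\<in>I. g i = (\<Sum>j\<in>J. s j * f j i)"
  proof
    fix g :: "'a \<Rightarrow> complex"
    have "(\<Sum>i\<in>I. cscale (g i) (delta i)) \<in> fs.span (f ` J)"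
      using L by (intro fs.span_sum fs.span_scale) auto
    then obtain s where s: "(\<Sum>i\<in>I. cscale (g i) (delta i)) = (\<Sum>j\<in>J. cscale (s j) (f j))"
      using span_image_explicit[OF assms(2)] by blast
    have "g i = (\<Sum>j\<in>J. s j * f j i)" if "i \<in> I" for i
      using fun_cong[OF s, of i] that assms(1)
      by (simp add: sum_fun_apply delta_apply of_bool_def if_distrib cong: if_cong)
    then show "\<exists>s. \<forall>i\<in>I. g i = (\<Sum>j\<in>J. s j * f j i)" by blast
  qed
next
  assume R: "\<forall>g. \<exists>s. \<forall>i\<in>I. g i = (\<Sum>j\<in>J. s j * f j i)"
  show "\<forall>i\<in>I. delta i \<in> fs.span (f ` J)"
  proof
    fix i assume "i \<in> I"
    obtain s where s: "\<forall>l\<in>I. delta i l = (\<Sum>j\<in>J. s j * f j l)"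
      using R by blast
    have "delta i = (\<Sum>j\<in>J. cscale (s j) (f j))"
    proof
      fix l show "delta i l = (\<Sum>j\<in>J. cscale (s j) (f j)) l"
        using s supp \<open>i \<in> I\<close> by (cases "l \<in> I") (auto simp: sum_fun_apply delta_apply)
    qed
    then show "delta i \<in> fs.span (f ` J)"
      using span_image_explicit[OF assms(2)] by blast
  qed
qed

text \<open>Gaussian elimination with a pivot that is nonzero at \<open>x\<^sub>0\<close>; \<open>D\<close> is the product of the pivots.\<close>

lemma spanning_open:
  fixes f :: "'j \<Rightarrow> 'x \<Rightarrow> 'i \<Rightarrow> complex"
  assumes "finite I" "finite J"
    and "(\<lambda>x. 1) \<in> C"
    and mult: "\<And>g h. g \<in> C \<Longrightarrow> h \<in> C \<Longrightarrow> (\<lambda>x. g x * h x) \<in> C"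
    and diff: "\<And>g h. g \<in> C \<Longrightarrow> h \<in> C \<Longrightarrow> (\<lambda>x. g x - h x) \<in> C"
    and "\<And>j i. j \<in> J \<Longrightarrow> i \<in> I \<Longrightarrow> (\<lambda>x. f j x i) \<in> C"
    and "\<forall>g. \<exists>s. \<forall>i\<in>I. g i = (\<Sum>j\<in>J. s j * f j x0 i)"
  shows "\<exists>D\<in>C. D x0 \<noteq> 0 \<and> (\<forall>x. D x \<noteq> 0 \<longrightarrow> (\<forall>g. \<exists>s. \<forall>i\<in>I. g i = (\<Sum>j\<in>J. s j * f j x i)))"
  using assms(1,6,7)
proof (induction I arbitrary: f rule: finite_induct)
  case empty
  show ?case by (rule bexI[OF _ assms(3)]) auto
next
  case (insert i I)
  \<comment> \<open>If every entry in position \<open>i\<close> vanished, a right-hand side with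
    value 1 there could not be reached.\<close>
  obtain j0 where j0: "j0 \<in> J" "f j0 x0 i \<noteq> 0"
  proof (rule ccontr)
    assume "\<not> thesis"
    with that have "\<forall>j\<in>J. f j x0 i = 0" by blast
    moreover obtain s where "\<forall>l\<in>insert i I. (1::complex) = (\<Sum>j\<in>J. s j * f j x0 l)"
      using insert.prems(2)[rule_format, of "\<lambda>_. 1"] by blast
    ultimately show False by auto
  qed
  \<comment> \<open>Elimination by cross-multiplication: \<open>C\<close> is closed under products
    and differences, but not under division.\<close>
  define f' where "f' j x l = f j0 x i * f j x l - f j x i * f j0 x l" for j x l
  have sum_f': "(\<Sum>j\<in>J. s j * f' j x l) =
      f j0 x i * (\<Sum>j\<in>J. s j * f j x l) - (\<Sum>j\<in>J. s j * f j x i) * f j0 x l" for s x l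
    by (simp add: f'_def sum_distrib_left sum_distrib_right sum_subtractf[symmetric] algebra_simps)
  have "\<forall>g. \<exists>s. \<forall>l\<in>I. g l = (\<Sum>j\<in>J. s j * f' j x0 l)"
  proof
    fix g :: "'i \<Rightarrow> complex"
    obtain s where s: "\<forall>l\<in>insert i I. (g(i := 0)) l = (\<Sum>j\<in>J. s j * f j x0 l)"
      using insert.prems(2) by blast
    have "g l = (\<Sum>j\<in>J. (s j / f j0 x0 i) * f' j x0 l)" if "l \<in> I" for l
    proof -
      have "l \<noteq> i" using that insert.hyps by auto
      then have "(\<Sum>j\<in>J. s j * f j x0 l) = g l" "(\<Sum>j\<in>J. s j * f j x0 i) = 0"
        using bspec[OF s, of l] bspec[OF s, of i] that by simp_all
      then have "(\<Sum>j\<in>J. s j * f' j x0 l) = f j0 x0 i * g l"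
        by (simp add: sum_f')
      then show ?thesis
        using j0(2) by (simp add: sum_divide_distrib[symmetric] field_simps)
    qed
    then show "\<exists>s. \<forall>l\<in>I. g l = (\<Sum>j\<in>J. s j * f' j x0 l)"
      by (intro exI[of _ "\<lambda>j. s j / f j0 x0 i"]) blast
  qed
  moreover have "(\<lambda>x. f' j x l) \<in> C" if "j \<in> J" "l \<in> I" for j l
    unfolding f'_def using insert.prems(1) that j0(1) by (intro diff mult) auto
  ultimately obtain D where D: "D \<in> C" "D x0 \<noteq> 0"
    "\<And>x g. D x \<noteq> 0 \<Longrightarrow> \<exists>s. \<forall>l\<in>I. g l = (\<Sum>j\<in>J. s j * f' j x l)"
    using insert.IH[of f'] by blast
  show ?case
  proof (intro bexI[of _ "\<lambda>x. f j0 x i * D x"] conjI allI impI)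
    show "(\<lambda>x. f j0 x i * D x) \<in> C"
      using D(1) j0(1) insert.prems(1) by (intro mult) auto
    show "f j0 x0 i * D x0 \<noteq> 0"
      using D(2) j0(2) by simp
    fix x g assume x: "f j0 x i * D x \<noteq> 0"
    let ?c = "f j0 x i"
    obtain s where s: "\<forall>l\<in>I. g l - (g i / ?c) * f j0 x l = (\<Sum>j\<in>J. s j * f' j x l)"
      using D(3)[of x "\<lambda>l. g l - (g i / ?c) * f j0 x l"] x by auto
    define r where "r = (\<Sum>j\<in>J. s j * f j x i)"
    \<comment> \<open>The coefficient of the pivot is corrected so that position \<open>i\<close>
      receives \<open>g i\<close>; in the other positions the two terms with \<open>r\<close>
      cancel.\<close>
    define s' where "s' j = ?c * s j + (if j = j0 then g i / ?c - r else 0)" for j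
    have sum_s': "(\<Sum>j\<in>J. s' j * f j x l) = ?c * (\<Sum>j\<in>J. s j * f j x l) + (g i / ?c - r) * f j0 x l" for l
      using assms(2) j0(1)
      by (simp add: s'_def distrib_right sum.distrib sum_distrib_left if_distrib[of "\<lambda>z. z * _"] mult.assoc
          cong: if_cong)
    have "g l = (\<Sum>j\<in>J. s' j * f j x l)" if "l \<in> insert i I" for l
    proof (cases "l = i")
      case True
      then show ?thesis using x by (simp add: sum_s' r_def[symmetric] field_simps)
    next
      case False
      with that have "g l - (g i / ?c) * f j0 x l = ?c * (\<Sum>j\<in>J. s j * f j x l) - r * f j0 x l"
        using s by (auto simp: sum_f' r_def)
      then show ?thesis by (simp add: sum_s' algebra_simps)
    qed
    then show "\<exists>s. \<forall>l\<in>insert i I. g l = (\<Sum>j\<in>J. s j * f j x l)" by blast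
  qed
qed


section \<open>Ladders and their semigroup\<close>


text \<open>\<open>Inl i\<close> carries the power of 1/f_{i+1} and \<open>Inr j\<close> the power
  of t_j. Column 0 has no coordinate because t_0 = 1; its degree is the sum over all rows minus the
  sum over the other columns.\<close>

type_synonym expo = "nat + nat \<Rightarrow> int"

text \<open>\<open>Inl\<close> labels a standard monomial, \<open>Inr (k, v)\<close> the leading
  part of operator \<open>k\<close> at the exponent \<open>v\<close>.\<close>

type_synonym gen_label = "(nat \<times> nat) list + (nat + nat) \<times> expo"

definition vec :: "nat \<times> nat \<Rightarrow> expo"
  where "vec a k = (case k of Inl i \<Rightarrow> of_bool (fst a = i) | Inr j \<Rightarrow> of_bool (snd a = j \<and> j \<noteq> 0))"

lemma vec_simps [simp]:
  "vec a (Inl i) = of_bool (fst a = i)"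
  "vec a (Inr j) = of_bool (snd a = j \<and> j \<noteq> 0)"
  by (simp_all add: vec_def)

lemma vec_nonneg: "0 \<le> vec a k"
  by (cases k) auto

definition deg :: "(nat \<times> nat) multiset \<Rightarrow> expo"
  where "deg M = (\<Sum>a\<in>#M. vec a)"

lemma deg_simps:
  "deg {#} = 0" "deg (add_mset a M) = vec a + deg M" "deg (M + N) = deg M + deg N"
  by (simp_all add: deg_def)

lemma deg_apply [simp]:
  "deg {#} k = 0" "deg (add_mset a M) k = vec a k + deg M k" "deg (M + N) k = deg M k + deg N k"
  by (simp_all add: deg_simps)

lemma deg_nonneg: "0 \<le> deg M k"
  by (induction M) (auto simp: vec_nonneg)

lemma deg_Inl_pos_iff: "0 < deg M (Inl i) \<longleftrightarrow> (\<exists>j. (i, j) \<in># M)"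
proof (induction M)
  case (add a M)
  then show ?case using deg_nonneg[of M "Inl i"] by (cases a) auto
qed simp

lemma deg_Inr_pos_iff: "0 < deg M (Inr j) \<longleftrightarrow> j \<noteq> 0 \<and> (\<exists>i. (i, j) \<in># M)"
proof (induction M)
  case (add a M)
  then show ?case using deg_nonneg[of M "Inr j"] by (cases a) auto
qed simp

text \<open>Multichains of the product order: entries in a common row or column are always
  comparable, so only strict crossings are excluded.\<close>

definition chain :: "(nat \<times> nat) multiset \<Rightarrow> bool"
  where "chain M \<longleftrightarrow> (\<forall>(i, j)\<in>#M. \<forall>(i', j')\<in>#M. i < i' \<longrightarrow> j \<le> j')"

lemma chain_empty [simp]: "chain {#}"
  by (simp add: chain_def)

lemma chain_diff: "chain M \<Longrightarrow> chain (M - N)"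
  unfolding chain_def by (blast dest: in_diffD)

lemma chain_min:
  assumes "chain M" and "M \<noteq> {#}"
  obtains i j where "(i, j) \<in># M" and "\<And>i' j'. (i', j') \<in># M \<Longrightarrow> i \<le> i' \<and> j \<le> j'"
proof -
  define i where "i = (LEAST i. \<exists>j. (i, j) \<in># M)"
  define j where "j = (LEAST j. (i, j) \<in># M)"
  obtain i1 j1 where "(i1, j1) \<in># M"
    using assms(2) by (metis multiset_nonemptyE surj_pair)
  then have "\<exists>j. (i, j) \<in># M"
    unfolding i_def by (intro LeastI[of "\<lambda>i. \<exists>j. (i, j) \<in># M"]) blast
  then have ij: "(i, j) \<in># M"
    unfolding j_def by (metis LeastI)
  have "i \<le> i' \<and> j \<le> j'" if "(i', j') \<in># M" for i' j'
  proof -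
    have "i \<le> i'" unfolding i_def using that by (metis (mono_tags, lifting) Least_le)
    moreover have "j \<le> j'"
    proof (cases "i = i'")
      case True
      then show ?thesis unfolding j_def using that by (metis Least_le)
    next
      case False
      then show ?thesis using \<open>i \<le> i'\<close> assms(1) ij that unfolding chain_def by fastforce
    qed
    ultimately show ?thesis by blast
  qed
  with ij show thesis by (rule that)
qed

text \<open>Only the mixed term -2ij of the square matters for uncrossing; the pure squares make the
  weight a natural number.\<close>

definition wt :: "nat \<times> nat \<Rightarrow> nat"
  where "wt a = nat ((int (fst a) - int (snd a))\<^sup>2)"

definition wts :: "(nat \<times> nat) multiset \<Rightarrow> nat"
  where "wts M = (\<Sum>a\<in>#M. wt a)"

lemma wts_simps [simp]: "wts {#} = 0" "wts (add_mset a M) = wt a + wts M"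
  by (simp_all add: wts_def)

text \<open>The pure squares cancel, and the right side exceeds the left by 2 (i' - i) (j -
  j').\<close>

lemma wt_uncross:
  assumes "i < i'" and "j' < j"
  shows "wt (i, j') + wt (i', j) < wt (i, j) + wt (i', j')"
proof -
  have "0 < (int i' - int i) * (int j - int j')"
    using assms by simp
  then have "(int i - int j')\<^sup>2 + (int i' - int j)\<^sup>2 < (int i - int j)\<^sup>2 + (int i' - int j')\<^sup>2"
    by (simp add: power2_eq_square algebra_simps)
  moreover have "0 < (int i - int j)\<^sup>2 + (int i' - int j')\<^sup>2"
    using calculation zero_le_power2[of "int i - int j'"] zero_le_power2[of "int i' - int j"] by linarith
  ultimately show ?thesis
    by (simp add: wt_def nat_add_distrib[symmetric])
qed

text \<open>Closure under meet and join of incomparable pairs and descent to (0, 0) by unit steps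
  are all that the combinatorics takes from the poset. The conditions are symmetric in rows and
  columns.\<close>

locale ladder =
  fixes p q :: nat and A :: "(nat \<times> nat) set"
  assumes A_bounds: "(i, j) \<in> A \<Longrightarrow> i \<le> p \<and> j \<le> q"
    and top_in: "(p, q) \<in> A"
    and meet_join: "(i, j) \<in> A \<Longrightarrow> (i', j') \<in> A \<Longrightarrow> i \<le> i' \<Longrightarrow> j' \<le> j \<Longrightarrow> (i, j') \<in> A \<and> (i', j) \<in> A"
    and step_down: "(i, j) \<in> A \<Longrightarrow> (i, j) \<noteq> (0, 0) \<Longrightarrow>
      (0 < i \<and> (i - 1, j) \<in> A) \<or> (0 < j \<and> (i, j - 1) \<in> A)"
begin

text \<open>Transposition turns every statement about rows into one about columns.\<close>

lemma flip: "ladder q p (A\<inverse>)"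
proof
  show "(i, j) \<in> A\<inverse> \<Longrightarrow> i \<le> q \<and> j \<le> p" for i j using A_bounds by auto
  show "(q, p) \<in> A\<inverse>" using top_in by simp
  show "(i, j') \<in> A\<inverse> \<and> (i', j) \<in> A\<inverse>"
    if "(i, j) \<in> A\<inverse>" "(i', j') \<in> A\<inverse>" "i \<le> i'" "j' \<le> j" for i j i' j'
    using meet_join[of j' i' j i] that by simp
  show "0 < i \<and> (i - 1, j) \<in> A\<inverse> \<or> 0 < j \<and> (i, j - 1) \<in> A\<inverse>"
    if "(i, j) \<in> A\<inverse>" "(i, j) \<noteq> (0, 0)" for i j
    using step_down[of j i] that by auto
qed

lemma finite_A: "finite A"
  by (rule finite_subset[of _ "{..p} \<times> {..q}"]) (use A_bounds in auto)

lemma j_sharp_le: "(i, j) \<in> A \<Longrightarrow> j_sharp A i \<le> j"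
  unfolding j_sharp_def by (rule Least_le)

lemma row_step:
  assumes "(i, j_sharp A i) \<in> A" and "0 < i"
  shows "(i - 1, j_sharp A i) \<in> A"
proof -
  have "\<not> (0 < j_sharp A i \<and> (i, j_sharp A i - 1) \<in> A)"
    using j_sharp_le[of i "j_sharp A i - 1"] by auto
  then show ?thesis
    using step_down[OF assms(1)] assms(2) by auto
qed

text \<open>Descent from the top row: the minimal cell of row i + 1 cannot step to the left, so the
  cell with the same column in row i belongs to \<open>A\<close>. In particular no row is
  empty.\<close>

lemma j_sharp_in: "i \<le> p \<Longrightarrow> (i, j_sharp A i) \<in> A"
proof (induction rule: inc_induct)
  case base
  show ?case unfolding j_sharp_def using top_in by (rule LeastI)
next
  case (step i)
  then have "(i, j_sharp A (Suc i)) \<in> A"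
    using row_step[of "Suc i"] by simp
  then show ?case unfolding j_sharp_def[of A i] by (rule LeastI)
qed

lemma j_sharp_prev_in: "0 < i \<Longrightarrow> i \<le> p \<Longrightarrow> (i - 1, j_sharp A i) \<in> A"
  using row_step j_sharp_in by blast

lemma j_sharp_0 [simp]: "j_sharp A 0 = 0"
proof (rule ccontr)
  assume *: "j_sharp A 0 \<noteq> 0"
  then have "(0, j_sharp A 0 - 1) \<in> A"
    using step_down[OF j_sharp_in[of 0]] by auto
  then show False
    using j_sharp_le[of 0 "j_sharp A 0 - 1"] * by auto
qed

lemma j_sharp_mono:
  assumes "i \<le> i'" and "i' \<le> p"
  shows "j_sharp A i \<le> j_sharp A i'"
proof (rule ccontr)
  assume *: "\<not> ?thesis"
  then have "(i, j_sharp A i') \<in> A"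
    using meet_join[of i "j_sharp A i" i' "j_sharp A i'"] j_sharp_in assms by simp
  then show False
    using j_sharp_le * by blast
qed

lemma i_flat_converse: "i_flat A j = j_sharp (A\<inverse>) j"
  by (simp add: i_flat_def j_sharp_def)

lemma i_flat_le: "(i, j) \<in> A \<Longrightarrow> i_flat A j \<le> i"
  using ladder.j_sharp_le[OF flip, of j i] by (simp add: i_flat_converse)

lemma i_flat_in: "j \<le> q \<Longrightarrow> (i_flat A j, j) \<in> A"
  using ladder.j_sharp_in[OF flip, of j] by (simp add: i_flat_converse)

lemma i_flat_0 [simp]: "i_flat A 0 = 0"
  using ladder.j_sharp_0[OF flip] by (simp add: i_flat_converse)

lemma i_flat_mono: "j \<le> j' \<Longrightarrow> j' \<le> q \<Longrightarrow> i_flat A j \<le> i_flat A j'"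
  using ladder.j_sharp_mono[OF flip] by (simp add: i_flat_converse)

text \<open>The ladder is the region between two monotone staircases: (i, j) is the join of the
  minimal cell of its column and the minimal cell of its row.\<close>

lemma mem_A_iff: "(i, j) \<in> A \<longleftrightarrow> i \<le> p \<and> j \<le> q \<and> j_sharp A i \<le> j \<and> i_flat A j \<le> i"
proof
  show "(i, j) \<in> A \<Longrightarrow> i \<le> p \<and> j \<le> q \<and> j_sharp A i \<le> j \<and> i_flat A j \<le> i"
    using A_bounds j_sharp_le i_flat_le by blast
  show "i \<le> p \<and> j \<le> q \<and> j_sharp A i \<le> j \<and> i_flat A j \<le> i \<Longrightarrow> (i, j) \<in> A"
    using meet_join[of "i_flat A j" j i "j_sharp A i"] j_sharp_in i_flat_in by blast
qed

section \<open>Facet inequalities and lattice points of the cone\<close>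

definition Idx :: "(nat + nat) set"
  where "Idx = Inl ` {0..p} \<union> Inr ` {1..q}"

lemma finite_Idx: "finite Idx"
  by (simp add: Idx_def)

text \<open>The ring is left open because a functional is evaluated both on integral exponents and
  on complex parameters.\<close>

definition pairing :: "expo \<Rightarrow> (nat + nat \<Rightarrow> 'b::comm_ring_1) \<Rightarrow> 'b"
  where "pairing c v = (\<Sum>k\<in>Idx. of_int (c k) * v k)"

lemma pairing_sum:
  "pairing c v = (\<Sum>i=0..p. of_int (c (Inl i)) * v (Inl i)) + (\<Sum>j=1..q. of_int (c (Inr j)) * v (Inr j))"
  unfolding pairing_def Idx_def
  by (subst sum.union_disjoint) (auto simp: sum.reindex)

lemma pairing_add: "pairing c (v + w) = pairing c v + pairing c w"
  by (simp add: pairing_def algebra_simps sum.distrib)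

lemma pairing_diff: "pairing c (v - w) = pairing c v - pairing c w"
  by (simp add: pairing_def algebra_simps sum_subtractf)

lemma pairing_0 [simp]: "pairing c 0 = 0"
  by (simp add: pairing_def)

lemma pairing_vec:
  assumes "i \<le> p" and "j \<le> q"
  shows "pairing c (vec (i, j)) = c (Inl i) + (if j = 0 then 0 else c (Inr j))"
proof -
  have "(\<Sum>i'=0..p. c (Inl i') * vec (i, j) (Inl i')) = c (Inl i)"
    using assms by (simp add: of_bool_def if_distrib[of "\<lambda>z. _ * z"] cong: if_cong)
  moreover have "(\<Sum>j'=1..q. c (Inr j') * vec (i, j) (Inr j')) = (if j = 0 then 0 else c (Inr j))"
  proof -
    have "(\<Sum>j'=1..q. c (Inr j') * vec (i, j) (Inr j')) = (\<Sum>j'=1..q. if j = j' then c (Inr j') else 0)"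
      by (rule sum.cong) auto
    then show ?thesis using assms by simp
  qed
  ultimately show ?thesis by (simp add: pairing_sum)
qed

definition zero_col :: expo
  where "zero_col k = (case k of Inl _ \<Rightarrow> 1 | Inr _ \<Rightarrow> -1)"

definition row_facet :: "nat \<Rightarrow> nat + nat \<Rightarrow> int"
  where "row_facet i k = (if j_sharp A i = 0
     then (case k of Inl i' \<Rightarrow> of_bool (i' < i) | Inr _ \<Rightarrow> 0)
     else (case k of Inl i' \<Rightarrow> - of_bool (i \<le> i') | Inr j \<Rightarrow> of_bool (j_sharp A i \<le> j)))"

definition col_facet :: "nat \<Rightarrow> nat + nat \<Rightarrow> int"
  where "col_facet j k =
     (case k of Inl i \<Rightarrow> of_bool (i_flat A j \<le> i) | Inr j' \<Rightarrow> - of_bool (j \<le> j'))"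

definition coord :: "nat + nat \<Rightarrow> nat + nat \<Rightarrow> int"
  where "coord k l = of_bool (l = k)"

text \<open>
  For an exponent \<open>(b, a)\<close> put \<open>a\<^sub>0 = \<Sum>\<^sub>i b\<^sub>i - \<Sum>\<^sub>j a\<^sub>j\<close>, which is the value of \<open>zero_col\<close>. Then \<open>row_facet i\<close> is
  the sum of the \<open>b\<^sub>l\<close>, \<open>l < i\<close>, minus the sum of the \<open>a\<^sub>l\<close>, \<open>l < j_sharp A i\<close>, and \<open>col_facet j\<close> is the same with
  rows and columns exchanged; the formulas above eliminate \<open>a\<^sub>0\<close>.
\<close>

definition facets :: "expo set"
  where "facets = coord ` Idx \<union> {zero_col} \<union> row_facet ` {1..p} \<union> col_facet ` {1..q}"

lemma finite_facets: "finite facets"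
  by (simp add: facets_def finite_Idx)

lemma pairing_coord: "k \<in> Idx \<Longrightarrow> pairing (coord k) v = v k"
  by (simp add: pairing_def coord_def of_bool_def if_distrib[of "\<lambda>z. z * _"] if_distrib[of of_int] finite_Idx cong: if_cong)

text \<open>A column left of \<open>j_sharp A i\<close> meets the ladder only in rows before i, so
  its cells are counted among those rows; the same holds with rows and columns exchanged.\<close>

lemma facet_vec_nonneg:
  assumes "c \<in> facets" and "a \<in> A"
  shows "0 \<le> pairing c (vec a)"
proof -
  obtain i j where a: "a = (i, j)" by fastforce
  have b: "i \<le> p" "j \<le> q" "j_sharp A i \<le> j" "i_flat A j \<le> i"
    using assms(2) a mem_A_iff by blast+
  have "0 \<le> pairing (row_facet i') (vec (i, j))" if "i' \<in> {1..p}" for i'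
    using that b j_sharp_mono[of i' i] by (auto simp: pairing_vec row_facet_def)
  moreover have "0 \<le> pairing (col_facet j') (vec (i, j))" if "j' \<in> {1..q}" for j'
    using that b i_flat_mono[of j' j] by (auto simp: pairing_vec col_facet_def)
  ultimately show ?thesis
    using assms(1) b unfolding facets_def a
    by (auto simp: pairing_coord vec_nonneg) (simp add: pairing_vec zero_col_def)
qed

lemma pairing_row_facet:
  fixes v :: expo
  assumes "i \<in> {1..p}"
  shows "pairing (row_facet i) v = (if j_sharp A i = 0 then (\<Sum>i'=0..<i. v (Inl i'))
    else (\<Sum>j=j_sharp A i..q. v (Inr j)) - (\<Sum>i'=i..p. v (Inl i')))"
proof -
  have 1: "(\<Sum>i'=0..p. of_bool (i' < i) * v (Inl i')) = (\<Sum>i'=0..<i. v (Inl i'))"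
    using assms by (intro sum.mono_neutral_cong_right) auto
  have 2: "(\<Sum>i'=0..p. of_bool (i \<le> i') * v (Inl i')) = (\<Sum>i'=i..p. v (Inl i'))"
    using assms by (intro sum.mono_neutral_cong_right) auto
  have 3: "(\<Sum>j=1..q. of_bool (j_sharp A i \<le> j) * v (Inr j)) = (\<Sum>j=j_sharp A i..q. v (Inr j))" if "j_sharp A i \<noteq> 0"
    using that by (intro sum.mono_neutral_cong_right) auto
  show ?thesis
    unfolding pairing_sum row_facet_def using 1 2 3
    by (auto simp: sum_negf simp del: sum_mult_of_bool_eq sum_of_bool_mult_eq One_nat_def)
qed

lemma pairing_col_facet:
  fixes v :: expo
  assumes "j \<in> {1..q}"
  shows "pairing (col_facet j) v = (\<Sum>i=i_flat A j..p. v (Inl i)) - (\<Sum>j'=j..q. v (Inr j'))"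
proof -
  have 1: "(\<Sum>i=0..p. of_bool (i_flat A j \<le> i) * v (Inl i)) = (\<Sum>i=i_flat A j..p. v (Inl i))"
    by (intro sum.mono_neutral_cong_right) auto
  have 2: "(\<Sum>j'=1..q. of_bool (j \<le> j') * v (Inr j')) = (\<Sum>j'=j..q. v (Inr j'))"
    using assms by (intro sum.mono_neutral_cong_right) auto
  show ?thesis
    unfolding pairing_sum col_facet_def using 1 2
    by (auto simp: sum_negf simp del: sum_mult_of_bool_eq sum_of_bool_mult_eq One_nat_def)
qed

lemma pairing_zero_col:
  fixes v :: expo
  shows "pairing zero_col v = (\<Sum>i=0..p. v (Inl i)) - (\<Sum>j=1..q. v (Inr j))"
  by (simp add: pairing_sum zero_col_def sum_negf)

definition supported :: "expo \<Rightarrow> bool"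
  where "supported v \<longleftrightarrow> (\<forall>k. k \<notin> Idx \<longrightarrow> v k = 0)"

lemma supported_vec: "a \<in> A \<Longrightarrow> supported (vec a)"
  using A_bounds by (cases a) (auto simp: supported_def Idx_def vec_def split: sum.splits)

lemma supported_deg: "set_mset M \<subseteq> A \<Longrightarrow> supported (deg M)"
proof (induction M)
  case (add a M)
  then show ?case using supported_vec[of a] by (simp add: supported_def)
qed (simp add: supported_def deg_simps)

text \<open>The north-west corner rule for transportation problems. The first nonempty row and the
  first nonempty column meet inside the ladder, and removing that cell preserves every inequality.
  Thus the semigroup is exactly the set of lattice points of its cone.\<close>

lemma in_cone_imp_deg:
  assumes "supported v" and "\<And>c. c \<in> facets \<Longrightarrow> 0 \<le> pairing c v"
  shows "\<exists>M. set_mset M \<subseteq> A \<and> deg M = v"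
  using assms
proof (induction "nat (\<Sum>i=0..p. v (Inl i))" arbitrary: v rule: less_induct)
  case less
  have coord_nonneg: "0 \<le> v k" for k
  proof (cases "k \<in> Idx")
    case True
    then have "coord k \<in> facets" by (simp add: facets_def)
    from less.prems(2)[OF this] show ?thesis using True by (simp add: pairing_coord)
  qed (use less.prems(1) in \<open>simp add: supported_def\<close>)
  define n where "n = (\<Sum>i=0..p. v (Inl i))"
  define a0 where "a0 = n - (\<Sum>j=1..q. v (Inr j))"
  have a0: "0 \<le> a0"
    using less.prems(2)[of zero_col] by (simp add: facets_def pairing_zero_col a0_def n_def)
  show ?case
  proof (cases "n = 0")
    case True
    have "v (Inl i) = 0" if "i \<le> p" for i
      using True that sum_nonneg_eq_0_iff[of "{0..p}" "\<lambda>i. v (Inl i)"] coord_nonneg by (auto simp: n_def)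
    moreover have "(\<Sum>j=1..q. v (Inr j)) = 0"
      using a0 True sum_nonneg[of "{1..q}" "\<lambda>j. v (Inr j)"] coord_nonneg unfolding a0_def by fastforce
    then have "v (Inr j) = 0" if "1 \<le> j" "j \<le> q" for j
      using that sum_nonneg_eq_0_iff[of "{1..q}" "\<lambda>j. v (Inr j)"] coord_nonneg by auto
    ultimately have "v k = 0" for k
      using less.prems(1) unfolding supported_def Idx_def by (cases "k \<in> Idx") (auto simp: Idx_def)
    then show ?thesis
      by (intro exI[of _ "{#}"]) auto
  next
    case False
    then obtain i1 where i1: "i1 \<le> p" "v (Inl i1) \<noteq> 0"
      unfolding n_def by (metis atLeastAtMost_iff sum.neutral)
    define i0 where "i0 = (LEAST i. v (Inl i) \<noteq> 0)"
    have i0: "v (Inl i0) \<noteq> 0" "i0 \<le> p" and i0_min: "\<And>i. i < i0 \<Longrightarrow> v (Inl i) = 0"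
      using i1 unfolding i0_def
      by (metis (mono_tags, lifting) LeastI, metis (mono_tags, lifting) Least_le le_trans,
          metis (mono_tags, lifting) not_less_Least)
    \<comment> \<open>Column degrees with the eliminated column 0 restored, so that rows and columns
      have the same total \<open>n\<close>.\<close>
    define cv where "cv j = (if j = 0 then a0 else v (Inr j))" for j
    have cv_nonneg: "0 \<le> cv j" for j using a0 coord_nonneg by (simp add: cv_def)
    have sum_cv: "(\<Sum>j=0..q. cv j) = n"
      unfolding sum.atLeast_Suc_atMost[OF le0] by (simp add: cv_def a0_def)
    then obtain j1 where j1: "j1 \<le> q" "cv j1 \<noteq> 0"
      using False by (metis atLeastAtMost_iff sum.neutral)
    define j0 where "j0 = (LEAST j. cv j \<noteq> 0)"
    have j0: "cv j0 \<noteq> 0" "j0 \<le> q" and j0_min: "\<And>j. j < j0 \<Longrightarrow> cv j = 0"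
      using j1 unfolding j0_def
      by (metis (mono_tags, lifting) LeastI, metis (mono_tags, lifting) Least_le le_trans,
          metis (mono_tags, lifting) not_less_Least)
    have pos: "0 < v (Inl i0)" "0 < cv j0"
      using i0 j0 coord_nonneg cv_nonneg by (simp_all add: less_le)
    have rows_all: "(\<Sum>i=l..p. v (Inl i)) = n" if "l \<le> i0" for l
      unfolding n_def using that i0_min by (intro sum.mono_neutral_left) auto
    have rows_less: "(\<Sum>i=l..p. v (Inl i)) < n" if "i0 < l" for l
    proof -
      have "(\<Sum>i=l..p. v (Inl i)) + v (Inl i0) = (\<Sum>i\<in>insert i0 {l..p}. v (Inl i))"
        using that by simp
      also have "\<dots> \<le> n"
        unfolding n_def using that i0(2) coord_nonneg by (intro sum_mono2) auto
      finally show ?thesis using pos by simp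
    qed
    have cols_cv: "(\<Sum>j=l..q. v (Inr j)) = (\<Sum>j=l..q. cv j)" if "0 < l" for l
      using that by (intro sum.cong) (auto simp: cv_def)
    have cols_all: "(\<Sum>j=l..q. v (Inr j)) = n" if "l \<le> j0" "0 < l" for l
      unfolding cols_cv[OF that(2)] sum_cv[symmetric] using that j0_min
      by (intro sum.mono_neutral_left) auto
    have cols_less: "(\<Sum>j=l..q. v (Inr j)) < n" if "j0 < l" for l
    proof -
      have "(\<Sum>j=l..q. cv j) + cv j0 = (\<Sum>j\<in>insert j0 {l..q}. cv j)"
        using that by simp
      also have "\<dots> \<le> n"
        unfolding sum_cv[symmetric] using that j0(2) cv_nonneg by (intro sum_mono2) auto
      finally show ?thesis using pos cols_cv[of l] that by simp
    qed
    have row: "0 \<le> pairing (row_facet i) v" if "i \<in> {1..p}" for i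
      using less.prems(2) that by (simp add: facets_def)
    have col: "0 \<le> pairing (col_facet j) v" if "j \<in> {1..q}" for j
      using less.prems(2) that by (simp add: facets_def)
    \<comment> \<open>Otherwise the rows from \<open>i0\<close> on carry the whole of
      \<open>n\<close>, while the columns from \<open>j_sharp A i0\<close> on miss column
      \<open>j0\<close>; the facet of row \<open>i0\<close> would be negative.\<close>
    have "j_sharp A i0 \<le> j0"
    proof (rule ccontr)
      assume *: "\<not> j_sharp A i0 \<le> j0"
      then have "i0 \<noteq> 0" by (intro notI) simp
      then show False
        using row[of i0] i0(2) * rows_all[of i0] cols_less[of "j_sharp A i0"]
        by (auto simp: pairing_row_facet)
    qed
    moreover have "i_flat A j0 \<le> i0"
    proof (rule ccontr)
      assume *: "\<not> i_flat A j0 \<le> i0"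
      then have "j0 \<noteq> 0" by (intro notI) simp
      then show False
        using col[of j0] j0(2) * cols_all[of j0] rows_less[of "i_flat A j0"]
        by (auto simp: pairing_col_facet)
    qed
    ultimately have in_A: "(i0, j0) \<in> A"
      using mem_A_iff i0 j0 by blast
    define w where "w = v - vec (i0, j0)"
    have "0 \<le> pairing (row_facet i) w" if i: "i \<in> {1..p}" for i
    \<comment> \<open>Exactly in this case the removed cell costs the facet 1. Then row
      \<open>i0\<close> lies before i and all columns before \<open>j_sharp A i\<close> are empty,
      so the facet was positive.\<close>
    proof (cases "i0 < i \<and> j_sharp A i \<le> j0")
      case True
      have "0 < pairing (row_facet i) v"
      proof (cases "j_sharp A i = 0")
        case z: True
        have "v (Inl i0) \<le> (\<Sum>i'=0..<i. v (Inl i'))"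
          using True coord_nonneg by (intro member_le_sum) auto
        then show ?thesis using i z pos by (simp add: pairing_row_facet)
      next
        case False
        then show ?thesis
          using i True rows_less[of i] cols_all[of "j_sharp A i"] by (simp add: pairing_row_facet)
      qed
      moreover have "pairing (row_facet i) (vec (i0, j0)) \<le> 1"
        using i0 j0 by (auto simp: pairing_vec row_facet_def)
      ultimately show ?thesis by (simp add: w_def pairing_diff)
    next
      case False
      then have "pairing (row_facet i) (vec (i0, j0)) \<le> 0"
        using i0 j0 by (auto simp: pairing_vec row_facet_def)
      then show ?thesis using row[OF i] by (simp add: w_def pairing_diff)
    qed
    moreover have "0 \<le> pairing (col_facet j) w" if j: "j \<in> {1..q}" for j
    proof (cases "j0 < j \<and> i_flat A j \<le> i0")
      case True
      then have "0 < pairing (col_facet j) v"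
        using j rows_all[of "i_flat A j"] cols_less[of j] by (simp add: pairing_col_facet)
      moreover have "pairing (col_facet j) (vec (i0, j0)) \<le> 1"
        using i0 j0 by (auto simp: pairing_vec col_facet_def)
      ultimately show ?thesis by (simp add: w_def pairing_diff)
    next
      case False
      then have "pairing (col_facet j) (vec (i0, j0)) \<le> 0"
        using i0 j0 that by (auto simp: pairing_vec col_facet_def)
      then show ?thesis using col[OF j] by (simp add: w_def pairing_diff)
    qed
    moreover have "0 \<le> w k" for k
      using coord_nonneg[of k] pos by (cases k) (auto simp: w_def cv_def)
    moreover have "0 \<le> pairing zero_col w"
    proof -
      have "pairing zero_col v = a0" by (simp add: pairing_zero_col a0_def n_def)
      moreover have "pairing zero_col (vec (i0, j0)) = of_bool (j0 = 0)"
        unfolding pairing_vec[OF i0(2) j0(2)] by (simp add: zero_col_def)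
      ultimately show ?thesis
        using pos(2) a0 by (auto simp: w_def pairing_diff cv_def)
    qed
    ultimately have "0 \<le> pairing c w" if "c \<in> facets" for c
      using that by (auto simp: facets_def pairing_coord)
    moreover have "supported w"
      using less.prems(1) supported_vec[OF in_A] by (simp add: supported_def w_def)
    moreover have "(\<Sum>i=0..p. w (Inl i)) = n - 1"
      using i0(2) by (simp add: w_def sum_subtractf n_def of_bool_def)
    then have "nat (\<Sum>i=0..p. w (Inl i)) < nat (\<Sum>i=0..p. v (Inl i))"
      using pos sum_nonneg[of "{0..p}" "\<lambda>i. v (Inl i)"] coord_nonneg False by (simp add: n_def)
    ultimately obtain M where "set_mset M \<subseteq> A" "deg M = w"
      using less.hyps[of w] by blast
    then show ?thesis
      using in_A by (intro exI[of _ "add_mset (i0, j0) M"]) (auto simp: w_def)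
  qed
qed

lemma pairing_deg_nonneg: "c \<in> facets \<Longrightarrow> set_mset M \<subseteq> A \<Longrightarrow> 0 \<le> pairing c (deg M)"
  by (induction M) (auto simp: deg_simps pairing_add facet_vec_nonneg)

text \<open>\<open>zero_col\<close> recovers the degree in column 0, so that this column can be
  tested like the others.\<close>

lemma zero_col_deg_pos_iff:
  "set_mset M \<subseteq> A \<Longrightarrow> 0 < pairing zero_col (deg M) \<longleftrightarrow> (\<exists>i. (i, 0) \<in># M)"
proof (induction M)
  case (add a M)
  moreover have "0 \<le> pairing zero_col (deg M)"
    using add.prems by (intro pairing_deg_nonneg) (auto simp: facets_def)
  moreover have "pairing zero_col (vec a) = of_bool (snd a = 0)"
    using add.prems A_bounds[of "fst a" "snd a"] pairing_vec[of "fst a" "snd a"] by (auto simp: zero_col_def)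
  ultimately show ?case
    unfolding deg_simps pairing_add by (cases a) auto
qed (simp add: deg_simps)

text \<open>The least element of a chain lies in the first nonempty row and the first nonempty
  column, which the degree determines; remove it and repeat.\<close>

lemma chain_deg_unique:
  assumes "chain M" "chain N" "set_mset M \<subseteq> A" "set_mset N \<subseteq> A" "deg M = deg N"
  shows "M = N"
  using assms
proof (induction "size M" arbitrary: M N)
  case 0
  then have "deg N (Inl i) = 0" for i
    by (metis deg_apply(1) size_eq_0_iff_empty)
  then have "\<not> (i, j) \<in># N" for i j
    using deg_Inl_pos_iff[of N i] by auto
  then have "N = {#}" by (metis multiset_nonemptyE surj_pair)
  with 0 show ?case by simp
next
  case (Suc n)
  then have "M \<noteq> {#}" by auto
  then have "N \<noteq> {#}"
    using Suc.prems(5) deg_Inl_pos_iff[of M] by (metis deg_apply(1) less_irrefl multiset_nonemptyE surj_pair)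
  obtain i j where m: "(i, j) \<in># M" "\<And>i' j'. (i', j') \<in># M \<Longrightarrow> i \<le> i' \<and> j \<le> j'"
    using chain_min[OF Suc.prems(1) \<open>M \<noteq> {#}\<close>] by blast
  obtain k l where n: "(k, l) \<in># N" "\<And>i' j'. (i', j') \<in># N \<Longrightarrow> k \<le> i' \<and> l \<le> j'"
    using chain_min[OF Suc.prems(2) \<open>N \<noteq> {#}\<close>] by blast
  have col_iff: "(\<exists>i. (i, c) \<in># M) \<longleftrightarrow> (\<exists>i. (i, c) \<in># N)" for c
    using zero_col_deg_pos_iff[OF Suc.prems(3)] zero_col_deg_pos_iff[OF Suc.prems(4)]
      deg_Inr_pos_iff[of M c] deg_Inr_pos_iff[of N c] Suc.prems(5) by (cases "c = 0") auto
  have "i = k"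
    using m n deg_Inl_pos_iff[of M] deg_Inl_pos_iff[of N] Suc.prems(5) by (metis le_antisym)
  moreover have "j = l"
    using m n col_iff by (metis le_antisym)
  ultimately have "(i, j) \<in># N" using n by simp
  obtain M' where M': "M = add_mset (i, j) M'" using m(1) by (metis insert_DiffM)
  obtain N' where N': "N = add_mset (i, j) N'" using \<open>(i, j) \<in># N\<close> by (metis insert_DiffM)
  have "M' = N'"
  proof (rule Suc.hyps(1))
    show "n = size M'" using Suc.hyps(2) M' by simp
    show "chain M'" "chain N'"
      using Suc.prems(1,2) unfolding M' N' chain_def by auto
    show "set_mset M' \<subseteq> A" "set_mset N' \<subseteq> A" using Suc.prems M' N' by auto
    show "deg M' = deg N'" using Suc.prems(5) M' N' by (simp add: deg_simps)
  qed
  then show ?case using M' N' by simp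
qed

section \<open>Representatives of minimal weight\<close>

definition wmin :: "expo \<Rightarrow> nat"
  where "wmin v = (LEAST n. \<exists>M. set_mset M \<subseteq> A \<and> deg M = v \<and> wts M = n)"

lemma wmin_le: "set_mset M \<subseteq> A \<Longrightarrow> wmin (deg M) \<le> wts M"
  unfolding wmin_def by (rule Least_le) blast

text \<open>Exchanging the columns of a crossing pair keeps the degree, stays in the ladder by meet
  and join, and lowers the weight.\<close>

lemma wmin_less:
  assumes "set_mset M \<subseteq> A" and "\<not> chain M"
  shows "wmin (deg M) < wts M"
proof -
  obtain i j i' j' where ij: "(i, j) \<in># M" "(i', j') \<in># M" "i < i'" "j' < j"
    using assms(2) unfolding chain_def by (fastforce simp: not_le)
  then have "(i', j') \<in># M - {#(i, j)#}"
    by (metis in_diff_count count_single diff_zero in_diff_count insert_DiffM nat_neq_iff old.prod.inject set_mset_add_mset_insert insert_iff)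
  then obtain N where N: "M = add_mset (i, j) (add_mset (i', j') N)"
    using ij(1) by (metis insert_DiffM)
  define M' where "M' = add_mset (i, j') (add_mset (i', j) N)"
  have "(i, j') \<in> A \<and> (i', j) \<in> A"
    using ij assms(1) by (intro meet_join) auto
  then have "set_mset M' \<subseteq> A" using assms(1) N M'_def by auto
  moreover have "vec (i, j) + vec (i', j') = vec (i, j') + vec (i', j)"
    by (rule ext, case_tac x) auto
  then have "deg M' = deg M" unfolding N M'_def by (simp add: deg_simps add.assoc[symmetric])
  moreover have "wts M' < wts M"
    using wt_uncross[OF ij(3,4)] by (simp add: N M'_def)
  ultimately show ?thesis using wmin_le[of M'] by simp
qed

lemma chain_exists:
  assumes "set_mset M \<subseteq> A"
  obtains N where "set_mset N \<subseteq> A" "deg N = deg M" "chain N" "wts N = wmin (deg M)"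
proof -
  have "\<exists>N. set_mset N \<subseteq> A \<and> deg N = deg M \<and> wts N = wmin (deg M)"
    unfolding wmin_def by (rule LeastI[of _ "wts M"]) (use assms in auto)
  then obtain N where N: "set_mset N \<subseteq> A" "deg N = deg M" "wts N = wmin (deg M)" by blast
  then have "chain N" using wmin_less[of N] by force
  with N that show thesis by blast
qed

text \<open>Existence by minimality and uniqueness by degree: the initial terms for the weight are
  exactly the monomials that are not chains.\<close>

lemma wmin_eq_iff:
  assumes "set_mset M \<subseteq> A"
  shows "wmin (deg M) = wts M \<longleftrightarrow> chain M"
proof
  show "wmin (deg M) = wts M \<Longrightarrow> chain M" using wmin_less[OF assms] by force
  assume "chain M"
  obtain N where N: "set_mset N \<subseteq> A" "deg N = deg M" "chain N" "wts N = wmin (deg M)"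
    using chain_exists[OF assms] .
  with \<open>chain M\<close> assms have "N = M" by (intro chain_deg_unique)
  with N show "wmin (deg M) = wts M" by simp
qed

end


section \<open>Monomials and lattice paths\<close>


lemma finite_bounded_multisets:
  assumes "finite X"
  shows "finite {M. set_mset M \<subseteq> X \<and> size M \<le> n}"
proof (rule finite_subset)
  show "{M. set_mset M \<subseteq> X \<and> size M \<le> n} \<subseteq> mset ` {xs. set xs \<subseteq> X \<and> length xs \<le> n}"
  proof
    fix M assume M: "M \<in> {M. set_mset M \<subseteq> X \<and> size M \<le> n}"
    obtain xs where "mset xs = M" using ex_mset by blast
    with M show "M \<in> mset ` {xs. set xs \<subseteq> X \<and> length xs \<le> n}" by auto
  qed
  show "finite (mset ` {xs. set xs \<subseteq> X \<and> length xs \<le> n})"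
    using assms by (intro finite_imageI finite_lists_length_le)
qed

context ladder
begin

abbreviation S :: "(nat \<times> nat) list set"
  where "S \<equiv> standard_monomials p q A"

text \<open>The last fact is the one behind the path monomials: a pair minimal neither in its row
  nor in its column also has the cell of the preceding row in the ladder.\<close>

lemma S_memD:
  assumes "u \<in> S" and "(i, j) \<in> set u"
  shows "(i, j) \<in> A" "0 < i" "i \<le> p" "0 < j" "j \<le> q" "j_sharp A i < j" "i_flat A j < i" "(i - 1, j) \<in> A"
proof -
  have *: "(i, j) \<in> A" "0 < i" "i \<le> p" "0 < j" "j \<le> q" "(i, j) \<noteq> (i, j_sharp A i)" "(i, j) \<noteq> (i_flat A j, j)"
    using assms unfolding standard_monomials_def by fastforce+
  then show "(i, j) \<in> A" "0 < i" "i \<le> p" "0 < j" "j \<le> q" by blast+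
  show **: "j_sharp A i < j" "i_flat A j < i"
    using * mem_A_iff[of i j] by auto
  show "(i - 1, j) \<in> A"
    using * ** j_sharp_mono[of "i - 1" i] by (auto simp: mem_A_iff)
qed

lemma S_sorted: "u \<in> S \<Longrightarrow> sorted_wrt (\<lambda>a b. fst a < fst b \<and> snd a < snd b) u"
  by (simp add: standard_monomials_def case_prod_beta')

lemma S_fst_sorted: "u \<in> S \<Longrightarrow> sorted_wrt (<) (map fst u)"
  unfolding sorted_wrt_map by (rule sorted_wrt_mono_rel[OF _ S_sorted]) auto

lemma S_fst_distinct: "u \<in> S \<Longrightarrow> distinct (map fst u)"
  using S_fst_sorted strict_sorted_iff by blast

lemma S_set: "u \<in> S \<Longrightarrow> set u \<subseteq> A"
  using S_memD(1) by auto

lemma S_less: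
  assumes "u \<in> S" "(i, j) \<in> set u" "(i', j') \<in> set u" "i < i'"
  shows "j < j'"
proof -
  have "sorted_wrt (\<lambda>a b. fst a < fst b \<and> snd a < snd b) u \<Longrightarrow> a \<in> set u \<Longrightarrow> b \<in> set u \<Longrightarrow>
      fst a < fst b \<Longrightarrow> snd a < snd b" for a b :: "nat \<times> nat" and u
    by (induction u) auto
  from this[OF S_sorted[OF assms(1)] assms(2,3)] assms(4) show ?thesis by simp
qed

lemma S_length: "u \<in> S \<Longrightarrow> length u \<le> p"
proof -
  assume u: "u \<in> S"
  have "length u = card (set (map fst u))"
    using distinct_card[OF S_fst_distinct[OF u]] by simp
  also have "\<dots> \<le> card {1..p}"
    using S_memD[OF u] by (intro card_mono) (auto simp: Suc_le_eq)
  finally show ?thesis by simp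
qed

lemma finite_S: "finite S"
  by (rule finite_subset[of _ "{u. set u \<subseteq> A \<and> length u \<le> p}"])
     (use S_set S_length finite_A in \<open>auto intro: finite_lists_length_le\<close>)

text \<open>
  A monotone lattice path in \<open>A\<close> is given by the columns in which it enters each row. The path of
  \<open>u\<close> is the lowest one that enters row \<open>i\<close> in column \<open>j\<close> for all \<open>(i, j)\<close> in \<open>u\<close>.
\<close>

primrec crossing :: "(nat \<times> nat) list \<Rightarrow> nat \<Rightarrow> nat"
  where
    "crossing u 0 = 0"
  | "crossing u (Suc i) = (case map_of u (Suc i) of Some j \<Rightarrow> j
      | None \<Rightarrow> max (j_sharp A (Suc i)) (crossing u i))"

lemma map_of_S: "u \<in> S \<Longrightarrow> map_of u i = Some j \<longleftrightarrow> (i, j) \<in> set u"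
  using S_fst_distinct by (simp add: map_of_eq_Some_iff)

lemma crossing_mem: "u \<in> S \<Longrightarrow> (i, j) \<in> set u \<Longrightarrow> crossing u i = j"
  using S_memD(2)[of u i j] by (cases i) (auto simp: map_of_S[symmetric])

lemma crossing_not_mem:
  "(\<And>j. (i, j) \<notin> set u) \<Longrightarrow> 0 < i \<Longrightarrow> crossing u i = max (j_sharp A i) (crossing u (i - 1))"
  by (cases i) (auto split: option.split dest: map_of_SomeD)

lemma crossing_less:
  assumes "u \<in> S" "(i, j) \<in> set u" "i' < i"
  shows "crossing u i' < j"
  using assms(3)
proof (induction i')
  case 0
  then show ?case using S_memD[OF assms(1,2)] by simp
next
  case (Suc i')
  show ?case
  proof (cases "\<exists>j'. (Suc i', j') \<in> set u")
    case True
    then show ?thesis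
      using crossing_mem[OF assms(1)] S_less[OF assms(1) _ assms(2)] Suc.prems by blast
  next
    case False
    moreover have "j_sharp A (Suc i') < j"
      using j_sharp_mono[of "Suc i'" i] S_memD[OF assms(1,2)] Suc.prems by simp
    ultimately show ?thesis
      using Suc crossing_not_mem[of "Suc i'" u] by auto
  qed
qed

lemma crossing_turn:
  assumes "u \<in> S" "(i, j) \<in> set u"
  shows "max (j_sharp A i) (crossing u (i - 1)) < crossing u i"
  using crossing_less[OF assms, of "i - 1"] crossing_mem[OF assms] S_memD[OF assms] by simp

lemma crossing_ge:
  assumes "u \<in> S" "0 < i"
  shows "max (j_sharp A i) (crossing u (i - 1)) \<le> crossing u i"
  using crossing_turn[OF assms(1), of i] crossing_not_mem[of i u] assms(2)
  by (cases "\<exists>j. (i, j) \<in> set u") (auto simp del: max.bounded_iff intro: less_imp_le)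

text \<open>A pair of \<open>u\<close> shows as a row entered strictly later than the ladder and the
  previous row force; hence the path determines \<open>u\<close>.\<close>

lemma mem_iff_crossing:
  assumes "u \<in> S"
  shows "(i, j) \<in> set u \<longleftrightarrow>
    0 < i \<and> i \<le> p \<and> j = crossing u i \<and> max (j_sharp A i) (crossing u (i - 1)) < crossing u i"
proof
  assume "(i, j) \<in> set u"
  then show "0 < i \<and> i \<le> p \<and> j = crossing u i \<and> max (j_sharp A i) (crossing u (i - 1)) < crossing u i"
    using crossing_turn crossing_mem S_memD assms by metis
next
  assume R: "0 < i \<and> i \<le> p \<and> j = crossing u i \<and> max (j_sharp A i) (crossing u (i - 1)) < crossing u i"
  then obtain j' where "(i, j') \<in> set u"
    using crossing_not_mem[of i u] by (metis less_irrefl)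
  with R show "(i, j) \<in> set u" using crossing_mem[OF assms] by simp
qed

lemma crossing_prev_in:
  assumes "u \<in> S"
  shows "0 < i \<Longrightarrow> i \<le> p \<Longrightarrow> (i - 1, crossing u i) \<in> A"
proof (induction i)
  case (Suc i)
  show ?case
  proof (cases "\<exists>j. (Suc i, j) \<in> set u")
    case True
    then show ?thesis using S_memD[OF assms] crossing_mem[OF assms] by fastforce
  next
    case False
    then have c: "crossing u (Suc i) = max (j_sharp A (Suc i)) (crossing u i)"
      using crossing_not_mem[of "Suc i" u] by simp
    show ?thesis
    proof (cases "crossing u (Suc i) = j_sharp A (Suc i)")
      case True
      then show ?thesis using j_sharp_prev_in[of "Suc i"] Suc.prems by simp
    next
      case False
      then have c': "crossing u (Suc i) = crossing u i" "j_sharp A (Suc i) < crossing u i"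
        using c by auto
      then have "0 < i" by (cases i) auto
      then have "(i - 1, crossing u i) \<in> A" using Suc by simp
      then show ?thesis
        using c' Suc.prems j_sharp_mono[of i "Suc i"] by (auto simp: mem_A_iff)
    qed
  qed
qed simp

lemma crossing_in:
  assumes "u \<in> S" "i \<le> p"
  shows "(i, crossing u i) \<in> A"
proof (cases "i = 0")
  case True
  then show ?thesis using j_sharp_in[of 0] by simp
next
  case False
  then have "(i - 1, crossing u i) \<in> A" "j_sharp A i \<le> crossing u i"
    using crossing_prev_in[OF assms(1)] crossing_ge[OF assms(1)] assms(2) by auto
  then show ?thesis using assms(2) by (auto simp: mem_A_iff)
qed

lemma crossing_mono:
  assumes "u \<in> S" "i \<le> i'"
  shows "crossing u i \<le> crossing u i'"
  using assms(2)
proof (induction rule: dec_induct)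
  case (step n)
  then show ?case using crossing_ge[OF assms(1), of "Suc n"] by simp
qed simp

text \<open>In row i the path runs from the column of entry to the column in which it leaves for row
  i + 1; in the last row it runs to column q.\<close>

definition path :: "(nat \<times> nat) list \<Rightarrow> (nat \<times> nat) set"
  where "path u = {(i, j). i \<le> p \<and> j \<le> q \<and> crossing u i \<le> j \<and> (i < p \<longrightarrow> j \<le> crossing u (Suc i))}"

lemma path_subset: assumes "u \<in> S" shows "path u \<subseteq> A"
proof
  fix a assume "a \<in> path u"
  then obtain i j where a: "a = (i, j)" "i \<le> p" "j \<le> q" "crossing u i \<le> j" "i < p \<longrightarrow> j \<le> crossing u (Suc i)"
    by (auto simp: path_def)
  have "j_sharp A i \<le> j"
    using crossing_in[OF assms a(2)] a(4) mem_A_iff by fastforce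
  moreover have "i_flat A j \<le> i"
  proof (cases "i < p")
    case True
    then have "(i, crossing u (Suc i)) \<in> A"
      using crossing_prev_in[OF assms, of "Suc i"] by simp
    then show ?thesis
      using True a(5) i_flat_mono[of j "crossing u (Suc i)"] mem_A_iff by fastforce
  next
    case False
    then show ?thesis using i_flat_in[OF a(3)] mem_A_iff a(2) by fastforce
  qed
  ultimately show "a \<in> A" using a mem_A_iff by blast
qed

lemma chain_path: "u \<in> S \<Longrightarrow> set_mset M \<subseteq> path u \<Longrightarrow> chain M"
proof -
  assume u: "u \<in> S" and M: "set_mset M \<subseteq> path u"
  have "j \<le> j'" if "(i, j) \<in> path u" "(i', j') \<in> path u" "i < i'" for i j i' j'
    using that crossing_mono[OF u, of "Suc i" i'] by (auto simp: path_def)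
  then show "chain M" unfolding chain_def using M by blast
qed

text \<open>Every cell of the path after (0, 0) is entered by a step into a new row or a new column,
  and is labelled by it; (0, 0) is labelled by row 0. This pairs the p + 1 + q operators with cells
  of the path.\<close>

definition pos :: "(nat \<times> nat) list \<Rightarrow> nat + nat \<Rightarrow> nat \<times> nat"
  where "pos u k = (case k of Inl i \<Rightarrow> (i, crossing u i)
    | Inr j \<Rightarrow> (Max {i. i \<le> p \<and> crossing u i < j}, j))"

lemma pos_Inr:
  assumes "0 < j"
  shows "\<exists>i. pos u (Inr j) = (i, j) \<and> i \<le> p \<and> crossing u i < j \<and> (i < p \<longrightarrow> j \<le> crossing u (Suc i))"
proof -
  let ?I = "{i. i \<le> p \<and> crossing u i < j}"
  have fin: "finite ?I" by (rule finite_subset[of _ "{..p}"]) auto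
  moreover have "0 \<in> ?I" using assms by simp
  ultimately have "Max ?I \<in> ?I" using Max_in by blast
  moreover have "j \<le> crossing u (Suc (Max ?I))" if "Max ?I < p"
  proof (rule ccontr)
    assume "\<not> j \<le> crossing u (Suc (Max ?I))"
    then have "Suc (Max ?I) \<in> ?I" using that by (simp del: crossing.simps)
    then show False using Max_ge[OF fin] by (metis Suc_n_not_le_n)
  qed
  ultimately show ?thesis by (simp add: pos_def)
qed

lemma pos_in_path:
  assumes "u \<in> S" "k \<in> Idx"
  shows "pos u k \<in> path u"
proof (cases k)
  case (Inl i)
  then have "i \<le> p" using assms(2) by (auto simp: Idx_def)
  then show ?thesis
    using Inl crossing_in[OF assms(1)] crossing_mono[OF assms(1), of i "Suc i"] mem_A_iff
    by (auto simp: pos_def path_def simp del: crossing.simps)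
next
  case (Inr j)
  then show ?thesis
    using assms(2) pos_Inr[of j u] by (auto simp: Idx_def path_def simp del: crossing.simps)
qed

lemma inj_on_pos: "inj_on (pos u) Idx"
proof (rule inj_onI)
  fix k l assume kl: "k \<in> Idx" "l \<in> Idx" "pos u k = pos u l"
  have "pos u (Inl i) \<noteq> pos u (Inr j)" if "0 < j" for i j
    using pos_Inr[OF that, of u] by (auto simp: pos_def)
  then show "k = l"
    using kl by (cases k; cases l) (auto simp: pos_def Idx_def Suc_le_eq, metis)
qed

text \<open>The extra factor (i - 1, j) is the corner at which the path of \<open>u\<close> turns
  into row i. Demanding these corners separates the monomials of different paths, as in a shelling
  of the complex of chains.\<close>

definition path_monomial :: "(nat \<times> nat) list \<Rightarrow> (nat + nat) multiset \<Rightarrow> (nat \<times> nat) multiset"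
  where "path_monomial u e = image_mset (pos u) e + image_mset (\<lambda>(i, j). (i - 1, j)) (mset u)"

lemma path_monomial_subset:
  assumes "u \<in> S" "set_mset e \<subseteq> Idx"
  shows "set_mset (path_monomial u e) \<subseteq> path u"
proof -
  have "(i - 1, j) \<in> path u" if "(i, j) \<in> set u" for i j
    using S_memD[OF assms(1) that] crossing_mem[OF assms(1) that] crossing_mono[OF assms(1), of "i - 1" i]
    by (auto simp: path_def simp del: crossing.simps)
  then show ?thesis
    using assms pos_in_path[OF assms(1)] by (auto simp: path_monomial_def)
qed

text \<open>A corner of \<open>u\<close> must lie on the path of \<open>u'\<close>, which therefore
  enters the next row no earlier; in rows without a corner the path of \<open>u\<close> is as low as
  possible.\<close>

lemma path_monomial_crossing_le:
  assumes "u \<in> S" "u' \<in> S" "set_mset e' \<subseteq> Idx" "path_monomial u e = path_monomial u' e'"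
  shows "i \<le> p \<Longrightarrow> crossing u i \<le> crossing u' i"
proof (induction i)
  case (Suc i)
  show ?case
  proof (cases "\<exists>j. (Suc i, j) \<in> set u")
    case True
    then obtain j where j: "(Suc i, j) \<in> set u" by blast
    then have "(i, j) \<in># path_monomial u e"
      by (force simp: path_monomial_def)
    then have "(i, j) \<in> path u'"
      using path_monomial_subset[OF assms(2,3)] assms(4) by auto
    then show ?thesis
      using Suc.prems crossing_mem[OF assms(1) j] by (simp add: path_def del: crossing.simps)
  next
    case False
    then have "crossing u (Suc i) = max (j_sharp A (Suc i)) (crossing u i)"
      using crossing_not_mem[of "Suc i" u] by simp
    also have "\<dots> \<le> crossing u' (Suc i)"
      using Suc crossing_ge[OF assms(2), of "Suc i"] by (simp del: crossing.simps)
    finally show ?thesis .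
  qed
qed simp

lemma S_eq_sorted_list:
  assumes "u \<in> S"
  shows "u = map (\<lambda>i. (i, crossing u i)) (sorted_list_of_set {i. \<exists>j. (i, j) \<in> set u})"
proof -
  have "map fst u = sorted_list_of_set (set (map fst u))"
    using S_fst_sorted[OF assms] by (metis sorted_list_of_set.idem_if_sorted_distinct strict_sorted_iff)
  moreover have "set (map fst u) = {i. \<exists>j. (i, j) \<in> set u}" by force
  moreover have "u = map (\<lambda>i. (i, crossing u i)) (map fst u)"
    unfolding map_map by (rule map_idI[symmetric]) (use crossing_mem[OF assms] in auto)
  ultimately show ?thesis by metis
qed

text \<open>Comparison in both directions gives equal paths, hence equal \<open>u\<close>. The
  corners then cancel, and \<open>e\<close> is recovered because \<open>pos u\<close> is
  injective.\<close>

lemma path_monomial_inj: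
  assumes "u \<in> S" "u' \<in> S" "set_mset e \<subseteq> Idx" "set_mset e' \<subseteq> Idx"
    and eq: "path_monomial u e = path_monomial u' e'"
  shows "u = u' \<and> e = e'"
proof -
  have cr: "crossing u i = crossing u' i" if "i \<le> p" for i
    using path_monomial_crossing_le[OF assms(1,2,4) eq that]
      path_monomial_crossing_le[OF assms(2,1,3) eq[symmetric] that] by simp
  have "set u = set u'"
  proof (intro set_eqI)
    fix a :: "nat \<times> nat"
    have "crossing u (fst a) = crossing u' (fst a) \<and> crossing u (fst a - 1) = crossing u' (fst a - 1)"
      if "fst a \<le> p"
      using that cr by simp
    then show "a \<in> set u \<longleftrightarrow> a \<in> set u'"
      using mem_iff_crossing[OF assms(1), of "fst a" "snd a"] mem_iff_crossing[OF assms(2), of "fst a" "snd a"]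
      by auto
  qed
  moreover have "map (\<lambda>i. (i, crossing u i)) (sorted_list_of_set {i. \<exists>j. (i, j) \<in> set u}) =
      map (\<lambda>i. (i, crossing u' i)) (sorted_list_of_set {i. \<exists>j. (i, j) \<in> set u})"
  proof (rule map_cong[OF refl])
    have "{i. \<exists>j. (i, j) \<in> set u} = fst ` set u" by force
    then have "finite {i. \<exists>j. (i, j) \<in> set u}" by simp
    fix i assume "i \<in> set (sorted_list_of_set {i. \<exists>j. (i, j) \<in> set u})"
    with \<open>finite _\<close> have "i \<le> p" using S_memD[OF assms(1)] by auto
    then show "(i, crossing u i) = (i, crossing u' i)" using cr by simp
  qed
  ultimately have u: "u = u'"
    using S_eq_sorted_list[OF assms(1)] S_eq_sorted_list[OF assms(2)] by metis
  then have "image_mset (pos u) e = image_mset (pos u) e'"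
    using eq by (simp add: path_monomial_def)
  then have "image_mset (inv_into Idx (pos u)) (image_mset (pos u) e) =
      image_mset (inv_into Idx (pos u)) (image_mset (pos u) e')" by simp
  moreover have "image_mset (inv_into Idx (pos u)) (image_mset (pos u) e) = e" if "set_mset e \<subseteq> Idx" for e
    unfolding multiset.map_comp
    by (rule multiset.map_ident_strong) (use that inv_into_f_f[OF inj_on_pos] in auto)
  ultimately show ?thesis using u assms by simp
qed

section \<open>Counting in bounded degree\<close>

definition cone_le :: "nat \<Rightarrow> expo set"
  where "cone_le n = deg ` {M. set_mset M \<subseteq> A \<and> size M \<le> n}"

definition basis_index :: "nat \<Rightarrow> ((nat \<times> nat) list \<times> (nat + nat) multiset) set"
  where "basis_index n = {(u, e). u \<in> S \<and> set_mset e \<subseteq> Idx \<and> length u + size e \<le> n}"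

lemma finite_cone_le: "finite (cone_le n)"
  unfolding cone_le_def by (intro finite_imageI finite_bounded_multisets finite_A)

lemma finite_basis_index: "finite (basis_index n)"
  by (rule finite_subset[of _ "S \<times> {e. set_mset e \<subseteq> Idx \<and> size e \<le> n}"])
     (auto simp: basis_index_def finite_S finite_Idx finite_bounded_multisets)

text \<open>Path monomials are chains, so distinct ones have distinct degrees; their size is
  \<open>length u + size e\<close>.\<close>

lemma card_basis_index_le: "card (basis_index n) \<le> card (cone_le n)"
proof (rule card_inj_on_le[OF _ _ finite_cone_le])
  show "inj_on (\<lambda>(u, e). deg (path_monomial u e)) (basis_index n)"
  proof (rule inj_onI, clarify)
    fix u e u' e' assume ue: "(u, e) \<in> basis_index n" "(u', e') \<in> basis_index n"
      and eq: "deg (path_monomial u e) = deg (path_monomial u' e')"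
    have "path_monomial u e = path_monomial u' e'"
      using ue eq path_monomial_subset path_subset chain_path unfolding basis_index_def
      by (intro chain_deg_unique) (auto, blast+)
    then show "u = u' \<and> e = e'"
      using ue path_monomial_inj by (auto simp: basis_index_def)
  qed
  show "(\<lambda>(u, e). deg (path_monomial u e)) ` basis_index n \<subseteq> cone_le n"
  proof clarify
    fix u e assume "(u, e) \<in> basis_index n"
    moreover have "size (path_monomial u e) = length u + size e"
      by (simp add: path_monomial_def)
    ultimately show "deg (path_monomial u e) \<in> cone_le n"
      using path_monomial_subset[of u e] path_subset[of u] unfolding cone_le_def basis_index_def
      by (intro imageI) auto
  qed
qed

end


section \<open>The ring of chains\<close>


text \<open>Allows the order relation to be checked on two entries of the multiset instead of on
  positions in a list.\<close>

lemma sorted_wrt_of_pairs: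
  assumes "sorted (map fst u)"
    and "\<And>a b N. mset u = add_mset a (add_mset b N) \<Longrightarrow> fst a \<le> fst b \<Longrightarrow> R a b"
  shows "sorted_wrt R u"
  using assms
proof (induction u)
  case (Cons x u)
  have "R x y" if y: "y \<in> set u" for y
  proof -
    obtain N where "mset u = add_mset y N" using multi_member_split[of y "mset u"] y by auto
    then show ?thesis using Cons.prems that by simp
  qed
  moreover have "sorted_wrt R u"
  proof (rule Cons.IH)
    show "sorted (map fst u)" using Cons.prems by simp
    fix a b N assume "mset u = add_mset a (add_mset b N)" "fst a \<le> fst b"
    then show "R a b"
      using Cons.prems(2)[of a b "add_mset x N"] by (simp add: add_mset_commute)
  qed
  ultimately show ?case by simp
qed simp

text \<open>The class of a monomial in the ring of chains. A nonzero class is recorded by its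
  degree, which is faithful because a chain is determined by its degree.\<close>

definition chain_val :: "(nat \<times> nat) multiset \<Rightarrow> expo \<Rightarrow> complex"
  where "chain_val M = (if chain M then delta (deg M) else 0)"

lemma not_chain:
  assumes "(i, j) \<in># M" "(i', j') \<in># M" "i < i'" "j' < j"
  shows "\<not> chain M"
proof
  assume "chain M"
  then have "j \<le> j'"
    using assms(1-3) unfolding chain_def by blast
  with assms(4) show False by simp
qed

context ladder
begin

definition row_cols :: "nat \<Rightarrow> nat set" where "row_cols i = {j. (i, j) \<in> A}"
definition col_rows :: "nat \<Rightarrow> nat set" where "col_rows j = {i. (i, j) \<in> A}"

lemma finite_row_cols: "finite (row_cols i)"
  by (rule finite_subset[of _ "{..q}"]) (use A_bounds in \<open>auto simp: row_cols_def\<close>)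

lemma finite_col_rows: "finite (col_rows j)"
  by (rule finite_subset[of _ "{..p}"]) (use A_bounds in \<open>auto simp: col_rows_def\<close>)

lemma sum_A_row: "(\<Sum>a\<in>A. if fst a = i then g a else 0) = (\<Sum>j\<in>row_cols i. g (i, j))"
  for g :: "nat \<times> nat \<Rightarrow> 'b::comm_monoid_add"
proof -
  have "(\<Sum>a\<in>A. if fst a = i then g a else 0) = (\<Sum>a\<in>{a\<in>A. fst a = i}. g a)"
    using finite_A by (simp add: sum.If_cases Collect_conj_eq)
  also have "{a\<in>A. fst a = i} = Pair i ` row_cols i"
    by (auto simp: row_cols_def)
  finally show ?thesis by (simp add: sum.reindex inj_on_def)
qed

lemma sum_A_col: "(\<Sum>a\<in>A. if snd a = j then g a else 0) = (\<Sum>i\<in>col_rows j. g (i, j))"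
  for g :: "nat \<times> nat \<Rightarrow> 'b::comm_monoid_add"
proof -
  have "(\<Sum>a\<in>A. if snd a = j then g a else 0) = (\<Sum>a\<in>{a\<in>A. snd a = j}. g a)"
    using finite_A by (simp add: sum.If_cases Collect_conj_eq)
  also have "{a\<in>A. snd a = j} = (\<lambda>i. (i, j)) ` col_rows j"
    by (auto simp: col_rows_def)
  finally show ?thesis by (simp add: sum.reindex inj_on_def)
qed

lemma sum_A_rows: "(\<Sum>i=0..p. \<Sum>j\<in>row_cols i. g (i, j)) = (\<Sum>a\<in>A. g a)"
  for g :: "nat \<times> nat \<Rightarrow> 'b::comm_monoid_add"
proof -
  have "(\<Sum>i=0..p. \<Sum>a\<in>A. if fst a = i then g a else 0) = (\<Sum>a\<in>A. \<Sum>i=0..p. if fst a = i then g a else 0)"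
    by (rule sum.swap)
  also have "\<dots> = (\<Sum>a\<in>A. g a)"
    using A_bounds by (intro sum.cong) auto
  finally show ?thesis by (simp add: sum_A_row)
qed

lemma sum_A_cols: "(\<Sum>j=0..q. \<Sum>i\<in>col_rows j. g (i, j)) = (\<Sum>a\<in>A. g a)"
  for g :: "nat \<times> nat \<Rightarrow> 'b::comm_monoid_add"
proof -
  have "(\<Sum>j=0..q. \<Sum>a\<in>A. if snd a = j then g a else 0) = (\<Sum>a\<in>A. \<Sum>j=0..q. if snd a = j then g a else 0)"
    by (rule sum.swap)
  also have "\<dots> = (\<Sum>a\<in>A. g a)"
    using A_bounds by (intro sum.cong) auto
  finally show ?thesis by (simp add: sum_A_col)
qed

definition chain_gens :: "nat \<Rightarrow> (expo \<Rightarrow> complex) set"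
  where "chain_gens d = {delta (deg (mset u)) | u. u \<in> S \<and> length u = d} \<union>
    {\<Sum>a\<in>A. cscale (of_int (vec a k)) (chain_val (add_mset a M)) | k M.
       k \<in> Idx \<and> set_mset M \<subseteq> A \<and> Suc (size M) = d}"

lemma row_sum_in_span:
  assumes "i \<le> p" "set_mset M \<subseteq> A" "Suc (size M) = d"
  shows "(\<Sum>j\<in>row_cols i. chain_val (add_mset (i, j) M)) \<in> fs.span (chain_gens d)"
proof -
  have "(\<Sum>a\<in>A. cscale (of_int (vec a (Inl i))) (chain_val (add_mset a M))) \<in> chain_gens d"
  proof -
    have "Inl i \<in> Idx" using assms by (simp add: Idx_def)
    then show ?thesis using assms(2,3) unfolding chain_gens_def by blast
  qed
  also have "(\<Sum>a\<in>A. cscale (of_int (vec a (Inl i))) (chain_val (add_mset a M))) =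
      (\<Sum>a\<in>A. if fst a = i then chain_val (add_mset a M) else 0)"
    by (rule sum.cong) (auto simp: of_bool_def)
  finally show ?thesis by (simp add: sum_A_row fs.span_base)
qed

text \<open>Column 0 has no operator of its own: its sum is the total of the row sums minus the
  total of the other column sums.\<close>

lemma col_sum_in_span:
  assumes "j \<le> q" "set_mset M \<subseteq> A" "Suc (size M) = d"
  shows "(\<Sum>i\<in>col_rows j. chain_val (add_mset (i, j) M)) \<in> fs.span (chain_gens d)"
proof -
  have pos: "(\<Sum>i\<in>col_rows j. chain_val (add_mset (i, j) M)) \<in> fs.span (chain_gens d)"
    if "j \<in> {1..q}" for j
  proof -
    have "(\<Sum>a\<in>A. cscale (of_int (vec a (Inr j))) (chain_val (add_mset a M))) \<in> chain_gens d"
    proof -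
      have "Inr j \<in> Idx" using that by (simp add: Idx_def)
      then show ?thesis using assms(2,3) unfolding chain_gens_def by blast
    qed
    also have "(\<Sum>a\<in>A. cscale (of_int (vec a (Inr j))) (chain_val (add_mset a M))) =
        (\<Sum>a\<in>A. if snd a = j then chain_val (add_mset a M) else 0)"
      using that by (intro sum.cong) (auto simp: of_bool_def)
    finally show ?thesis by (simp add: sum_A_col fs.span_base)
  qed
  show ?thesis
  proof (cases "j = 0")
    case True
    let ?g = "\<lambda>a. chain_val (add_mset a M)"
    have "(\<Sum>i\<in>col_rows 0. ?g (i, 0)) + (\<Sum>j=Suc 0..q. \<Sum>i\<in>col_rows j. ?g (i, j)) = (\<Sum>a\<in>A. ?g a)"
      using sum_A_cols[of ?g] by (simp add: sum.atLeast_Suc_atMost)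
    also have "\<dots> = (\<Sum>i=0..p. \<Sum>j\<in>row_cols i. ?g (i, j))"
      by (rule sum_A_rows[symmetric])
    finally have "(\<Sum>i\<in>col_rows 0. ?g (i, 0)) =
        (\<Sum>i=0..p. \<Sum>j\<in>row_cols i. ?g (i, j)) - (\<Sum>j=Suc 0..q. \<Sum>i\<in>col_rows j. ?g (i, j))"
      by (simp only: eq_diff_eq)
    also have "\<dots> \<in> fs.span (chain_gens d)"
      using pos row_sum_in_span[OF _ assms(2,3)] by (intro fs.span_diff[OF fs.span_sum fs.span_sum]) auto
    finally show ?thesis using True by simp
  qed (use pos assms(1) in simp)
qed

definition height :: "(nat \<times> nat) multiset \<Rightarrow> nat"
  where "height M = (\<Sum>a\<in>#M. fst a + snd a)"

lemma height_add_mset [simp]: "height (add_mset a M) = fst a + snd a + height M"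
  by (simp add: height_def)

text \<open>The bound that makes the rewriting towards larger height terminate.\<close>

lemma height_le: "set_mset M \<subseteq> A \<Longrightarrow> height M \<le> (p + q) * size M"
proof (induction M)
  case (add a M)
  then have "fst a + snd a \<le> p + q" using A_bounds[of "fst a" "snd a"] by auto
  then show ?case using add by simp
qed (simp add: height_def)

lemma span_remove:
  assumes "sum g I \<in> fs.span X" "finite I" "i \<in> I" "\<And>l. l \<in> I \<Longrightarrow> l \<noteq> i \<Longrightarrow> g l \<in> fs.span X"
  shows "g i \<in> fs.span X"
proof -
  have "g i = sum g I - sum g (I - {i})"
    using sum.remove[OF assms(2,3), of g] by simp
  also have "\<dots> \<in> fs.span X"
    using assms(4) by (intro fs.span_diff[OF assms(1)] fs.span_sum) auto
  finally show ?thesis .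
qed

text \<open>
  Modulo the row and column sums, every monomial of the ring of chains is rewritten into monomials
  of larger height until it lies in \<open>S\<close>.
\<close>

lemma chain_val_in_span:
  "set_mset M \<subseteq> A \<Longrightarrow> size M = d \<Longrightarrow> chain_val M \<in> fs.span (chain_gens d)"
proof (induction "(p + q) * d - height M" arbitrary: M rule: less_induct)
  case less
  let ?X = "fs.span (chain_gens d)"
  note [simp] = fs.span_zero
  have higher: "chain_val N \<in> ?X" if "set_mset N \<subseteq> A" "size N = d" "height M < height N" for N
    using less.hyps[of N] that height_le[of N] by auto
  have nonchain: "chain_val N \<in> ?X"
    if "(i, j) \<in># N" "(i', j') \<in># N" "i < i'" "j' < j" for N i j i' j'
    using not_chain[OF that] by (simp add: chain_val_def)
  \<comment> \<open>In the row relation for one cell, the terms with the cell further right have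
    larger height. Only the terms with the cell further left must be supplied; \<open>col\<close> is
    the analogue for columns.\<close>
  have row: "chain_val M \<in> ?X"
    if M: "M = add_mset (i, j) N" and "\<And>j'. (i, j') \<in> A \<Longrightarrow> j' < j \<Longrightarrow> chain_val (add_mset (i, j') N) \<in> ?X"
    for i j N
  proof -
    have *: "chain_val (add_mset (i, j') N) \<in> ?X" if "j' \<in> row_cols i" "j' \<noteq> j" for j'
    proof (cases "j' < j")
      case False
      then show ?thesis
        using that M less.prems by (intro higher) (auto simp: row_cols_def)
    qed (use that \<open>\<And>j'. (i, j') \<in> A \<Longrightarrow> j' < j \<Longrightarrow> chain_val (add_mset (i, j') N) \<in> ?X\<close> in \<open>auto simp: row_cols_def\<close>)
    have "i \<le> p" using M less.prems A_bounds by auto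
    then have "(\<Sum>j\<in>row_cols i. chain_val (add_mset (i, j) N)) \<in> ?X"
      using M less.prems by (intro row_sum_in_span) auto
    from span_remove[OF this finite_row_cols _ *] show ?thesis
      using M less.prems by (auto simp: row_cols_def)
  qed
  have col: "chain_val M \<in> ?X"
    if M: "M = add_mset (i, j) N" and "\<And>i'. (i', j) \<in> A \<Longrightarrow> i' < i \<Longrightarrow> chain_val (add_mset (i', j) N) \<in> ?X"
    for i j N
  proof -
    have *: "chain_val (add_mset (i', j) N) \<in> ?X" if "i' \<in> col_rows j" "i' \<noteq> i" for i'
    proof (cases "i' < i")
      case False
      then show ?thesis
        using that M less.prems by (intro higher) (auto simp: col_rows_def)
    qed (use that \<open>\<And>i'. (i', j) \<in> A \<Longrightarrow> i' < i \<Longrightarrow> chain_val (add_mset (i', j) N) \<in> ?X\<close> in \<open>auto simp: col_rows_def\<close>)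
    have "j \<le> q" using M less.prems A_bounds by auto
    then have "(\<Sum>i\<in>col_rows j. chain_val (add_mset (i, j) N)) \<in> ?X"
      using M less.prems by (intro col_sum_in_span) auto
    from span_remove[OF this finite_col_rows _ *] show ?thesis
      using M less.prems by (auto simp: col_rows_def)
  qed
  \<comment> \<open>The first six cases list what keeps a monomial from being standard: a crossing,
    a cell minimal in its row or column, or two entries that share a row or column.\<close>
  consider
      (nonchain) "\<not> chain M"
    | (row_min) i where "(i, j_sharp A i) \<in># M"
    | (col_min) j where "(i_flat A j, j) \<in># M"
    | (same_col) i i' j N where "M = add_mset (i', j) (add_mset (i, j) N)" "i < i'"
    | (same_row) i j j' N where "M = add_mset (i, j') (add_mset (i, j) N)" "j < j'"
    | (square) i j N where "M = add_mset (i, j) (add_mset (i, j) N)"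
    | (standard) "chain M" "\<And>i. (i, j_sharp A i) \<notin># M" "\<And>j. (i_flat A j, j) \<notin># M"
        "\<And>a b N. M = add_mset a (add_mset b N) \<Longrightarrow> fst a \<noteq> fst b \<and> snd a \<noteq> snd b"
  proof -
    have False
      if "\<not> thesis" "chain M" "\<And>i. (i, j_sharp A i) \<notin># M" "\<And>j. (i_flat A j, j) \<notin># M"
        "\<And>i i' j N. M = add_mset (i', j) (add_mset (i, j) N) \<Longrightarrow> \<not> i < i'"
        "\<And>i j j' N. M = add_mset (i, j') (add_mset (i, j) N) \<Longrightarrow> \<not> j < j'"
        "\<And>i j N. M \<noteq> add_mset (i, j) (add_mset (i, j) N)"
    proof -
      have "fst a \<noteq> fst b \<and> snd a \<noteq> snd b" if "M = add_mset a (add_mset b N)" for a b N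
      proof (rule ccontr)
        assume *: "\<not> (fst a \<noteq> fst b \<and> snd a \<noteq> snd b)"
        obtain i j i' j' where ab: "a = (i, j)" "b = (i', j')" by fastforce
        have M': "M = add_mset b (add_mset a N)" using that by (simp add: add_mset_commute)
        show False
          using * that M' \<open>\<And>i i' j N. M = add_mset (i', j) (add_mset (i, j) N) \<Longrightarrow> \<not> i < i'\<close>
            \<open>\<And>i j j' N. M = add_mset (i, j') (add_mset (i, j) N) \<Longrightarrow> \<not> j < j'\<close>
            \<open>\<And>i j N. M \<noteq> add_mset (i, j) (add_mset (i, j) N)\<close>
          unfolding ab by (metis fst_conv linorder_neqE_nat snd_conv)
      qed
      with that(1-4) standard show False by blast
    qed
    with that show thesis by blast
  qed
  then show ?case
  proof cases
    case nonchain
    then show ?thesis by (simp add: chain_val_def)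
  next
    case (row_min i)
    then obtain N where "M = add_mset (i, j_sharp A i) N" by (metis insert_DiffM)
    then show ?thesis
      by (rule row) (use j_sharp_le in fastforce)
  next
    case (col_min j)
    then obtain N where "M = add_mset (i_flat A j, j) N" by (metis insert_DiffM)
    then show ?thesis
      by (rule col) (use i_flat_le in fastforce)
  next
    \<comment> \<open>Moved to the left in its row, the lower cell crosses (i, j), so those terms
      vanish. The case \<open>same_row\<close> is the transpose.\<close>
    case (same_col i i' j N)
    show ?thesis
      by (rule row[OF same_col(1)]) (rule nonchain[of i j _ i'], use same_col in auto)
  next
    case (same_row i j j' N)
    show ?thesis
      by (rule col[OF same_row(1)]) (rule nonchain[of _ j' _ i j], use same_row in auto)
  next
    case (square i j N)
    txt \<open>
      The sums \<open>\<Sum>\<^bsub>j' < j\<^esub> z\<^bsub>i,j'\<^esub>\<close> and \<open>\<Sum>\<^bsub>i' < i\<^esub> z\<^bsub>i',j\<^esub>\<close> have product 0, since all their terms are incomparable.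
      Modulo the sums of row \<open>i\<close> and column \<open>j\<close> they are \<open>- \<Sum>\<^bsub>j' \<ge> j\<^esub> z\<^bsub>i,j'\<^esub>\<close> and \<open>- \<Sum>\<^bsub>i' \<ge> i\<^esub> z\<^bsub>i',j\<^esub>\<close>; the
      only term of minimal height in the product of these is the square.
    \<close>
    let ?f = "\<lambda>a b. chain_val (add_mset a (add_mset b N))"
    have ij: "(i, j) \<in> A" "i \<le> p" "j \<le> q" "set_mset N \<subseteq> A" "Suc (Suc (size N)) = d"
      using square less.prems A_bounds by auto
    have comm: "?f a b = ?f b a" for a b by (simp add: add_mset_commute)
    have above: "(\<Sum>i'\<in>{i'\<in>col_rows j. i' < i}. ?f (i', j) (i, j')) \<in> ?X" if j': "j < j'" "(i, j') \<in> A" for j'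
    proof -
      let ?I = "{i'\<in>col_rows j. i' < i}"
      have eq: "(\<Sum>i'\<in>?I. ?f (i', j) (i, j')) =
          (\<Sum>i'\<in>col_rows j. ?f (i', j) (i, j')) - (\<Sum>i'\<in>col_rows j - ?I. ?f (i', j) (i, j'))"
        using sum.subset_diff[of ?I "col_rows j" "\<lambda>i'. ?f (i', j) (i, j')"] finite_col_rows[of j]
        by (simp add: algebra_simps)
      have "?f (i', j) (i, j') \<in> ?X" if "i' \<in> col_rows j" "\<not> i' < i" for i'
      proof (cases "i' = i")
        case True
        then show ?thesis
          using j' ij square by (intro higher) auto
      next
        case False
        then show ?thesis
          using that j' by (intro nonchain[of i j' _ i' j]) auto
      qed
      then show ?thesis
        unfolding eq using j' ij by (intro fs.span_diff[OF col_sum_in_span fs.span_sum]) auto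
    qed
    have left: "?f (i', j) (i, j) + (\<Sum>j'\<in>{j'\<in>row_cols i. j < j'}. ?f (i', j) (i, j')) \<in> ?X"
      if i': "i' < i" "(i', j) \<in> A" for i'
    proof -
      have "row_cols i = insert j ({j'\<in>row_cols i. j < j'} \<union> {j'\<in>row_cols i. j' < j})"
        using ij by (auto simp: row_cols_def)
      then have "(\<Sum>j'\<in>row_cols i. ?f (i', j) (i, j')) = (\<Sum>j'\<in>insert j ({j'\<in>row_cols i. j < j'} \<union> {j'\<in>row_cols i. j' < j}). ?f (i', j) (i, j'))"
        by (rule arg_cong)
      also have "\<dots> = ?f (i', j) (i, j) + ((\<Sum>j'\<in>{j'\<in>row_cols i. j < j'}. ?f (i', j) (i, j')) + (\<Sum>j'\<in>{j'\<in>row_cols i. j' < j}. ?f (i', j) (i, j')))"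
        using finite_row_cols[of i]
        by (subst sum.insert) (auto intro!: sum.union_disjoint)
      finally have eq: "?f (i', j) (i, j) + (\<Sum>j'\<in>{j'\<in>row_cols i. j < j'}. ?f (i', j) (i, j')) =
          (\<Sum>j'\<in>row_cols i. ?f (i, j') (i', j)) - (\<Sum>j'\<in>{j'\<in>row_cols i. j' < j}. ?f (i', j) (i, j'))"
        by (simp add: comm algebra_simps)
      have "?f (i', j) (i, j') \<in> ?X" if "j' < j" for j'
        using that i' by (intro nonchain[of i' j _ i j']) auto
      then show ?thesis
        unfolding eq using i' ij by (intro fs.span_diff[OF row_sum_in_span fs.span_sum]) auto
    qed
    let ?I = "{i'\<in>col_rows j. i' < i}" and ?J = "{j'\<in>row_cols i. j < j'}"
    \<comment> \<open>Summing \<open>left\<close> over the rows before i and \<open>above\<close>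
      over the columns after j produces the same double sum, which cancels.\<close>
    have "(\<Sum>i'\<in>?I. ?f (i', j) (i, j) + (\<Sum>j'\<in>?J. ?f (i', j) (i, j'))) - (\<Sum>j'\<in>?J. \<Sum>i'\<in>?I. ?f (i', j) (i, j')) \<in> ?X"
      using left by (intro fs.span_diff[OF fs.span_sum fs.span_sum[OF above]]) (auto simp: col_rows_def row_cols_def)
    moreover have "(\<Sum>j'\<in>?J. \<Sum>i'\<in>?I. ?f (i', j) (i, j')) = (\<Sum>i'\<in>?I. \<Sum>j'\<in>?J. ?f (i', j) (i, j'))"
      by (rule sum.swap)
    ultimately have sumI: "(\<Sum>i'\<in>?I. ?f (i', j) (i, j)) \<in> ?X"
      by (simp add: sum.distrib)
    have "col_rows j = insert i (?I \<union> {i'\<in>col_rows j. i < i'})"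
      using ij by (auto simp: col_rows_def)
    then have "(\<Sum>i'\<in>col_rows j. ?f (i', j) (i, j)) = (\<Sum>i'\<in>insert i (?I \<union> {i'\<in>col_rows j. i < i'}). ?f (i', j) (i, j))"
      by (rule arg_cong)
    also have "\<dots> = ?f (i, j) (i, j) + ((\<Sum>i'\<in>?I. ?f (i', j) (i, j)) + (\<Sum>i'\<in>{i'\<in>col_rows j. i < i'}. ?f (i', j) (i, j)))"
      using finite_col_rows[of j]
      by (subst sum.insert) (auto intro!: sum.union_disjoint)
    finally have "chain_val M = (\<Sum>i'\<in>col_rows j. ?f (i', j) (i, j)) - (\<Sum>i'\<in>?I. ?f (i', j) (i, j)) -
        (\<Sum>i'\<in>{i'\<in>col_rows j. i < i'}. ?f (i', j) (i, j))"
      using square by (simp add: algebra_simps)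
    also have "\<dots> \<in> ?X"
    proof (intro fs.span_diff sumI)
      show "(\<Sum>i'\<in>col_rows j. ?f (i', j) (i, j)) \<in> ?X"
        using ij by (intro col_sum_in_span) auto
      show "(\<Sum>i'\<in>{i'\<in>col_rows j. i < i'}. ?f (i', j) (i, j)) \<in> ?X"
        using ij square by (intro fs.span_sum higher) (auto simp: col_rows_def)
    qed
    finally show ?thesis .
  next
    case standard
    obtain xs where xs: "mset xs = M" using ex_mset by blast
    \<comment> \<open>Sorting by rows suffices: in a chain with distinct rows and columns the
      columns increase along with the rows.\<close>
    define u where "u = sort_key fst xs"
    have mu: "mset u = M" by (simp add: u_def xs)
    have "sorted_wrt (\<lambda>(i, j) (i', j'). i < i' \<and> j < j') u"
    proof (rule sorted_wrt_of_pairs)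
      show "sorted (map fst u)" by (simp add: u_def)
      fix a b N assume "mset u = add_mset a (add_mset b N)" and le: "fst a \<le> fst b"
      then have M: "M = add_mset a (add_mset b N)" using mu by simp
      then have "fst a \<noteq> fst b \<and> snd a \<noteq> snd b" by (rule standard(4))
      moreover have "\<not> snd b < snd a"
        using not_chain[of "fst a" "snd a" M "fst b" "snd b"] standard(1) M le calculation by auto
      ultimately show "(case a of (i, j) \<Rightarrow> \<lambda>(i', j'). i < i' \<and> j < j') b"
        using le by (auto simp: case_prod_beta')
    qed
    moreover have "set u = set_mset M" using mu by (metis set_mset_mset)
    moreover have "0 < i \<and> i \<le> p \<and> 0 < j \<and> j \<le> q" if "(i, j) \<in># M" for i j
    proof -
      have in_A: "(i, j) \<in> A" using that less.prems by auto
      have "i \<noteq> 0"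
        using standard(3)[of j] that i_flat_le[OF in_A] by (metis le_zero_eq)
      moreover have "j \<noteq> 0"
        using standard(2)[of i] that j_sharp_le[OF in_A] by (metis le_zero_eq)
      ultimately show ?thesis using A_bounds[OF in_A] by simp
    qed
    ultimately have "u \<in> S"
      using standard(2,3) less.prems unfolding standard_monomials_def by fastforce
    moreover have "length u = d" using mu less.prems by (metis size_mset)
    ultimately have "delta (deg (mset u)) \<in> ?X"
      by (intro fs.span_base) (auto simp: chain_gens_def)
    then show ?thesis using standard(1) mu by (simp add: chain_val_def)
  qed
qed

end


section \<open>Generic coefficients\<close>


lemma continuous_map_mult:
  fixes f g :: "'a \<Rightarrow> 'b::real_normed_algebra"
  assumes "continuous_map X euclidean f" "continuous_map X euclidean g"
  shows "continuous_map X euclidean (\<lambda>x. f x * g x)"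
  using assms by (auto simp: continuous_map_atin intro: tendsto_mult)

lemma holomorphic_in_const: "holomorphic_in I U (\<lambda>x. c)"
  by (simp add: holomorphic_in_def)

lemma holomorphic_in_coord:
  assumes "i \<in> I"
  shows "holomorphic_in I U (\<lambda>x. x i)"
proof -
  have "continuous_map (subtopology (product_topology (\<lambda>_. euclidean) I) U) euclidean (\<lambda>x. x i)"
    using assms by (intro continuous_map_from_subtopology continuous_map_product_projection)
  moreover have "(\<lambda>w. (z(j := w)) i) field_differentiable at (z j)" for z :: "'a \<Rightarrow> complex" and j
    by (cases "j = i") (auto simp: field_differentiable_ident field_differentiable_const)
  ultimately show ?thesis by (simp add: holomorphic_in_def del: fun_upd_apply)
qed

lemma holomorphic_in_mult:
  "holomorphic_in I U f \<Longrightarrow> holomorphic_in I U g \<Longrightarrow> holomorphic_in I U (\<lambda>x. f x * g x)"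
  unfolding holomorphic_in_def by (auto intro!: continuous_map_mult field_differentiable_mult)

lemma holomorphic_in_add:
  "holomorphic_in I U f \<Longrightarrow> holomorphic_in I U g \<Longrightarrow> holomorphic_in I U (\<lambda>x. f x + g x)"
  unfolding holomorphic_in_def by (auto intro!: continuous_map_add field_differentiable_add)

lemma holomorphic_in_diff:
  "holomorphic_in I U f \<Longrightarrow> holomorphic_in I U g \<Longrightarrow> holomorphic_in I U (\<lambda>x. f x - g x)"
  unfolding holomorphic_in_def by (auto intro!: continuous_map_diff field_differentiable_diff)

lemma holomorphic_in_sum:
  "finite J \<Longrightarrow> (\<And>j. j \<in> J \<Longrightarrow> holomorphic_in I U (f j)) \<Longrightarrow> holomorphic_in I U (\<lambda>x. \<Sum>j\<in>J. f j x)"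
  by (induction J rule: finite_induct) (auto intro: holomorphic_in_add holomorphic_in_const)

lemma holomorphic_in_prod:
  "finite J \<Longrightarrow> (\<And>j. j \<in> J \<Longrightarrow> holomorphic_in I U (f j)) \<Longrightarrow> holomorphic_in I U (\<lambda>x. \<Prod>j\<in>J. f j x)"
  by (induction J rule: finite_induct) (auto intro: holomorphic_in_mult holomorphic_in_const)

lemma proper_analytic_subset_zeros:
  assumes "holomorphic_in I (cspace I) D" "x0 \<in> cspace I" "D x0 \<noteq> 0"
  shows "proper_analytic_subset I {x \<in> cspace I. D x = 0}"
proof -
  have "openin (product_topology (\<lambda>_. euclidean) I) (cspace I :: ('a \<Rightarrow> complex) set)"
    using openin_topspace[of "product_topology (\<lambda>_. euclidean :: complex topology) I"]
    by (simp add: topspace_product_topology)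
  then have "analytic_subset I {x \<in> cspace I. D x = 0}"
    unfolding analytic_subset_def using assms(1)
    by (intro conjI ballI exI[of _ "cspace I"] exI[of _ "{D}"]) auto
  then show ?thesis
    unfolding proper_analytic_subset_def using assms(2,3) by blast
qed

context ladder
begin

section \<open>Spanning by standard monomials, degree by degree\<close>

definition lead :: "(nat \<times> nat \<Rightarrow> complex) \<Rightarrow> nat + nat \<Rightarrow> expo \<Rightarrow> expo \<Rightarrow> complex"
  where "lead x k v = (\<Sum>a\<in>A. cscale (of_int (vec a k) * x a) (delta (v + vec a)))"

definition cone_deg :: "nat \<Rightarrow> expo set"
  where "cone_deg d = deg ` {M. set_mset M \<subseteq> A \<and> size M = d}"

definition gens :: "(nat \<times> nat \<Rightarrow> complex) \<Rightarrow> nat \<Rightarrow> (expo \<Rightarrow> complex) set"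
  where "gens x d = {delta (deg (mset u)) | u. u \<in> S \<and> length u = d} \<union>
    {lead x k (deg M) | k M. k \<in> Idx \<and> set_mset M \<subseteq> A \<and> Suc (size M) = d}"

definition good :: "(nat \<times> nat \<Rightarrow> complex) \<Rightarrow> bool"
  where "good x \<longleftrightarrow> (\<forall>d. \<forall>v\<in>cone_deg d. delta v \<in> fs.span (gens x d))"

lemma finite_cone_deg: "finite (cone_deg d)"
proof -
  have "{M. set_mset M \<subseteq> A \<and> size M = d} \<subseteq> {M. set_mset M \<subseteq> A \<and> size M \<le> d}" by auto
  then show ?thesis
    unfolding cone_deg_def by (intro finite_imageI finite_subset[OF _ finite_bounded_multisets[OF finite_A, of d]])
qed

lemma cone_deg_add: "v \<in> cone_deg d \<Longrightarrow> a \<in> A \<Longrightarrow> v + vec a \<in> cone_deg (Suc d)"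
  unfolding cone_deg_def
proof (elim imageE)
  fix M assume "a \<in> A" "v = deg M" "M \<in> {M. set_mset M \<subseteq> A \<and> size M = d}"
  then show "v + vec a \<in> deg ` {M. set_mset M \<subseteq> A \<and> size M = Suc d}"
    by (intro image_eqI[of _ _ "add_mset a M"]) (auto simp: deg_simps add.commute)
qed

text \<open>Standard monomials have at most p factors, so from degree p + 1 on the generators are
  leading parts only. Multiplication by one cell then carries spanning from each degree to the
  next.\<close>

lemma good_of_bounded:
  assumes "\<And>d v. d \<le> Suc p \<Longrightarrow> v \<in> cone_deg d \<Longrightarrow> delta v \<in> fs.span (gens x d)"
  shows "good x"
proof -
  have "delta v \<in> fs.span (gens x d)" if "Suc p \<le> d" "v \<in> cone_deg d" for d v
    using that
  proof (induction d arbitrary: v rule: dec_induct)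
    case base
    then show ?case using assms by blast
  next
    case (step d)
    then obtain M where M: "set_mset M \<subseteq> A" "size M = Suc d" "v = deg M"
      by (auto simp: cone_deg_def)
    then obtain a N where N: "M = add_mset a N" by (metis size_Suc_Diff1 size_eq_Suc_imp_eq_union)
    define shift :: "(expo \<Rightarrow> complex) \<Rightarrow> expo \<Rightarrow> complex"
      where "shift g = (\<lambda>w. g (w - vec a))" for g
    have shift_delta: "shift (delta w) = delta (w + vec a)" for w
      by (rule ext) (simp only: shift_def delta_apply diff_eq_eq)
    have shift_lead: "shift (lead x k w) = lead x k (w + vec a)" for k w
    proof -
      have "shift (lead x k w) = (\<Sum>b\<in>A. cscale (of_int (vec b k) * x b) (shift (delta (w + vec b))))"
        by (rule ext) (simp add: lead_def shift_def sum_fun_apply)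
      then show ?thesis by (simp only: shift_delta lead_def add_ac)
    qed
    have "gens x d \<subseteq> {g. shift g \<in> fs.span (gens x (Suc d))}"
    proof
      fix g assume "g \<in> gens x d"
      moreover have "length u \<noteq> d" if "u \<in> S" for u
        using S_length[OF that] step.hyps by simp
      ultimately obtain k K where K: "g = lead x k (deg K)" "k \<in> Idx" "set_mset K \<subseteq> A" "Suc (size K) = d"
        by (auto simp: gens_def)
      have "shift g = lead x k (deg (add_mset a K))"
        by (simp only: K(1) shift_lead deg_simps add.commute)
      moreover have "set_mset (add_mset a K) \<subseteq> A" "Suc (size (add_mset a K)) = Suc d"
        using K M N by auto
      ultimately have "shift g \<in> gens x (Suc d)"
        unfolding gens_def using K(2) by blast
      then show "g \<in> {g. shift g \<in> fs.span (gens x (Suc d))}"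
        by (simp add: fs.span_base)
    qed
    moreover have "fs.subspace {g. shift g \<in> fs.span (gens x (Suc d))}"
    proof -
      have "shift 0 = 0" "shift (g + h) = shift g + shift h" "shift (cscale c g) = cscale c (shift g)" for g h c
        by (auto simp: shift_def fun_eq_iff)
      then show ?thesis
        unfolding fs.subspace_def by (auto simp: fs.span_zero fs.span_add fs.span_scale)
    qed
    ultimately have "fs.span (gens x d) \<subseteq> {g. shift g \<in> fs.span (gens x (Suc d))}"
      by (rule fs.span_minimal)
    moreover have "deg N \<in> cone_deg d"
      using M N by (auto simp: cone_deg_def)
    ultimately have "shift (delta (deg N)) \<in> fs.span (gens x (Suc d))"
      using step.IH by blast
    then show ?case by (simp only: shift_delta M(3) N deg_simps add.commute)
  qed
  then show ?thesis
    unfolding good_def using assms by (metis nat_le_linear)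
qed

definition gen_index :: "nat \<Rightarrow> gen_label set"
  where "gen_index d = Inl ` {u \<in> S. length u = d} \<union>
    Inr ` (Idx \<times> deg ` {M. set_mset M \<subseteq> A \<and> Suc (size M) = d})"

lemma finite_gen_index: "finite (gen_index d)"
proof -
  have "{M. set_mset M \<subseteq> A \<and> Suc (size M) = d} \<subseteq> {M. set_mset M \<subseteq> A \<and> size M \<le> d}" by auto
  then have "finite {M. set_mset M \<subseteq> A \<and> Suc (size M) = d}"
    using finite_subset finite_bounded_multisets[OF finite_A, of d] by blast
  then show ?thesis
    using finite_S finite_Idx by (simp add: gen_index_def)
qed

lemma gen_index_cases:
  assumes "j \<in> gen_index d"
  obtains u where "j = Inl u" "u \<in> S" "length u = d"
  | k M where "j = Inr (k, deg M)" "k \<in> Idx" "set_mset M \<subseteq> A" "Suc (size M) = d"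
  using assms by (auto simp: gen_index_def)

definition gen :: "gen_label \<Rightarrow> (nat \<times> nat \<Rightarrow> complex)
    \<Rightarrow> expo \<Rightarrow> complex"
  where "gen j x = (case j of Inl u \<Rightarrow> delta (deg (mset u)) | Inr (k, v) \<Rightarrow> lead x k v)"

lemma gens_eq: "gens x d = (\<lambda>j. gen j x) ` gen_index d"
proof
  show "gens x d \<subseteq> (\<lambda>j. gen j x) ` gen_index d"
    by (auto simp: gens_def gen_index_def gen_def image_Un image_image)
  show "(\<lambda>j. gen j x) ` gen_index d \<subseteq> gens x d"
  proof
    fix g assume "g \<in> (\<lambda>j. gen j x) ` gen_index d"
    then obtain j where j: "j \<in> gen_index d" "g = gen j x" by blast
    from j(1) show "g \<in> gens x d"
    proof (cases rule: gen_index_cases)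
      case (1 u)
      then have "g = delta (deg (mset u))" using j(2) by (simp add: gen_def)
      then show ?thesis using 1 unfolding gens_def by blast
    next
      case (2 k M)
      then have "g = lead x k (deg M)" using j(2) by (simp add: gen_def)
      then show ?thesis using 2 unfolding gens_def by blast
    qed
  qed
qed

text \<open>The \<open>gen j x\<close> for \<open>x a = \<epsilon> ^ wt a\<close>, with the basis rescaled so that the limit \<open>\<epsilon> \<rightarrow> 0\<close> exists.\<close>

definition scaled_gen :: "gen_label \<Rightarrow> complex
    \<Rightarrow> expo \<Rightarrow> complex"
  where "scaled_gen j \<epsilon> = (case j of Inl u \<Rightarrow> delta (deg (mset u))
    | Inr (k, v) \<Rightarrow> (\<Sum>a\<in>A. cscale (of_int (vec a k) * \<epsilon> ^ (wt a + wmin v - wmin (v + vec a))) (delta (v + vec a))))"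

lemma sum_delta_support:
  assumes "j \<in> gen_index d" "w \<notin> cone_deg d"
  shows "gen j x w = 0" "scaled_gen j \<epsilon> w = 0"
proof -
  have 1: "deg (mset u) \<in> cone_deg d" if "u \<in> S" "length u = d" for u
    using that S_set by (auto simp: cone_deg_def)
  have 2: "deg M + vec a \<in> cone_deg d" if "a \<in> A" "set_mset M \<subseteq> A" "Suc (size M) = d" for a M
    using cone_deg_add[of "deg M" "size M" a] that by (auto simp: cone_deg_def)
  from assms(1) show "gen j x w = 0"
    by (cases rule: gen_index_cases)
       (use assms(2) 1 2 in \<open>auto simp: gen_def delta_apply lead_def sum_fun_apply intro!: sum.neutral\<close>)
  from assms(1) show "scaled_gen j \<epsilon> w = 0"
    by (cases rule: gen_index_cases)
       (use assms(2) 1 2 in \<open>auto simp: scaled_gen_def delta_apply sum_fun_apply intro!: sum.neutral\<close>)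
qed

text \<open>Add the cell to a minimal representative. The bound makes the truncated subtraction in
  the exponent of \<open>scaled_gen\<close> a genuine one.\<close>

lemma wmin_add_le:
  assumes "set_mset M \<subseteq> A" "a \<in> A"
  shows "wmin (deg M + vec a) \<le> wt a + wmin (deg M)"
proof -
  obtain N where N: "set_mset N \<subseteq> A" "deg N = deg M" "chain N" "wts N = wmin (deg M)"
    using chain_exists[OF assms(1)] .
  then show ?thesis
    using wmin_le[of "add_mset a N"] assms(2) by (simp add: deg_simps add.commute)
qed

text \<open>The exponent of \<epsilon> is 0 exactly when adding the cell leaves a chain; as 0 ^ 0 =
  1, just these terms survive.\<close>

lemma scaled_gen_0:
  assumes "chain M" "set_mset M \<subseteq> A"
  shows "scaled_gen (Inr (k, deg M)) 0 = (\<Sum>a\<in>A. cscale (of_int (vec a k)) (chain_val (add_mset a M)))"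
proof -
  have "cscale (of_int (vec a k) * 0 ^ (wt a + wmin (deg M) - wmin (deg M + vec a))) (delta (deg M + vec a)) =
      cscale (of_int (vec a k)) (chain_val (add_mset a M))" if "a \<in> A" for a
  proof -
    let ?n = "wt a + wmin (deg M) - wmin (deg M + vec a)"
    have eq: "deg (add_mset a M) = deg M + vec a" by (simp only: deg_simps add.commute)
    have "wmin (deg M) = wts M" using wmin_eq_iff[OF assms(2)] assms(1) by blast
    moreover have "wmin (deg (add_mset a M)) = wts (add_mset a M) \<longleftrightarrow> chain (add_mset a M)"
      using assms that by (intro wmin_eq_iff) auto
    moreover have "wmin (deg (add_mset a M)) \<le> wts (add_mset a M)"
      using assms that by (intro wmin_le) auto
    ultimately have n: "?n = 0 \<longleftrightarrow> chain (add_mset a M)"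
      unfolding eq wts_simps by linarith
    show ?thesis
    proof (cases "chain (add_mset a M)")
      case True
      then have "?n = 0" using n by blast
      show ?thesis unfolding chain_val_def if_P[OF True] eq \<open>?n = 0\<close> by simp
    next
      case False
      then have "?n \<noteq> 0" using n by blast
      then have "(0::complex) ^ ?n = 0" by (simp add: power_0_left)
      then show ?thesis unfolding chain_val_def if_not_P[OF False] by simp
    qed
  qed
  then show ?thesis unfolding scaled_gen_def by simp
qed

text \<open>Each degree is represented by its chain of minimal weight, to which the rewriting in the
  ring of chains applies. Relations built on a non-chain vanish there, the others are values of
  \<open>scaled_gen\<close> at 0.\<close>

lemma scaled_gen_spanning_0:
  assumes "v \<in> cone_deg d"
  shows "delta v \<in> fs.span ((\<lambda>j. scaled_gen j 0) ` gen_index d)"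
proof -
  let ?X = "fs.span ((\<lambda>j. scaled_gen j 0) ` gen_index d)"
  have "chain_gens d \<subseteq> ?X"
  proof
    fix g assume "g \<in> chain_gens d"
    then consider u where "g = delta (deg (mset u))" "u \<in> S" "length u = d"
      | k M where "g = (\<Sum>a\<in>A. cscale (of_int (vec a k)) (chain_val (add_mset a M)))"
          "k \<in> Idx" "set_mset M \<subseteq> A" "Suc (size M) = d"
      unfolding chain_gens_def by blast
    then show "g \<in> ?X"
    proof cases
      case (1 u)
      then show ?thesis
        by (intro fs.span_base image_eqI[of _ _ "Inl u"]) (auto simp: scaled_gen_def gen_index_def)
    next
      case (2 k M)
      show ?thesis
      proof (cases "chain M")
        case True
        with 2 show ?thesis
          by (intro fs.span_base image_eqI[of _ _ "Inr (k, deg M)"])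
            (simp only: scaled_gen_0, unfold gen_index_def, blast)
      next
        case False
        then have "\<not> chain (add_mset a M)" for a
          using chain_diff[of "add_mset a M" "{#a#}"] by auto
        then have "g = 0" using 2(1) by (simp add: chain_val_def)
        then show ?thesis by (simp add: fs.span_zero)
      qed
    qed
  qed
  moreover obtain M where M: "set_mset M \<subseteq> A" "size M = d" "v = deg M"
    using assms by (auto simp: cone_deg_def)
  obtain N where N: "set_mset N \<subseteq> A" "deg N = deg M" "chain N" "wts N = wmin (deg M)"
    using chain_exists[OF M(1)] .
  have size: "int (size K) = (\<Sum>i=0..p. deg K (Inl i))" if "set_mset K \<subseteq> A" for K
    using that
  proof (induction K)
    case (add a K)
    then have "fst a \<le> p" using A_bounds[of "fst a" "snd a"] by auto
    then show ?case using add by (simp add: sum.distrib of_bool_def)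
  qed simp
  have "size N = d" using size[OF N(1)] size[OF M(1)] N(2) M(2) by simp
  then have "chain_val N \<in> fs.span (chain_gens d)" using chain_val_in_span N(1) by blast
  ultimately show ?thesis
  proof -
    have "fs.span (chain_gens d) \<subseteq> ?X"
      using \<open>chain_gens d \<subseteq> ?X\<close> by (intro fs.span_minimal) auto
    with \<open>chain_val N \<in> _\<close> have "chain_val N \<in> ?X" by blast
    then show ?thesis unfolding chain_val_def if_P[OF N(3)] N(2) M(3) .
  qed
qed

definition spanning :: "nat \<Rightarrow> (gen_label
    \<Rightarrow> expo \<Rightarrow> complex) \<Rightarrow> bool"
  where "spanning d f \<longleftrightarrow> (\<forall>g. \<exists>s. \<forall>i\<in>cone_deg d. g i = (\<Sum>j\<in>gen_index d. s j * f j i))"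

text \<open>For nonzero \<epsilon> the two matrices differ by invertible diagonal factors on both
  sides, namely powers of \<epsilon> with exponents \<open>wmin\<close>.\<close>

lemma gen_spanning_of_scaled:
  assumes "\<epsilon> \<noteq> 0" and x: "\<And>a. a \<in> A \<Longrightarrow> x a = \<epsilon> ^ wt a"
    and sp: "spanning d (\<lambda>j. scaled_gen j \<epsilon>)"
  shows "spanning d (\<lambda>j. gen j x)"
unfolding spanning_def
proof
  fix g :: "expo \<Rightarrow> complex"
  define vof :: "gen_label \<Rightarrow> nat + nat \<Rightarrow> int"
    where "vof j = (case j of Inl u \<Rightarrow> deg (mset u) | Inr (k, v) \<Rightarrow> v)" for j
  have scale: "scaled_gen j \<epsilon> i * \<epsilon> ^ wmin i = \<epsilon> ^ wmin (vof j) * gen j x i" if "j \<in> gen_index d" for j i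
    using that
  proof (cases rule: gen_index_cases)
    case (1 u)
    then show ?thesis by (simp add: scaled_gen_def gen_def vof_def delta_apply)
  next
    case (2 k M)
    have "\<epsilon> ^ (wt a + wmin (deg M) - wmin (deg M + vec a)) * \<epsilon> ^ wmin (deg M + vec a) = \<epsilon> ^ wmin (deg M) * x a"
      if "a \<in> A" for a
      using wmin_add_le[OF 2(3) that] by (simp add: x[OF that] power_add[symmetric] add.commute)
    then have "(of_int (vec a k) * \<epsilon> ^ (wt a + wmin (deg M) - wmin (deg M + vec a))) * delta (deg M + vec a) i * \<epsilon> ^ wmin i =
       \<epsilon> ^ wmin (deg M) * ((of_int (vec a k) * x a) * delta (deg M + vec a) i)" if "a \<in> A" for a
      using that by (cases "i = deg M + vec a") (simp_all only: delta_apply, simp_all)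
    then have "(\<Sum>a\<in>A. (of_int (vec a k) * \<epsilon> ^ (wt a + wmin (deg M) - wmin (deg M + vec a))) * delta (deg M + vec a) i * \<epsilon> ^ wmin i) =
       (\<Sum>a\<in>A. \<epsilon> ^ wmin (deg M) * ((of_int (vec a k) * x a) * delta (deg M + vec a) i))"
      by (rule sum.cong[OF refl])
    then show ?thesis
      by (simp only: 2(1) scaled_gen_def gen_def vof_def lead_def sum_fun_apply sum_distrib_left
          sum_distrib_right sum.case prod.case cscale_apply)
  qed
  obtain s where s: "\<forall>i\<in>cone_deg d. g i / \<epsilon> ^ wmin i = (\<Sum>j\<in>gen_index d. s j * scaled_gen j \<epsilon> i)"
    using sp[unfolded spanning_def, rule_format, of "\<lambda>i. g i / \<epsilon> ^ wmin i"] by blast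
  have "g i = (\<Sum>j\<in>gen_index d. (s j * \<epsilon> ^ wmin (vof j)) * gen j x i)" if "i \<in> cone_deg d" for i
  proof -
    have "g i = (g i / \<epsilon> ^ wmin i) * \<epsilon> ^ wmin i" using assms(1) by simp
    also have "\<dots> = (\<Sum>j\<in>gen_index d. s j * (scaled_gen j \<epsilon> i * \<epsilon> ^ wmin i))"
      using s that by (simp add: sum_distrib_right mult.assoc)
    also have "\<dots> = (\<Sum>j\<in>gen_index d. (s j * \<epsilon> ^ wmin (vof j)) * gen j x i)"
      by (rule sum.cong) (simp_all add: scale mult.assoc)
    finally show ?thesis .
  qed
  then show "\<exists>s. \<forall>i\<in>cone_deg d. g i = (\<Sum>j\<in>gen_index d. s j * gen j x i)"
    by (intro exI[of _ "\<lambda>j. s j * \<epsilon> ^ wmin (vof j)"]) blast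
qed

lemma scaled_gen_continuous: "isCont (\<lambda>\<epsilon>. scaled_gen j \<epsilon> i) z"
proof (cases j)
  case (Inl u)
  then show ?thesis by (simp add: scaled_gen_def)
next
  case (Inr kv)
  obtain k v where kv: "kv = (k, v)" by fastforce
  have "scaled_gen j \<epsilon> i =
      (\<Sum>a\<in>A. (of_int (vec a k) * \<epsilon> ^ (wt a + wmin v - wmin (v + vec a))) * delta (v + vec a) i)" for \<epsilon>
    by (simp only: Inr kv scaled_gen_def sum_fun_apply cscale_apply Sum_Type.sum.case prod.case)
  then show ?thesis
    by (simp only:) (intro continuous_sum continuous_mult continuous_const continuous_power continuous_ident)
qed

text \<open>Elimination with the functions continuous at 0 as class of coefficients: the product of
  the pivots is nonzero at 0, hence near 0.\<close>

lemma eventually_gen_spanning: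
  "\<forall>\<^sub>F \<epsilon> in at 0. spanning d (\<lambda>j. scaled_gen j \<epsilon>)"
proof -
  have "spanning d (\<lambda>j. scaled_gen j 0)"
    unfolding spanning_def
  proof (rule iffD1[OF span_image_iff[OF finite_cone_deg finite_gen_index]])
    show "\<forall>i\<in>cone_deg d. delta i \<in> fs.span ((\<lambda>j. scaled_gen j 0) ` gen_index d)"
      by (intro ballI scaled_gen_spanning_0)
  qed (rule sum_delta_support(2))
  note sp0 = this
  have "\<exists>D\<in>{D :: complex \<Rightarrow> complex. isCont D 0}. D 0 \<noteq> 0 \<and>
      (\<forall>x. D x \<noteq> 0 \<longrightarrow> (spanning d (\<lambda>j. scaled_gen j x)))"
    unfolding spanning_def
  proof (rule spanning_open[where f = scaled_gen and C = "{D. isCont D 0}", OF finite_cone_deg finite_gen_index])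
    show "\<forall>g. \<exists>s. \<forall>i\<in>cone_deg d. g i = (\<Sum>j\<in>gen_index d. s j * scaled_gen j 0 i)"
      by (rule sp0[unfolded spanning_def])
  qed (auto intro: continuous_mult continuous_diff scaled_gen_continuous)
  then obtain D :: "complex \<Rightarrow> complex" where D: "isCont D 0" "D 0 \<noteq> 0"
    "\<And>x. D x \<noteq> 0 \<Longrightarrow> spanning d (\<lambda>j. scaled_gen j x)"
    by blast
  from D(1,2) have "\<forall>\<^sub>F x in at 0. D x \<noteq> 0"
    by (auto simp: isCont_def intro: tendsto_imp_eventually_ne)
  then show ?thesis by (rule eventually_mono) (use D(3) in blast)
qed

lemma holomorphic_in_gen: "holomorphic_in A (cspace A) (\<lambda>x. gen j x i)"
proof (cases j)
  case (Inl u)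
  then show ?thesis by (simp add: gen_def holomorphic_in_const)
next
  case (Inr kv)
  then show ?thesis
    by (cases kv) (auto simp: gen_def lead_def sum_fun_apply
        intro!: holomorphic_in_sum finite_A holomorphic_in_mult holomorphic_in_const holomorphic_in_coord)
qed

lemma generic_good:
  "\<exists>D. holomorphic_in A (cspace A) D \<and> (\<exists>x0\<in>cspace A. D x0 \<noteq> 0) \<and>
    (\<forall>x. D x \<noteq> 0 \<longrightarrow> good x \<and> (\<forall>a\<in>A. x a \<noteq> 0))"
proof -
  have "\<forall>\<^sub>F \<epsilon> in at 0. \<forall>d\<in>{..Suc p}. spanning d (\<lambda>j. scaled_gen j \<epsilon>)"
    by (intro eventually_ball_finite ballI eventually_gen_spanning) simp
  moreover have "\<forall>\<^sub>F \<epsilon>::complex in at 0. \<epsilon> \<noteq> 0"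
    by (simp add: eventually_at_filter)
  ultimately have "\<forall>\<^sub>F \<epsilon> in at 0. \<epsilon> \<noteq> 0 \<and> (\<forall>d\<in>{..Suc p}. spanning d (\<lambda>j. scaled_gen j \<epsilon>))"
    by eventually_elim blast
  then have "\<exists>\<epsilon>::complex. \<epsilon> \<noteq> 0 \<and> (\<forall>d\<in>{..Suc p}. spanning d (\<lambda>j. scaled_gen j \<epsilon>))"
    by (rule eventually_happens'[rotated]) simp
  then obtain \<epsilon> :: complex where \<epsilon>: "\<epsilon> \<noteq> 0"
    "\<And>d. d \<le> Suc p \<Longrightarrow> spanning d (\<lambda>j. scaled_gen j \<epsilon>)"
    by auto
  \<comment> \<open>One \<epsilon> serves all finitely many degrees, so none of the pivot products
    vanishes at the common point \<open>x0\<close>, nor does their product.\<close>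
  define x0 where "x0 = restrict (\<lambda>a. \<epsilon> ^ wt a) A"
  have "\<forall>d\<in>{..Suc p}. \<exists>D\<in>Collect (holomorphic_in A (cspace A)). D x0 \<noteq> 0 \<and>
      (\<forall>x. D x \<noteq> 0 \<longrightarrow> (spanning d (\<lambda>j. gen j x)))"
  proof
    fix d assume "d \<in> {..Suc p}"
    then have sp0: "spanning d (\<lambda>j. gen j x0)"
      by (intro gen_spanning_of_scaled[of \<epsilon>] \<epsilon>) (auto simp: x0_def)
    show "\<exists>D\<in>Collect (holomorphic_in A (cspace A)). D x0 \<noteq> 0 \<and>
      (\<forall>x. D x \<noteq> 0 \<longrightarrow> (spanning d (\<lambda>j. gen j x)))"
      unfolding spanning_def
    proof (rule spanning_open[where f = gen and C = "Collect (holomorphic_in A (cspace A))",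
          OF finite_cone_deg finite_gen_index])
      show "\<forall>g. \<exists>s. \<forall>i\<in>cone_deg d. g i = (\<Sum>j\<in>gen_index d. s j * gen j x0 i)"
        by (rule sp0[unfolded spanning_def])
    qed (auto intro: holomorphic_in_const holomorphic_in_mult holomorphic_in_diff holomorphic_in_gen)
  qed
  then have "\<forall>d\<in>{..Suc p}. \<exists>D. holomorphic_in A (cspace A) D \<and> D x0 \<noteq> 0 \<and>
      (\<forall>x. D x \<noteq> 0 \<longrightarrow> spanning d (\<lambda>j. gen j x))"
    by blast
  from bchoice[OF this] obtain D where "\<forall>d\<in>{..Suc p}. holomorphic_in A (cspace A) (D d) \<and> D d x0 \<noteq> 0 \<and>
      (\<forall>x. D d x \<noteq> 0 \<longrightarrow> spanning d (\<lambda>j. gen j x))"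
    by blast
  then have D: "\<And>d. d \<le> Suc p \<Longrightarrow> holomorphic_in A (cspace A) (D d)" "\<And>d. d \<le> Suc p \<Longrightarrow> D d x0 \<noteq> 0"
    "\<And>d x. d \<le> Suc p \<Longrightarrow> D d x \<noteq> 0 \<Longrightarrow> spanning d (\<lambda>j. gen j x)"
    by auto
  \<comment> \<open>The factors \<open>x a\<close> keep every coefficient nonzero; later this
    prevents the f_i from vanishing identically.\<close>
  define E where "E x = (\<Prod>d\<le>Suc p. D d x) * (\<Prod>a\<in>A. x a)" for x :: "nat \<times> nat \<Rightarrow> complex"
  have "holomorphic_in A (cspace A) E"
    unfolding E_def using D(1)
    by (intro holomorphic_in_mult holomorphic_in_prod holomorphic_in_coord finite_A) auto
  moreover have "x0 \<in> cspace A" by (simp add: x0_def)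
  moreover have "E x0 \<noteq> 0"
    using D(2) \<epsilon>(1) finite_A by (auto simp: E_def x0_def simp del: prod.atMost_Suc)
  moreover have "good x \<and> (\<forall>a\<in>A. x a \<noteq> 0)" if "E x \<noteq> 0" for x
  proof
    have "D d x \<noteq> 0" if "d \<le> Suc p" for d
      using \<open>E x \<noteq> 0\<close> that by (simp add: E_def prod_zero_iff del: prod.atMost_Suc)
    note nz = this
    have "\<forall>v\<in>cone_deg d. delta v \<in> fs.span (gens x d)" if "d \<le> Suc p" for d
      unfolding gens_eq
    proof (rule iffD2[OF span_image_iff[OF finite_cone_deg finite_gen_index]])
      show "\<forall>g. \<exists>s. \<forall>i\<in>cone_deg d. g i = (\<Sum>j\<in>gen_index d. s j * gen j x i)"
        using D(3)[OF that nz[OF that]] unfolding spanning_def .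
    qed (rule sum_delta_support(1))
    then show "good x" by (intro good_of_bounded) blast
    show "\<forall>a\<in>A. x a \<noteq> 0"
      using \<open>E x \<noteq> 0\<close> finite_A by (simp add: E_def prod_zero_iff)
  qed
  ultimately show ?thesis by blast
qed

end


section \<open>Contiguity operators\<close>


lemma span_directed_Union:
  assumes "mono G" and "v \<in> fs.span (\<Union>n. G n)"
  shows "\<exists>n::nat. v \<in> fs.span (G n)"
  using assms(2)
proof (induction rule: fs.span_induct_alt)
  case base
  show ?case by (intro exI fs.span_zero)
next
  case (step c x y)
  then obtain m n where mn: "x \<in> G m" "y \<in> fs.span (G n)" by blast
  have "x \<in> fs.span (G (max m n))" "y \<in> fs.span (G (max m n))"
    using mn monoD[OF assms(1), of m "max m n"] monoD[OF assms(1), of n "max m n"] fs.span_mono[of "G n" "G (max m n)"]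
    by (auto intro: fs.span_base)
  then show ?case by (blast intro: fs.span_add fs.span_scale)
qed

lemma span_image_linear:
  assumes "v \<in> fs.span X" and "L 0 = 0" and "\<And>g h. L (g + h) = L g + L h" and "\<And>c g. L (cscale c g) = cscale c (L g)"
    and "\<And>g. g \<in> X \<Longrightarrow> L g \<in> fs.span Y"
  shows "L v \<in> fs.span Y"
  using assms(1)
proof (induction rule: fs.span_induct_alt)
  case base
  show ?case unfolding assms(2) by (rule fs.span_zero)
next
  case (step c x y)
  then show ?case unfolding assms(3,4) by (blast intro: fs.span_add fs.span_scale assms(5))
qed

lemma span_in_span:
  assumes "v \<in> fs.span X" and "\<And>g. g \<in> X \<Longrightarrow> g \<in> fs.span Y"
  shows "v \<in> fs.span Y"
  using fs.span_minimal[of X "fs.span Y"] assms by auto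

context ladder
begin

text \<open>An Euler operator of a GKZ system, written on coefficient functions: a diagonal part,
  plus a leading part that raises the degree by one.\<close>

definition opr :: "(nat \<times> nat \<Rightarrow> complex) \<Rightarrow> (nat + nat \<Rightarrow> complex) \<Rightarrow> nat + nat
    \<Rightarrow> (expo \<Rightarrow> complex) \<Rightarrow> expo \<Rightarrow> complex"
  where "opr x \<tau> k g = (\<lambda>v. (of_int (v k) - \<tau> k) * g v + (\<Sum>a\<in>A. of_int (vec a k) * x a * g (v - vec a)))"

lemma opr_delta: "opr x \<tau> k (delta v) = cscale (of_int (v k) - \<tau> k) (delta v) + lead x k v"
proof
  fix w
  have "delta v (w - vec a) = delta (v + vec a) w" for a
    by (simp only: delta_apply diff_eq_eq)
  then show "opr x \<tau> k (delta v) w = (cscale (of_int (v k) - \<tau> k) (delta v) + lead x k v) w"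
    by (simp only: opr_def lead_def sum_fun_apply plus_fun_apply cscale_apply) (auto simp: delta_apply)
qed

lemma opr_zero: "opr x \<tau> k 0 = 0"
  by (rule ext) (simp add: opr_def)

lemma opr_add: "opr x \<tau> k (g + h) = opr x \<tau> k g + opr x \<tau> k h"
  by (rule ext) (simp add: opr_def algebra_simps sum.distrib)

lemma opr_cscale: "opr x \<tau> k (cscale c g) = cscale c (opr x \<tau> k g)"
  by (rule ext) (simp add: opr_def algebra_simps sum_distrib_left)

text \<open>Shifts commute among themselves. The commutator of the diagonal part of k with the
  leading part of l has coefficients \<open>vec a k * vec a l * x a\<close>; they are symmetric in k
  and l, so the two mixed commutators cancel.\<close>

lemma opr_commute: "opr x \<tau> k (opr x \<tau> l g) = opr x \<tau> l (opr x \<tau> k g)"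
proof
  fix v
  let ?B = "\<lambda>k l. (\<Sum>a\<in>A. \<Sum>b\<in>A. of_int (vec a k) * x a * (of_int (vec b l) * x b * g (v - vec a - vec b)))"
  let ?C = "\<lambda>k l. (\<Sum>a\<in>A. ((of_int (v k) - \<tau> k) * of_int (vec a l) + of_int (vec a k) * (of_int (v l) - \<tau> l)
            - of_int (vec a k) * of_int (vec a l)) * x a * g (v - vec a))"
  have expand: "opr x \<tau> k (opr x \<tau> l g) v =
      (of_int (v k) - \<tau> k) * (of_int (v l) - \<tau> l) * g v
      + (\<Sum>a\<in>A. ((of_int (v k) - \<tau> k) * of_int (vec a l) + of_int (vec a k) * (of_int (v l) - \<tau> l)
            - of_int (vec a k) * of_int (vec a l)) * x a * g (v - vec a)) + ?B k l" for k l
  proof -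
    have "opr x \<tau> k (opr x \<tau> l g) v = (of_int (v k) - \<tau> k) * (of_int (v l) - \<tau> l) * g v
      + (of_int (v k) - \<tau> k) * (\<Sum>a\<in>A. of_int (vec a l) * x a * g (v - vec a))
      + (\<Sum>a\<in>A. of_int (vec a k) * x a * ((of_int (v l) - of_int (vec a l) - \<tau> l) * g (v - vec a)
         + (\<Sum>b\<in>A. of_int (vec b l) * x b * g (v - vec a - vec b))))"
      unfolding opr_def by (simp only: minus_apply of_int_diff distrib_left mult.assoc)
    then show ?thesis
      by (simp add: sum_distrib_left sum.distrib sum_subtractf algebra_simps)
  qed
  have B: "?B k l = ?B l k"
  proof -
    have "?B k l = (\<Sum>b\<in>A. \<Sum>a\<in>A. of_int (vec a k) * x a * (of_int (vec b l) * x b * g (v - vec a - vec b)))"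
      by (rule sum.swap)
    also have "\<dots> = ?B l k"
    proof (intro sum.cong refl)
      fix a b
      have "v - vec a - vec b = v - vec b - vec a" by (simp only: diff_diff_eq add.commute)
      then show "of_int (vec a k) * x a * (of_int (vec b l) * x b * g (v - vec a - vec b)) =
          of_int (vec b l) * x b * (of_int (vec a k) * x a * g (v - vec b - vec a))"
        by (simp only: mult.commute mult.left_commute)
    qed
    finally show ?thesis .
  qed
  have C: "?C k l = ?C l k"
    by (intro sum.cong refl) (simp add: algebra_simps)
  show "opr x \<tau> k (opr x \<tau> l g) v = opr x \<tau> l (opr x \<tau> k g) v"
    unfolding expand[of k l] expand[of l k] B C by (simp only: mult.commute)
qed

definition rels :: "(nat \<times> nat \<Rightarrow> complex) \<Rightarrow> (nat + nat \<Rightarrow> complex) \<Rightarrow> expo set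
    \<Rightarrow> (expo \<Rightarrow> complex) set"
  where "rels x \<tau> X = {opr x \<tau> k (delta v) | k v. k \<in> Idx \<and> v \<in> X}"

lemma rels_mono: "X \<subseteq> Y \<Longrightarrow> rels x \<tau> X \<subseteq> rels x \<tau> Y"
  unfolding rels_def by blast

definition nonresonant :: "(nat + nat \<Rightarrow> complex) \<Rightarrow> bool"
  where "nonresonant \<tau> \<longleftrightarrow> (\<forall>c\<in>facets. pairing c \<tau> \<notin> \<int>)"

text \<open>For a facet functional only cells off the facet survive on the right, and nonresonance
  keeps the diagonal coefficient nonzero. So \<open>delta v\<close> is expressed through exponents
  with a larger value on that facet.\<close>

lemma opr_pairing:
  "(\<Sum>k\<in>Idx. cscale (of_int (c k)) (opr x \<tau> k (delta v))) =
    cscale (of_int (pairing c v) - pairing c \<tau>) (delta v)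
    + (\<Sum>a\<in>A. cscale (of_int (pairing c (vec a)) * x a) (delta (v + vec a)))"
proof
  fix w
  have "(\<Sum>k\<in>Idx. of_int (c k) * (opr x \<tau> k (delta v) w)) =
      (\<Sum>k\<in>Idx. of_int (c k) * (of_int (v k) - \<tau> k)) * delta v w +
      (\<Sum>k\<in>Idx. \<Sum>a\<in>A. of_int (c k) * (of_int (vec a k) * x a * delta (v + vec a) w))"
    by (simp only: opr_delta lead_def plus_fun_apply cscale_apply sum_fun_apply distrib_left sum.distrib
        sum_distrib_left sum_distrib_right mult.assoc)
  also have "(\<Sum>k\<in>Idx. of_int (c k) * (of_int (v k) - \<tau> k)) = of_int (pairing c v) - pairing c \<tau>"
    by (simp add: pairing_def algebra_simps sum_subtractf)
  also have "(\<Sum>k\<in>Idx. \<Sum>a\<in>A. of_int (c k) * (of_int (vec a k) * x a * delta (v + vec a) w)) =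
      (\<Sum>a\<in>A. of_int (pairing c (vec a)) * x a * delta (v + vec a) w)"
    by (subst sum.swap) (simp add: pairing_def sum_distrib_left sum_distrib_right mult.assoc)
  finally show "(\<Sum>k\<in>Idx. cscale (of_int (c k)) (opr x \<tau> k (delta v))) w =
    (cscale (of_int (pairing c v) - pairing c \<tau>) (delta v)
    + (\<Sum>a\<in>A. cscale (of_int (pairing c (vec a)) * x a) (delta (v + vec a)))) w"
    by (simp only: plus_fun_apply cscale_apply sum_fun_apply)
qed

definition cone :: "expo set"
  where "cone = deg ` {M. set_mset M \<subseteq> A}"

lemma cone_iff: "v \<in> cone \<longleftrightarrow> supported v \<and> (\<forall>c\<in>facets. 0 \<le> pairing c v)"
proof
  assume "v \<in> cone"
  then obtain M where "set_mset M \<subseteq> A" "v = deg M" unfolding cone_def by blast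
  then show "supported v \<and> (\<forall>c\<in>facets. 0 \<le> pairing c v)"
    using supported_deg[of M] pairing_deg_nonneg[of _ M] by simp
next
  assume R: "supported v \<and> (\<forall>c\<in>facets. 0 \<le> pairing c v)"
  obtain M where "set_mset M \<subseteq> A" "deg M = v"
    using in_cone_imp_deg[OF conjunct1[OF R] bspec[OF conjunct2[OF R]]] by blast
  then show "v \<in> cone" unfolding cone_def by blast
qed

lemma cone_eq_Union: "v \<in> cone \<longleftrightarrow> (\<exists>d. v \<in> cone_deg d)"
  by (auto simp: cone_def cone_deg_def)

text \<open>Solve for \<open>delta v\<close> along a violated facet. All exponents that appear
  improve on this facet and lose on none, so the total violation decreases.\<close>

lemma span_cone:
  assumes "nonresonant \<tau>" and closed: "\<And>v a. v \<in> X \<Longrightarrow> a \<in> A \<Longrightarrow> v + vec a \<in> X"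
    and supp: "\<And>v. v \<in> X \<Longrightarrow> supported v"
  shows "v \<in> X \<Longrightarrow> delta v \<in> fs.span (delta ` cone \<union> rels x \<tau> X)"
proof (induction "\<Sum>c\<in>facets. nat (- pairing c v)" arbitrary: v rule: less_induct)
  case less
  let ?Y = "fs.span (delta ` cone \<union> rels x \<tau> X)"
  show ?case
  proof (cases "v \<in> cone")
    case True
    then show ?thesis by (intro fs.span_base) auto
  next
    case False
    then obtain c where c: "c \<in> facets" "pairing c v < 0"
      using supp[OF less.prems] by (auto simp: cone_iff not_le)
    let ?z = "of_int (pairing c v) - pairing c \<tau>"
    have "?z \<noteq> 0"
      using assms(1) c(1) unfolding nonresonant_def by (metis Ints_of_int eq_iff_diff_eq_0)
    let ?s = "\<Sum>a\<in>A. cscale (of_int (pairing c (vec a)) * x a) (delta (v + vec a))"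
    have "?s \<in> ?Y"
    proof (intro fs.span_sum)
      fix a assume a: "a \<in> A"
      show "cscale (of_int (pairing c (vec a)) * x a) (delta (v + vec a)) \<in> ?Y"
      proof (cases "pairing c (vec a) = 0")
        case True
        then have "cscale (of_int (pairing c (vec a)) * x a) (delta (v + vec a)) = 0"
          by (simp add: fun_eq_iff)
        then show ?thesis by (simp only: fs.span_zero)
      next
        case False
        then have pos: "0 < pairing c (vec a)" using facet_vec_nonneg[OF c(1) a] by simp
        have "(\<Sum>c\<in>facets. nat (- pairing c (v + vec a))) < (\<Sum>c\<in>facets. nat (- pairing c v))"
        proof (rule sum_strict_mono_ex1[OF finite_facets])
          show "\<forall>c\<in>facets. nat (- pairing c (v + vec a)) \<le> nat (- pairing c v)"
            using facet_vec_nonneg[OF _ a] by (auto simp only: pairing_add intro!: nat_mono) force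
          show "\<exists>c\<in>facets. nat (- pairing c (v + vec a)) < nat (- pairing c v)"
            using c pos by (intro bexI[of _ c]) (auto simp only: pairing_add)
        qed
        then show ?thesis
          using less.hyps closed[OF less.prems a] by (intro fs.span_scale) blast
      qed
    qed
    moreover have "(\<Sum>k\<in>Idx. cscale (of_int (c k)) (opr x \<tau> k (delta v))) \<in> ?Y"
      using less.prems by (intro fs.span_sum fs.span_scale fs.span_base) (auto simp: rels_def)
    ultimately have "cscale ?z (delta v) \<in> ?Y"
      unfolding opr_pairing using fs.span_add_eq2 by blast
    then have "cscale (1 / ?z) (cscale ?z (delta v)) \<in> ?Y"
      by (rule fs.span_scale)
    then show ?thesis
      using \<open>?z \<noteq> 0\<close> by (simp only: fs.scale_scale) simp
  qed
qed

definition Sdelta :: "(nat \<times> nat) list \<Rightarrow> expo \<Rightarrow> complex"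
  where "Sdelta u = delta (deg (mset u))"

text \<open>A leading part differs from a relation only by its diagonal part, which has lower
  degree.\<close>

lemma span_S_cone_deg:
  assumes "good x"
  shows "v \<in> cone_deg d \<Longrightarrow> delta v \<in> fs.span (Sdelta ` S \<union> rels x \<tau> cone)"
proof (induction d arbitrary: v rule: less_induct)
  case (less d)
  have "delta v \<in> fs.span (gens x d)"
    using assms less.prems by (simp add: good_def)
  then show ?case
  proof (rule span_in_span)
    fix g assume "g \<in> gens x d"
    then consider u where "g = delta (deg (mset u))" "u \<in> S"
      | k M where "g = lead x k (deg M)" "k \<in> Idx" "set_mset M \<subseteq> A" "Suc (size M) = d"
      unfolding gens_def by blast
    then show "g \<in> fs.span (Sdelta ` S \<union> rels x \<tau> cone)"
    proof cases
      case (1 u)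
      then show ?thesis by (intro fs.span_base) (auto simp: Sdelta_def)
    next
      case (2 k M)
      then have "deg M \<in> cone_deg (size M)" "deg M \<in> cone" by (auto simp: cone_deg_def cone_def)
      then have "delta (deg M) \<in> fs.span (Sdelta ` S \<union> rels x \<tau> cone)"
        using 2 by (intro less.IH[of "size M"]) auto
      moreover have "opr x \<tau> k (delta (deg M)) \<in> fs.span (Sdelta ` S \<union> rels x \<tau> cone)"
        using 2 \<open>deg M \<in> cone\<close> by (intro fs.span_base) (auto simp: rels_def)
      moreover have "g = opr x \<tau> k (delta (deg M)) - cscale (of_int (deg M k) - \<tau> k) (delta (deg M))"
        by (simp only: 2(1) opr_delta add_diff_cancel_left')
      ultimately show ?thesis by (simp only: fs.span_diff fs.span_scale)
    qed
  qed
qed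

definition expos :: "expo set"
  where "expos = {v. supported v}"

lemma span_S:
  assumes "good x" "nonresonant \<tau>" "v \<in> X" "cone \<subseteq> X" "X \<subseteq> expos" "\<And>v a. v \<in> X \<Longrightarrow> a \<in> A \<Longrightarrow> v + vec a \<in> X"
  shows "delta v \<in> fs.span (Sdelta ` S \<union> rels x \<tau> X)"
proof (rule span_in_span[OF span_cone[OF assms(2,6) _ assms(3)]])
  show "supported v" if "v \<in> X" for v using that assms(5) by (auto simp: expos_def)
  fix g assume "g \<in> delta ` cone \<union> rels x \<tau> X"
  then consider v d where "g = delta v" "v \<in> cone_deg d" | "g \<in> rels x \<tau> X"
    by (auto simp: cone_eq_Union)
  then show "g \<in> fs.span (Sdelta ` S \<union> rels x \<tau> X)"
  proof cases
    case 1
    have "fs.span (Sdelta ` S \<union> rels x \<tau> cone) \<subseteq> fs.span (Sdelta ` S \<union> rels x \<tau> X)"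
      using rels_mono[OF assms(4), of x \<tau>] by (intro fs.span_mono) auto
    then show ?thesis using span_S_cone_deg[OF assms(1) 1(2)] 1(1) by blast
  qed (auto intro: fs.span_base)
qed

text \<open>
  The commuting operators make the functions on a translate of \<open>cone\<close> a module over the polynomial
  ring in \<open>Idx\<close>, and \<open>opow x \<tau> w (u, e)\<close> is the action of the monomial \<open>e\<close> on the translate of \<open>u\<close>.
\<close>

definition opow :: "(nat \<times> nat \<Rightarrow> complex) \<Rightarrow> (nat + nat \<Rightarrow> complex) \<Rightarrow> expo
    \<Rightarrow> (nat \<times> nat) list \<times> (nat + nat) multiset \<Rightarrow> expo \<Rightarrow> complex"
  where "opow x \<tau> w ue = fold_mset (opr x \<tau>) (delta (deg (mset (fst ue)) - w)) (snd ue)"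

lemma opow_add_mset: "opow x \<tau> w (u, add_mset k e) = opr x \<tau> k (opow x \<tau> w (u, e))"
proof -
  interpret comp_fun_commute "opr x \<tau>"
    by standard (simp add: fun_eq_iff opr_commute)
  show ?thesis by (simp add: opow_def)
qed

lemma opow_empty: "opow x \<tau> w (u, {#}) = delta (deg (mset u) - w)"
  by (simp add: opow_def)

lemma basis_index_mono: "m \<le> n \<Longrightarrow> basis_index m \<subseteq> basis_index n"
  by (auto simp: basis_index_def)

text \<open>With \<open>e\<close> nonempty the element lies in the image of some operator; these
  indices account for the relations, the rest for translates of S.\<close>

definition pos_index :: "nat \<Rightarrow> ((nat \<times> nat) list \<times> (nat + nat) multiset) set"
  where "pos_index n = {(u, e) \<in> basis_index n. e \<noteq> {#}}"

lemma finite_pos_index: "finite (pos_index n)"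
  by (rule finite_subset[OF _ finite_basis_index[of n]]) (auto simp: pos_index_def)

lemma opr_opow_in_span:
  assumes "g \<in> fs.span (opow x \<tau> w ` basis_index n)" "k \<in> Idx"
  shows "opr x \<tau> k g \<in> fs.span (opow x \<tau> w ` pos_index (Suc n))"
proof (rule span_image_linear[OF assms(1) opr_zero opr_add opr_cscale])
  fix h assume "h \<in> opow x \<tau> w ` basis_index n"
  then obtain u e where ue: "(u, e) \<in> basis_index n" "h = opow x \<tau> w (u, e)" by auto
  then have "(u, add_mset k e) \<in> pos_index (Suc n)"
    using assms(2) by (auto simp: basis_index_def pos_index_def)
  then show "opr x \<tau> k h \<in> fs.span (opow x \<tau> w ` pos_index (Suc n))"
    unfolding ue(2) opow_add_mset[symmetric] by (intro fs.span_base imageI)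
qed

text \<open>\<open>lead\<close> commutes with translation, so spanning carries over to each
  translate of the cone. Only the diagonal parts change, and they have lower degree.\<close>

lemma delta_shift_in_span:
  assumes "good x"
  shows "v \<in> cone_deg d \<Longrightarrow> delta (v - w) \<in> fs.span (opow x \<tau> w ` basis_index d)"
proof (induction d arbitrary: v rule: less_induct)
  case (less d)
  define shift :: "(expo \<Rightarrow> complex) \<Rightarrow> expo \<Rightarrow> complex"
    where "shift g = (\<lambda>v. g (v + w))" for g
  have shift_delta: "shift (delta v) = delta (v - w)" for v
    by (rule ext) (simp only: shift_def delta_apply eq_diff_eq)
  have shift_lead: "shift (lead x k v) = lead x k (v - w)" for k v
  proof -
    have "shift (lead x k v) = (\<Sum>b\<in>A. cscale (of_int (vec b k) * x b) (shift (delta (v + vec b))))"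
      by (rule ext) (simp only: lead_def shift_def sum_fun_apply cscale_apply)
    also have "\<dots> = (\<Sum>b\<in>A. cscale (of_int (vec b k) * x b) (delta (v - w + vec b)))"
      by (simp only: shift_delta diff_add_eq)
    finally show ?thesis by (simp only: lead_def)
  qed
  have "delta v \<in> fs.span (gens x d)"
    using assms less.prems by (simp add: good_def)
  then have "shift (delta v) \<in> fs.span (opow x \<tau> w ` basis_index d)"
  proof (rule span_image_linear)
    show "shift 0 = 0" by (rule ext) (simp only: shift_def zero_fun_apply)
    show "shift (g + h) = shift g + shift h" for g h by (rule ext) (simp only: shift_def plus_fun_apply)
    show "shift (cscale c g) = cscale c (shift g)" for g c by (rule ext) (simp only: shift_def cscale_apply)
    fix g assume "g \<in> gens x d"
    then consider u where "g = delta (deg (mset u))" "u \<in> S" "length u = d"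
      | k M where "g = lead x k (deg M)" "k \<in> Idx" "set_mset M \<subseteq> A" "Suc (size M) = d"
      unfolding gens_def by blast
    then show "shift g \<in> fs.span (opow x \<tau> w ` basis_index d)"
    proof cases
      case (1 u)
      then have "shift g = opow x \<tau> w (u, {#})" "(u, {#}) \<in> basis_index d"
        by (simp_all only: shift_delta opow_empty basis_index_def) auto
      then show ?thesis by (simp only: fs.span_base imageI)
    next
      case (2 k M)
      have "deg M \<in> cone_deg (size M)" using 2 by (auto simp: cone_deg_def)
      then have *: "delta (deg M - w) \<in> fs.span (opow x \<tau> w ` basis_index (size M))"
        using 2 by (intro less.IH[of "size M"]) auto
      have "pos_index d \<subseteq> basis_index d" "basis_index (size M) \<subseteq> basis_index d"
        using 2(4) by (auto simp: pos_index_def basis_index_def)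
      then have "opr x \<tau> k (delta (deg M - w)) \<in> fs.span (opow x \<tau> w ` basis_index d)"
          "delta (deg M - w) \<in> fs.span (opow x \<tau> w ` basis_index d)"
        using opr_opow_in_span[OF * 2(2)] * 2(4) fs.span_mono[OF image_mono] by blast+
      moreover have "shift g = opr x \<tau> k (delta (deg M - w)) - cscale (of_int ((deg M - w) k) - \<tau> k) (delta (deg M - w))"
        by (simp only: 2(1) shift_lead opr_delta add_diff_cancel_left')
      ultimately show ?thesis by (simp only: fs.span_diff fs.span_scale)
    qed
  qed
  then show ?case by (simp only: shift_delta)
qed

section \<open>Independence over a translate of the cone\<close>

definition cone_shift :: "expo \<Rightarrow> expo set"
  where "cone_shift w = {v. v + w \<in> cone}"

lemma cone_add: "v \<in> cone \<Longrightarrow> w \<in> cone \<Longrightarrow> v + w \<in> cone"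
  by (auto simp: cone_iff supported_def pairing_add)

lemma vec_in_cone: "a \<in> A \<Longrightarrow> vec a \<in> cone"
  by (auto simp: cone_iff supported_vec facet_vec_nonneg)

lemma cone_shift_closed: "v \<in> cone_shift w \<Longrightarrow> a \<in> A \<Longrightarrow> v + vec a \<in> cone_shift w"
  using cone_add[OF _ vec_in_cone, of "v + w" a] by (simp add: cone_shift_def add_ac)

lemma cone_shift_expos: "w \<in> cone \<Longrightarrow> cone_shift w \<subseteq> expos"
  by (auto simp: cone_shift_def expos_def cone_iff supported_def)

lemma rels_cone_shift_in_span:
  assumes "good x" "g \<in> rels x \<tau> (cone_shift w)"
  shows "g \<in> fs.span (\<Union>n. opow x \<tau> w ` pos_index n)"
proof -
  obtain k v where kv: "g = opr x \<tau> k (delta v)" "k \<in> Idx" "v + w \<in> cone"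
    using assms(2) unfolding rels_def cone_shift_def by blast
  then obtain d where "v + w \<in> cone_deg d" by (auto simp: cone_eq_Union)
  then have "delta v \<in> fs.span (opow x \<tau> w ` basis_index d)"
    using delta_shift_in_span[OF assms(1), of "v + w" d w] by (simp only: add_diff_cancel_right')
  then have "g \<in> fs.span (opow x \<tau> w ` pos_index (Suc d))"
    using opr_opow_in_span kv by blast
  moreover have "fs.span (opow x \<tau> w ` pos_index (Suc d)) \<subseteq> fs.span (\<Union>n. opow x \<tau> w ` pos_index n)"
    by (intro fs.span_mono) auto
  ultimately show ?thesis by blast
qed

text \<open>A relation involving \<open>u0\<close> would let S without \<open>u0\<close>, modulo
  relations, span the translates of all of S. In bounded degree fewer elements than
  \<open>basis_index n\<close> has would then span all lattice points of \<open>cone_le n\<close>,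
  of which there are at least as many.\<close>

lemma S_independent_cone_shift:
  assumes "good x" "nonresonant \<tau>" "w \<in> cone"
    and rel: "(\<Sum>u\<in>S. cscale (s u) (Sdelta u)) \<in> fs.span (rels x \<tau> (cone_shift w))"
    and u0: "u0 \<in> S"
  shows "s u0 = 0"
proof (rule ccontr)
  assume nz: "s u0 \<noteq> 0"
  \<comment> \<open>The candidate spanning sets form an increasing chain, because the whole space is
    infinite-dimensional and only bounded pieces can be counted.\<close>
  define G where "G n = opow x \<tau> w ` pos_index n \<union> Sdelta ` (S - {u0})" for n
  have "mono G"
    unfolding G_def using basis_index_mono by (intro monoI) (fastforce simp: pos_index_def)
  have rels_G: "g \<in> fs.span (\<Union>n. G n)" if "g \<in> rels x \<tau> (cone_shift w)" for g
    using rels_cone_shift_in_span[OF assms(1) that] fs.span_mono[of "\<Union>n. opow x \<tau> w ` pos_index n" "\<Union>n. G n"]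
    by (auto simp: G_def)
  have S_G: "Sdelta u \<in> fs.span (\<Union>n. G n)" if "u \<in> S" for u
  proof (cases "u = u0")
    case True
    have "cscale (s u0) (Sdelta u0) = (\<Sum>u\<in>S. cscale (s u) (Sdelta u)) - (\<Sum>u\<in>S - {u0}. cscale (s u) (Sdelta u))"
      using sum.remove[OF finite_S u0, of "\<lambda>u. cscale (s u) (Sdelta u)"] by (simp only: add_diff_cancel_right')
    also have "\<dots> \<in> fs.span (\<Union>n. G n)"
    proof (rule fs.span_diff)
      show "(\<Sum>u\<in>S. cscale (s u) (Sdelta u)) \<in> fs.span (\<Union>n. G n)"
        using rel rels_G by (rule span_in_span)
      show "(\<Sum>u\<in>S - {u0}. cscale (s u) (Sdelta u)) \<in> fs.span (\<Union>n. G n)"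
        by (intro fs.span_sum fs.span_scale fs.span_base) (auto simp: G_def)
    qed
    finally have "cscale (1 / s u0) (cscale (s u0) (Sdelta u0)) \<in> fs.span (\<Union>n. G n)"
      by (rule fs.span_scale)
    then show ?thesis using nz True by (simp only: fs.scale_scale) simp
  qed (use that in \<open>auto simp: G_def intro: fs.span_base\<close>)
  have "\<exists>n. delta (deg (mset u) - w) \<in> fs.span (G n)" if "u \<in> S" for u
  proof (rule span_directed_Union[OF \<open>mono G\<close>])
    have "deg (mset u) - w \<in> cone_shift w"
      using that S_set by (auto simp: cone_shift_def cone_def)
    moreover have "cone \<subseteq> cone_shift w"
      using cone_add[OF _ assms(3)] by (auto simp: cone_shift_def)
    ultimately have "delta (deg (mset u) - w) \<in> fs.span (Sdelta ` S \<union> rels x \<tau> (cone_shift w))"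
      using assms(1-3) by (intro span_S cone_shift_expos cone_shift_closed)
    then show "delta (deg (mset u) - w) \<in> fs.span (\<Union>n. G n)"
      by (rule span_in_span) (use S_G rels_G in auto)
  qed
  then obtain N where N: "\<And>u. u \<in> S \<Longrightarrow> delta (deg (mset u) - w) \<in> fs.span (G (N u))"
    by metis
  \<comment> \<open>The summand p makes room for all of S in \<open>basis_index n\<close>; the
    maximum makes room for the expansions of the translates of S.\<close>
  define n where "n = p + Max (N ` S)"
  have "N u \<le> n" if "u \<in> S" for u
    using finite_S that by (auto simp: n_def intro: trans_le_add2)
  then have S_n: "delta (deg (mset u) - w) \<in> fs.span (G n)" if "u \<in> S" for u
    using N[OF that] fs.span_mono[OF monoD[OF \<open>mono G\<close>, of "N u" n]] that by blast
  have B_n: "opow x \<tau> w ue \<in> fs.span (G n)" if "ue \<in> basis_index n" for ue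
  proof (cases "snd ue = {#}")
    case True
    then have "ue = (fst ue, {#})" by (metis prod.collapse)
    then have "opow x \<tau> w ue = delta (deg (mset (fst ue)) - w)" by (metis opow_empty)
    then show ?thesis using S_n that by (auto simp: basis_index_def)
  next
    case False
    then have "ue \<in> pos_index n" using that by (auto simp: pos_index_def)
    then show ?thesis by (intro fs.span_base) (auto simp: G_def)
  qed
  have "card ((\<lambda>v. v - w) ` cone_le n) \<le> card (G n)"
  proof (rule card_le_of_delta_in_span)
    show "finite (G n)"
      using finite_pos_index[of n] finite_S by (simp add: G_def)
    fix v' assume "v' \<in> (\<lambda>v. v - w) ` cone_le n"
    then obtain v where v: "v' = v - w" "v \<in> cone_le n" by blast
    then obtain d where d: "v \<in> cone_deg d" "d \<le> n" by (auto simp: cone_le_def cone_deg_def)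
    have "delta (v - w) \<in> fs.span (opow x \<tau> w ` basis_index d)"
      by (rule delta_shift_in_span[OF assms(1) d(1)])
    then show "delta v' \<in> fs.span (G n)"
      unfolding v(1) by (rule span_in_span) (use B_n basis_index_mono[OF d(2)] in auto)
  qed
  moreover have "card ((\<lambda>v. v - w) ` cone_le n) = card (cone_le n)"
    by (rule card_image) (auto intro!: inj_onI)
  moreover have "card (G n) < card (basis_index n)"
  proof -
    let ?E = "(\<lambda>u. (u, {#} :: (nat + nat) multiset)) ` S"
    have E: "?E \<subseteq> basis_index n" using S_length by (auto simp: basis_index_def n_def intro: trans_le_add1)
    have "pos_index n = basis_index n - ?E" by (auto simp: pos_index_def basis_index_def)
    moreover have "card ?E = card S" by (rule card_image) (auto intro: inj_onI)
    moreover have "card (basis_index n - ?E) = card (basis_index n) - card ?E"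
      by (rule card_Diff_subset[OF finite_imageI[OF finite_S] E])
    ultimately have "card (pos_index n) + card S = card (basis_index n)"
      using card_mono[OF finite_basis_index E] by simp
    moreover have "card (G n) \<le> card (pos_index n) + card (S - {u0})"
      unfolding G_def using finite_S finite_pos_index[of n]
      by (intro order_trans[OF card_Un_le] add_mono card_image_le) auto
    moreover have "card (S - {u0}) < card S" by (rule card_Diff1_less[OF finite_S u0])
    ultimately show ?thesis by simp
  qed
  ultimately show False using card_basis_index_le[of n] by simp
qed

section \<open>Exhausting all exponents by translates\<close>

definition interior :: expo
  where "interior = deg (mset_set A)"

lemma interior_in_cone: "interior \<in> cone"
  using finite_A by (auto simp: interior_def cone_def)

text \<open>For a row facet the cell (i - 1, \<open>j_sharp A i\<close>) lies off the facet: its row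
  comes before i, while its column does not come before \<open>j_sharp A i\<close>. Column facets
  are transposed.\<close>

lemma facet_pos:
  assumes "c \<in> facets"
  shows "\<exists>a\<in>A. 0 < pairing c (vec a)"
proof -
  have row: "0 < pairing (row_facet i) (vec (i - 1, j_sharp A i))" if "i \<in> {1..p}" for i
    using that j_sharp_prev_in[of i] A_bounds[of "i - 1" "j_sharp A i"] by (auto simp: pairing_vec row_facet_def)
  have flat: "(i_flat A j, j - 1) \<in> A" if "j \<in> {1..q}" for j
    using ladder.j_sharp_prev_in[OF flip, of j] that by (simp add: i_flat_converse)
  have col: "0 < pairing (col_facet j) (vec (i_flat A j, j - 1))" if "j \<in> {1..q}" for j
    using that flat[OF that] A_bounds[of "i_flat A j" "j - 1"] by (auto simp: pairing_vec col_facet_def)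
  have "0 < pairing (coord k) (vec a)" if "k \<in> Idx" "0 < vec a k" for k a
    using that by (simp add: pairing_coord)
  moreover have "\<exists>a\<in>A. 0 < vec a k" if "k \<in> Idx" for k
  proof (cases k)
    case (Inl i)
    then show ?thesis using that j_sharp_in[of i] by (intro bexI[of _ "(i, j_sharp A i)"]) (auto simp: Idx_def)
  next
    case (Inr j)
    then show ?thesis using that i_flat_in[of j] by (intro bexI[of _ "(i_flat A j, j)"]) (auto simp: Idx_def)
  qed
  moreover have "0 < pairing zero_col (vec (0, 0))" by (simp add: pairing_vec zero_col_def)
  moreover have "(0, 0) \<in> A" using j_sharp_in[of 0] by simp
  ultimately have "\<exists>a\<in>A. 0 < pairing (coord k) (vec a)" if "k \<in> Idx" for k
    using that by blast
  moreover have "\<exists>a\<in>A. 0 < pairing (row_facet i) (vec a)" if "i \<in> {1..p}" for i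
    using row[OF that] j_sharp_prev_in[of i] that by auto
  moreover have "\<exists>a\<in>A. 0 < pairing (col_facet j) (vec a)" if "j \<in> {1..q}" for j
    using col[OF that] flat[OF that] by blast
  moreover note \<open>0 < pairing zero_col (vec (0, 0))\<close> \<open>(0, 0) \<in> A\<close>
  ultimately show ?thesis
    using assms unfolding facets_def by blast
qed

lemma pairing_interior_pos:
  assumes "c \<in> facets"
  shows "0 < pairing c interior"
proof -
  have "pairing c (deg M) = (\<Sum>a\<in>#M. pairing c (vec a))" for M
    by (induction M) (simp_all only: deg_simps pairing_add pairing_0 image_mset_empty sum_mset.empty
        image_mset_add_mset sum_mset.add_mset)
  then have "pairing c interior = (\<Sum>a\<in>A. pairing c (vec a))"
    by (simp add: interior_def sum_unfold_sum_mset)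
  moreover obtain a where "a \<in> A" "0 < pairing c (vec a)" using facet_pos[OF assms] by blast
  then have "0 < (\<Sum>a\<in>A. pairing c (vec a))"
    using facet_vec_nonneg[OF assms] by (intro sum_pos2[OF finite_A])
  ultimately show ?thesis by (simp only:)
qed

fun int_multiple :: "nat \<Rightarrow> nat + nat \<Rightarrow> int"
  where "int_multiple 0 = 0" | "int_multiple (Suc n) = int_multiple n + interior"

lemma multiple_in_cone: "int_multiple n \<in> cone"
proof (induction n)
  case 0
  show ?case unfolding int_multiple.simps cone_iff pairing_0 by (simp add: supported_def)
next
  case (Suc n)
  then show ?case unfolding int_multiple.simps by (intro cone_add interior_in_cone)
qed

text \<open>Each copy of \<open>interior\<close> adds at least 1 on every facet, so as many copies
  as the sum of all violations suffice.\<close>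

lemma multiple_absorbs:
  assumes "supported v"
  shows "\<exists>n. v \<in> cone_shift (int_multiple n)"
proof -
  define n where "n = (\<Sum>c\<in>facets. nat \<bar>pairing c v\<bar>)"
  have 1: "int n \<le> pairing c (int_multiple n)" if "c \<in> facets" for c n
  proof (induction n)
    case (Suc n)
    then show ?case using pairing_interior_pos[OF that] unfolding int_multiple.simps pairing_add by simp
  qed (simp only: int_multiple.simps pairing_0 of_nat_0)
  have 2: "nat \<bar>pairing c v\<bar> \<le> n" if "c \<in> facets" for c
    unfolding n_def using finite_facets that by (intro member_le_sum) auto
  have "0 \<le> pairing c (v + int_multiple n)" if "c \<in> facets" for c
    using 1[OF that, of n] 2[OF that] unfolding pairing_add by linarith
  moreover have "supported (v + int_multiple n)"
    using assms multiple_in_cone[of n] by (simp add: cone_iff supported_def)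
  ultimately have "v + int_multiple n \<in> cone" by (simp add: cone_iff)
  then show ?thesis by (auto simp: cone_shift_def)
qed

text \<open>A relation involves finitely many exponents and the translates increase, so it already
  holds in one of them.\<close>

lemma S_independent:
  assumes "good x" "nonresonant \<tau>"
    and "(\<Sum>u\<in>S. cscale (s u) (Sdelta u)) \<in> fs.span (rels x \<tau> expos)" and "u \<in> S"
  shows "s u = 0"
proof -
  define R where "R n = rels x \<tau> (cone_shift (int_multiple n))" for n
  have "cone_shift (int_multiple n) \<subseteq> cone_shift (int_multiple (Suc n))" for n
    using cone_add[OF _ interior_in_cone] by (auto simp: cone_shift_def add.assoc[symmetric])
  then have "mono R"
    unfolding R_def by (intro mono_iff_le_Suc[THEN iffD2] allI rels_mono)
  have "rels x \<tau> expos \<subseteq> (\<Union>n. R n)"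
    using multiple_absorbs unfolding R_def rels_def expos_def by blast
  then obtain n where "(\<Sum>u\<in>S. cscale (s u) (Sdelta u)) \<in> fs.span (R n)"
    using span_directed_Union[OF \<open>mono R\<close>] assms(3) fs.span_mono by blast
  then show ?thesis
    using S_independent_cone_shift[OF assms(1,2) multiple_in_cone] assms(4) by (simp add: R_def)
qed

lemma S_spanning:
  assumes "good x" "nonresonant \<tau>" "v \<in> expos"
  shows "delta v \<in> fs.span (Sdelta ` S \<union> rels x \<tau> expos)"
  using assms
proof (intro span_S)
  show "cone \<subseteq> expos" by (auto simp: cone_iff expos_def)
  show "v + vec a \<in> expos" if "v \<in> expos" "a \<in> A" for v a
    using that supported_vec[of a] by (simp add: expos_def supported_def)
qed auto

end


section \<open>Multiplicative functions on the complement\<close>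


text \<open>The falling factorial \<open>\<alpha>(\<alpha> - 1)\<cdots>(\<alpha> - n + 1)\<close>, continued to negative \<open>n\<close>.\<close>

definition kap :: "complex \<Rightarrow> int \<Rightarrow> complex"
  where "kap \<alpha> n = Gamma (\<alpha> + 1) * rGamma (\<alpha> + 1 - of_int n)"

lemma kap_add_1: "kap \<alpha> (n + 1) = (\<alpha> - of_int n) * kap \<alpha> n"
  using rGamma_plus1[of "\<alpha> - of_int n"] by (simp add: kap_def algebra_simps)

lemma kap_nonzero:
  assumes "\<alpha> \<notin> \<int>"
  shows "kap \<alpha> n \<noteq> 0"
proof -
  have "\<alpha> + 1 - of_int n \<notin> \<int>\<^sub>\<le>\<^sub>0" "\<alpha> + 1 \<notin> \<int>\<^sub>\<le>\<^sub>0"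
    using assms Ints_diff[of "\<alpha> + 1 - of_int n" "1 - of_int n"] Ints_diff[of "\<alpha> + 1" 1] nonpos_Ints_Int by fastforce+
  then show ?thesis by (simp add: kap_def Gamma_eq_zero_iff rGamma_eq_zero_iff)
qed

lemma kap_0:
  assumes "\<alpha> \<notin> \<int>"
  shows "kap \<alpha> 0 = 1"
proof -
  have "Gamma (\<alpha> + 1) \<noteq> 0"
    using kap_nonzero[OF assms, of 0] by (auto simp: kap_def)
  then show ?thesis by (simp add: kap_def rGamma_inverse_Gamma)
qed

text \<open>\<open>\<beta>\<close> holds \<alpha> under \<open>Inl\<close>, counted from 1, and
  \<gamma> under \<open>Inr\<close>; rows are counted from 0, hence \<open>Suc\<close>. Sign and -1
  come from \<nabla>: on t_j times the function of exponent v it gives the coefficient v_j + 1 +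
  \<gamma>_j.\<close>

definition shifted :: "(nat + nat \<Rightarrow> complex) \<Rightarrow> nat + nat \<Rightarrow> complex"
  where "shifted \<beta> k = (case k of Inl i \<Rightarrow> \<beta> (Inl (Suc i)) | Inr j \<Rightarrow> - \<beta> (Inr j) - 1)"

locale arrangement = ladder +
  fixes x :: "nat \<times> nat \<Rightarrow> complex" and \<beta> :: "nat + nat \<Rightarrow> complex"
  assumes x_nonzero: "a \<in> A \<Longrightarrow> x a \<noteq> 0"
    and \<beta>_Inl: "i \<le> p \<Longrightarrow> \<beta> (Inl (Suc i)) \<notin> \<int>"
begin

abbreviation \<tau> :: "nat + nat \<Rightarrow> complex"
  where "\<tau> \<equiv> shifted \<beta>"

lemma \<tau>_simps: "\<tau> (Inl i) = \<beta> (Inl (Suc i))" "\<tau> (Inr j) = - \<beta> (Inr j) - 1"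
  by (simp_all add: shifted_def)

definition tt :: "(nat \<Rightarrow> complex) \<Rightarrow> nat \<Rightarrow> complex"
  where "tt t j = (if j = 0 then 1 else t j)"

definition F :: "nat \<Rightarrow> (nat \<Rightarrow> complex) \<Rightarrow> complex"
  where "F i t = (\<Sum>j\<in>row_cols i. x (i, j) * tt t j)"

lemma chain_poly_eq_F: "chain_poly A (Suc i) x t = F i t"
  by (simp add: chain_poly_def F_def row_cols_def tt_def)

definition Qr :: "(nat \<Rightarrow> complex) \<Rightarrow> complex"
  where "Qr = Q_reduced (p + 1) q (chain_poly A) x"

definition U :: "(nat \<Rightarrow> complex) set"
  where "U = compl_locus q Qr"

lemma prod_chain_poly: "(\<Prod>j=1..p+1. h j (chain_poly A j x t)) = (\<Prod>i=0..p. h (Suc i) (F i t))"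
  using prod.shift_bounds_cl_Suc_ivl[of "\<lambda>j. h j (chain_poly A j x t)" 0 p]
  by (simp add: chain_poly_eq_F)

lemma Qr_eq: "Qr t = (\<Prod>j=1..q. t j) * (\<Prod>i=0..p. F i t)"
  using prod_chain_poly[of "\<lambda>_ z. z" t] by (simp add: Qr_def Q_reduced_def)

lemma U_iff: "t \<in> U \<longleftrightarrow> t \<in> cspace {1..q} \<and> (\<forall>j\<in>{1..q}. t j \<noteq> 0) \<and> (\<forall>i\<le>p. F i t \<noteq> 0)"
  by (auto simp: U_def compl_locus_def Qr_eq)

lemma U_D: assumes "t \<in> U" shows "1 \<le> j \<Longrightarrow> j \<le> q \<Longrightarrow> t j \<noteq> 0" and "i \<le> p \<Longrightarrow> F i t \<noteq> 0"
  using assms by (auto simp: U_iff)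

definition xc :: "nat \<Rightarrow> nat \<Rightarrow> complex"
  where "xc i j = (if (i, j) \<in> A then x (i, j) else 0)"

lemma F_update:
  assumes "1 \<le> j"
  shows "F i (t(j := w)) = F i t + xc i j * (w - t j)"
proof -
  have "F i (t(j := w)) - F i t = (\<Sum>l\<in>row_cols i. if l = j then x (i, j) * (w - t j) else 0)"
    unfolding F_def sum_subtractf[symmetric] using assms by (intro sum.cong) (auto simp: tt_def algebra_simps)
  also have "\<dots> = xc i j * (w - t j)"
    using finite_row_cols by (simp add: xc_def row_cols_def)
  finally show ?thesis by (simp add: algebra_simps)
qed

text \<open>Functions are extended by 0 off \<open>U\<close>; this ensures that a derivative at a
  point of \<open>U\<close> sees only the values on \<open>U\<close>.\<close>

lemma U_update_eventually:
  assumes "t \<in> U" "1 \<le> j" "j \<le> q"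
  shows "\<forall>\<^sub>F w in nhds (t j). t(j := w) \<in> U"
proof -
  have "\<forall>\<^sub>F w in nhds (t j). \<forall>i\<in>{..p}. F i t + xc i j * (w - t j) \<noteq> 0"
  proof (intro eventually_ball_finite ballI)
    fix i assume "i \<in> {..p}"
    have "((\<lambda>w. F i t + xc i j * (w - t j)) \<longlongrightarrow> F i t + xc i j * (t j - t j)) (nhds (t j))"
      by (intro tendsto_intros filterlim_ident)
    then show "\<forall>\<^sub>F w in nhds (t j). F i t + xc i j * (w - t j) \<noteq> 0"
      by (rule tendsto_imp_eventually_ne) (use U_D(2)[OF assms(1)] \<open>i \<in> {..p}\<close> in simp)
  qed simp
  moreover have "\<forall>\<^sub>F w in nhds (t j). w \<noteq> 0"
    by (rule tendsto_imp_eventually_ne[OF filterlim_ident]) (use U_D(1)[OF assms] in simp)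
  ultimately show ?thesis
  proof eventually_elim
    case (elim w)
    have "t(j := w) \<in> cspace {1..q}"
      using assms by (auto simp: U_iff PiE_def extensional_def)
    moreover have "\<forall>l\<in>{1..q}. (t(j := w)) l \<noteq> 0"
      using elim U_D(1)[OF assms(1)] by simp
    moreover have "\<forall>i\<le>p. F i (t(j := w)) \<noteq> 0"
      using elim unfolding F_update[OF assms(2)] by simp
    ultimately show ?case unfolding U_iff by blast
  qed
qed

definition kappa :: "expo \<Rightarrow> complex"
  where "kappa v = (\<Prod>i=0..p. kap (\<tau> (Inl i)) (v (Inl i)))"

definition mon :: "expo \<Rightarrow> (nat \<Rightarrow> complex) \<Rightarrow> complex"
  where "mon v t = (\<Prod>j=1..q. t j powi v (Inr j)) * (\<Prod>i=0..p. F i t powi (- v (Inl i)))"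

text \<open>
  The function of the exponent \<open>v\<close>; the normalisation \<open>kappa\<close> turns the recurrences between
  these functions into the relations \<open>opr x \<tau> k\<close>.
\<close>

definition Y :: "expo \<Rightarrow> (nat \<Rightarrow> complex) \<Rightarrow> complex"
  where "Y v t = (if t \<in> U then kappa v * mon v t else 0)"

lemma \<tau>_Inl: "i \<le> p \<Longrightarrow> \<tau> (Inl i) \<notin> \<int>"
  using \<beta>_Inl by (simp add: \<tau>_simps)

lemma kappa_nonzero: "kappa v \<noteq> 0"
  using kap_nonzero \<tau>_Inl by (auto simp: kappa_def)

text \<open>The new factor is the one produced by differentiating the power \<tau> - v of
  \<open>F i\<close>.\<close>

lemma kappa_add_vec:
  assumes "i \<le> p"
  shows "kappa (v + vec (i, j)) = (\<tau> (Inl i) - of_int (v (Inl i))) * kappa v"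
proof -
  have "kappa (v + vec (i, j)) =
      (\<Prod>l=0..p. (if l = i then \<tau> (Inl i) - of_int (v (Inl i)) else 1) * kap (\<tau> (Inl l)) (v (Inl l)))"
    unfolding kappa_def by (intro prod.cong) (auto simp: kap_add_1)
  also have "\<dots> = (\<tau> (Inl i) - of_int (v (Inl i))) * kappa v"
    using assms by (simp add: prod.distrib kappa_def)
  finally show ?thesis .
qed

lemma mon_add_vec:
  assumes "t \<in> U" "i \<le> p" "j \<le> q"
  shows "mon (v + vec (i, j)) t = mon v t * tt t j / F i t"
proof -
  have "(\<Prod>l=1..q. t l powi (v + vec (i, j)) (Inr l)) = (\<Prod>l=1..q. t l powi v (Inr l) * (if l = j then t j else 1))"
    using U_D(1)[OF assms(1)] by (intro prod.cong) (auto simp: power_int_add)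
  also have "\<dots> = (\<Prod>l=1..q. t l powi v (Inr l)) * tt t j"
    using assms(3) by (simp add: prod.distrib tt_def Suc_le_eq)
  finally have 1: "(\<Prod>l=1..q. t l powi (v + vec (i, j)) (Inr l)) = (\<Prod>l=1..q. t l powi v (Inr l)) * tt t j" .
  have "(\<Prod>l=0..p. F l t powi (- (v + vec (i, j)) (Inl l))) = (\<Prod>l=0..p. F l t powi (- v (Inl l)) * (if l = i then inverse (F i t) else 1))"
    using U_D(2)[OF assms(1)] by (intro prod.cong) (auto simp: power_int_diff field_simps)
  also have "\<dots> = (\<Prod>l=0..p. F l t powi (- v (Inl l))) * inverse (F i t)"
    using assms(2) by (simp add: prod.distrib)
  finally have 2: "(\<Prod>l=0..p. F l t powi (- (v + vec (i, j)) (Inl l))) = (\<Prod>l=0..p. F l t powi (- v (Inl l))) * inverse (F i t)" .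
  show ?thesis unfolding mon_def 1 2 by (simp add: field_simps)
qed

lemma Y_add_vec:
  assumes "t \<in> U" "(i, j) \<in> A"
  shows "Y (v + vec (i, j)) t = (\<tau> (Inl i) - of_int (v (Inl i))) * tt t j / F i t * Y v t"
  using assms A_bounds[OF assms(2)] by (simp add: Y_def kappa_add_vec mon_add_vec)

definition unit :: "nat + nat \<Rightarrow> nat + nat \<Rightarrow> int"
  where "unit k l = of_bool (l = k)"

lemma Y_add_unit_Inr:
  assumes "t \<in> U" "1 \<le> j" "j \<le> q"
  shows "Y (v + unit (Inr j)) t = t j * Y v t"
proof -
  have "(\<Prod>l=1..q. t l powi (v + unit (Inr j)) (Inr l)) = (\<Prod>l=1..q. t l powi v (Inr l) * (if l = j then t j else 1))"
    using U_D(1)[OF assms(1)] by (intro prod.cong) (auto simp: power_int_add unit_def)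
  also have "\<dots> = (\<Prod>l=1..q. t l powi v (Inr l)) * t j"
    using assms by (simp add: prod.distrib)
  finally have "mon (v + unit (Inr j)) t = t j * mon v t"
    by (simp add: mon_def unit_def)
  moreover have "kappa (v + unit (Inr j)) = kappa v" by (simp add: kappa_def unit_def)
  ultimately show ?thesis by (simp add: Y_def)
qed

lemma Y_outside: "t \<notin> U \<Longrightarrow> Y v t = 0"
  by (simp add: Y_def)

text \<open>Up to a factor common to the row, adding \<open>vec (i, j)\<close> multiplies by t_j /
  \<open>F i\<close>; summing with the coefficients of row i gives \<open>F i\<close> /
  \<open>F i\<close>.\<close>

lemma row_relation:
  assumes "i \<le> p"
  shows "(of_int (v (Inl i)) - \<tau> (Inl i)) * Y v t + (\<Sum>a\<in>A. of_int (vec a (Inl i)) * x a * Y (v + vec a) t) = 0"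
proof (cases "t \<in> U")
  case True
  have "(\<Sum>a\<in>A. of_int (vec a (Inl i)) * x a * Y (v + vec a) t) = (\<Sum>a\<in>A. if fst a = i then x a * Y (v + vec a) t else 0)"
    by (rule sum.cong) auto
  also have "\<dots> = (\<Sum>j\<in>row_cols i. x (i, j) * Y (v + vec (i, j)) t)"
    by (rule sum_A_row)
  also have "\<dots> = (\<Sum>j\<in>row_cols i. (x (i, j) * tt t j) * ((\<tau> (Inl i) - of_int (v (Inl i))) / F i t * Y v t))"
    using True by (intro sum.cong) (auto simp: row_cols_def Y_add_vec)
  also have "\<dots> = F i t * ((\<tau> (Inl i) - of_int (v (Inl i))) / F i t * Y v t)"
    unfolding F_def[of i t] sum_distrib_right ..
  also have "\<dots> = (\<tau> (Inl i) - of_int (v (Inl i))) * Y v t"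
    using U_D(2)[OF True assms] by simp
  finally show ?thesis
    by (simp add: algebra_simps)
qed (simp add: Y_outside)

definition theta :: "nat \<Rightarrow> (nat \<Rightarrow> complex) \<Rightarrow> complex"
  where "theta = Q_twist (p + 1) q (chain_poly A) (\<lambda>i. \<beta> (Inl i)) (\<lambda>j. \<beta> (Inr j)) x"

text \<open>At the base point every power in \<open>Q_branch\<close> has base 1, off the cut of
  \<open>powr\<close>, so its derivative is the logarithmic derivative.\<close>

lemma theta_eq:
  assumes "t \<in> U" "1 \<le> j" "j \<le> q"
  shows "theta j t = \<beta> (Inr j) / t j + (\<Sum>i=0..p. \<tau> (Inl i) * xc i j / F i t)"
proof -
  define g where "g i w = ((F i t + xc i j * (w - t j)) / F i t) powr \<tau> (Inl i)" for i w
  define h where "h l w = ((t(j := w)) l / t l) powr \<beta> (Inr l)" for l w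
  have eq: "Q_branch (p + 1) q (chain_poly A) (\<lambda>i. \<beta> (Inl i)) (\<lambda>j. \<beta> (Inr j)) x t x (t(j := w)) =
      (\<Prod>i=0..p. g i w) * (\<Prod>l=1..q. h l w)" for w
  proof -
    have "(\<Prod>n=1..p+1. (chain_poly A n x (t(j := w)) / chain_poly A n x t) powr \<beta> (Inl n)) = (\<Prod>i=0..p. g i w)"
      using prod.shift_bounds_cl_Suc_ivl[of "\<lambda>n. (chain_poly A n x (t(j := w)) / chain_poly A n x t) powr \<beta> (Inl n)" 0 p]
      by (simp add: chain_poly_eq_F F_update[OF assms(2)] g_def \<tau>_simps)
    then show ?thesis by (simp add: Q_branch_def h_def)
  qed
  have g1: "g i (t j) = 1" if "i \<le> p" for i
    using U_D(2)[OF assms(1) that] by (simp add: g_def)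
  have h1: "h l (t j) = 1" if "l \<in> {1..q}" for l
    using U_D(1)[OF assms(1), of l] that by (simp add: h_def)
  have dg: "(g i has_field_derivative \<tau> (Inl i) * xc i j / F i t) (at (t j))" if "i \<le> p" for i
    unfolding g_def using U_D(2)[OF assms(1) that]
    by (auto intro!: derivative_eq_intros has_field_derivative_powr[THEN DERIV_chain2])
  have dh: "(h l has_field_derivative (if l = j then \<beta> (Inr j) / t j else 0)) (at (t j))" if "l \<in> {1..q}" for l
  proof (cases "l = j")
    case True
    show ?thesis unfolding h_def True using U_D(1)[OF assms]
      by (auto intro!: derivative_eq_intros has_field_derivative_powr[THEN DERIV_chain2])
  next
    case False
    then have "h l = (\<lambda>_. h l (t j))" by (intro ext) (simp add: h_def)
    then show ?thesis using False DERIV_const[of "h l (t j)" "at (t j)"] by simp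
  qed
  have "((\<lambda>w. \<Prod>i=0..p. g i w) has_field_derivative (\<Prod>i=0..p. g i (t j)) * (\<Sum>i=0..p. \<tau> (Inl i) * xc i j / F i t / g i (t j))) (at (t j))"
    by (rule has_field_derivative_prod') (use g1 dg in auto)
  moreover have "(\<Sum>i=0..p. \<tau> (Inl i) * xc i j / F i t / g i (t j)) = (\<Sum>i=0..p. \<tau> (Inl i) * xc i j / F i t)"
    by (rule sum.cong) (use g1 in auto)
  moreover have pg: "(\<Prod>i=0..p. g i (t j)) = 1" by (rule prod.neutral) (use g1 in auto)
  ultimately have Dg: "((\<lambda>w. \<Prod>i=0..p. g i w) has_field_derivative (\<Sum>i=0..p. \<tau> (Inl i) * xc i j / F i t)) (at (t j))"
    by simp
  have "((\<lambda>w. \<Prod>l=1..q. h l w) has_field_derivative (\<Prod>l=1..q. h l (t j)) * (\<Sum>l=1..q. (if l = j then \<beta> (Inr j) / t j else 0) / h l (t j))) (at (t j))"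
    by (rule has_field_derivative_prod') (use h1 dh in auto)
  moreover have "(\<Sum>l=1..q. (if l = j then \<beta> (Inr j) / t j else 0) / h l (t j)) = (\<Sum>l=1..q. if l = j then \<beta> (Inr j) / t j else 0)"
    by (rule sum.cong) (use h1 in auto)
  moreover have ph: "(\<Prod>l=1..q. h l (t j)) = 1" by (rule prod.neutral) (use h1 in auto)
  ultimately have Dh: "((\<lambda>w. \<Prod>l=1..q. h l w) has_field_derivative \<beta> (Inr j) / t j) (at (t j))"
    using assms by simp
  have "((\<lambda>w. (\<Prod>i=0..p. g i w) * (\<Prod>l=1..q. h l w)) has_field_derivative
      \<beta> (Inr j) / t j + (\<Sum>i=0..p. \<tau> (Inl i) * xc i j / F i t)) (at (t j))"
    using DERIV_mult[OF Dg Dh] unfolding pg ph by (simp add: add.commute)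
  then show ?thesis
    unfolding theta_def Q_twist_def eq by (rule DERIV_imp_deriv)
qed

lemma Y_has_derivative:
  assumes "t \<in> U" "1 \<le> j" "j \<le> q"
  shows "((\<lambda>w. Y v (t(j := w))) has_field_derivative
    Y v t * (of_int (v (Inr j)) / t j - (\<Sum>i=0..p. of_int (v (Inl i)) * xc i j / F i t))) (at (t j))"
proof -
  define g where "g i w = (F i t + xc i j * (w - t j)) powi (- v (Inl i))" for i w
  define h where "h l w = (t(j := w)) l powi v (Inr l)" for l w
  have pow: "z powi (n - 1) = z powi n / z" if "z \<noteq> 0" for z :: complex and n
    using that by (simp add: power_int_diff)
  have g1: "g i (t j) \<noteq> 0" if "i \<le> p" for i
    using U_D(2)[OF assms(1) that] by (simp add: g_def)
  have h1: "h l (t j) \<noteq> 0" if "l \<in> {1..q}" for l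
    using U_D(1)[OF assms(1), of l] that by (simp add: h_def)
  have dg: "(g i has_field_derivative - of_int (v (Inl i)) * xc i j / F i t * g i (t j)) (at (t j))" if "i \<le> p" for i
    unfolding g_def using U_D(2)[OF assms(1) that]
    by (auto intro!: derivative_eq_intros simp: pow)
  have dh: "(h l has_field_derivative (if l = j then of_int (v (Inr j)) / t j else 0) * h l (t j)) (at (t j))" if "l \<in> {1..q}" for l
  proof (cases "l = j")
    case True
    show ?thesis unfolding h_def True using U_D(1)[OF assms]
      by (auto intro!: derivative_eq_intros simp: pow)
  next
    case False
    then have "h l = (\<lambda>_. h l (t j))" by (intro ext) (simp add: h_def)
    then show ?thesis using False DERIV_const[of "h l (t j)" "at (t j)"] by simp
  qed
  have "((\<lambda>w. \<Prod>i=0..p. g i w) has_field_derivative (\<Prod>i=0..p. g i (t j)) * (\<Sum>i=0..p. - of_int (v (Inl i)) * xc i j / F i t * g i (t j) / g i (t j))) (at (t j))"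
    by (rule has_field_derivative_prod') (use g1 dg in auto)
  moreover have "(\<Sum>i=0..p. - of_int (v (Inl i)) * xc i j / F i t * g i (t j) / g i (t j)) = - (\<Sum>i=0..p. of_int (v (Inl i)) * xc i j / F i t)"
    unfolding sum_negf[symmetric] by (rule sum.cong) (use g1 in auto)
  ultimately have Dg: "((\<lambda>w. \<Prod>i=0..p. g i w) has_field_derivative (\<Prod>i=0..p. g i (t j)) * - (\<Sum>i=0..p. of_int (v (Inl i)) * xc i j / F i t)) (at (t j))"
    by simp
  have "((\<lambda>w. \<Prod>l=1..q. h l w) has_field_derivative (\<Prod>l=1..q. h l (t j)) * (\<Sum>l=1..q. (if l = j then of_int (v (Inr j)) / t j else 0) * h l (t j) / h l (t j))) (at (t j))"
    by (rule has_field_derivative_prod') (use h1 dh in auto)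
  moreover have "(\<Sum>l=1..q. (if l = j then of_int (v (Inr j)) / t j else 0) * h l (t j) / h l (t j)) = (\<Sum>l=1..q. if l = j then of_int (v (Inr j)) / t j else 0)"
    by (rule sum.cong) (use h1 in auto)
  ultimately have Dh: "((\<lambda>w. \<Prod>l=1..q. h l w) has_field_derivative (\<Prod>l=1..q. h l (t j)) * (of_int (v (Inr j)) / t j)) (at (t j))"
    using assms by simp
  have mon_t: "(\<Prod>l=1..q. h l (t j)) * (\<Prod>i=0..p. g i (t j)) = mon v t"
    by (simp add: mon_def h_def g_def)
  have "((\<lambda>w. kappa v * ((\<Prod>l=1..q. h l w) * (\<Prod>i=0..p. g i w))) has_field_derivative
     kappa v * mon v t * (of_int (v (Inr j)) / t j - (\<Sum>i=0..p. of_int (v (Inl i)) * xc i j / F i t))) (at (t j))"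
    using DERIV_cmult[OF DERIV_mult[OF Dh Dg], of "kappa v"] unfolding mon_t[symmetric] by (simp add: algebra_simps)
  moreover have "\<forall>\<^sub>F w in nhds (t j). Y v (t(j := w)) = kappa v * ((\<Prod>l=1..q. h l w) * (\<Prod>i=0..p. g i w))"
    using U_update_eventually[OF assms]
    by eventually_elim (simp add: Y_def mon_def h_def g_def F_update[OF assms(2)] del: fun_upd_apply)
  ultimately show ?thesis
    using DERIV_cong_ev[OF refl _ refl, of "\<lambda>w. Y v (t(j := w))" _ "t j"] assms(1) by (simp add: Y_def)
qed

definition nab :: "nat \<Rightarrow> ((nat \<Rightarrow> complex) \<Rightarrow> complex) \<Rightarrow> (nat \<Rightarrow> complex) \<Rightarrow> complex"
  where "nab j g t = (if t \<in> U then deriv (\<lambda>w. g (t(j := w))) (t j) + theta j t * g t else 0)"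

text \<open>The factor t_j cancels the pole of the twist along t_j and contributes the 1 hidden in
  \<open>\<tau> (Inr j)\<close>. The remaining terms carry \<open>\<tau> - v\<close> over
  \<open>F i\<close>, which is what the normalisation turns into neighbouring functions of column
  j.\<close>

lemma nab_Y:
  assumes "1 \<le> j" "j \<le> q"
  shows "nab j (Y (v + unit (Inr j))) t =
    (of_int (v (Inr j)) - \<tau> (Inr j)) * Y v t + (\<Sum>a\<in>A. of_int (vec a (Inr j)) * x a * Y (v + vec a) t)"
proof (cases "t \<in> U")
  case True
  have tj: "t j \<noteq> 0" using U_D(1)[OF True assms] .
  let ?w = "v + unit (Inr j)"
  have w: "?w (Inr j) = v (Inr j) + 1" "?w (Inl i) = v (Inl i)" for i by (simp_all add: unit_def)
  have "nab j (Y ?w) t = Y ?w t * (of_int (?w (Inr j)) / t j - (\<Sum>i=0..p. of_int (?w (Inl i)) * xc i j / F i t)) + theta j t * Y ?w t"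
    using True DERIV_imp_deriv[OF Y_has_derivative[OF True assms]] by (simp add: nab_def)
  also have "\<dots> = (of_int (v (Inr j)) - \<tau> (Inr j)) * Y v t +
      ((\<Sum>i=0..p. \<tau> (Inl i) * xc i j / F i t) - (\<Sum>i=0..p. of_int (v (Inl i)) * xc i j / F i t)) * (t j * Y v t)"
    unfolding w Y_add_unit_Inr[OF True assms] theta_eq[OF True assms] using tj
    by (simp add: \<tau>_simps field_simps)
  also have "((\<Sum>i=0..p. \<tau> (Inl i) * xc i j / F i t) - (\<Sum>i=0..p. of_int (v (Inl i)) * xc i j / F i t)) * (t j * Y v t) =
      (\<Sum>i=0..p. if (i, j) \<in> A then x (i, j) * Y (v + vec (i, j)) t else 0)"
    unfolding sum_subtractf[symmetric] sum_distrib_right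
  proof (rule sum.cong[OF refl])
    fix i
    show "(\<tau> (Inl i) * xc i j / F i t - of_int (v (Inl i)) * xc i j / F i t) * (t j * Y v t) =
        (if (i, j) \<in> A then x (i, j) * Y (v + vec (i, j)) t else 0)"
      using assms(1) by (simp add: xc_def Y_add_vec[OF True] tt_def diff_divide_distrib[symmetric] algebra_simps)
  qed
  also have "\<dots> = (\<Sum>i\<in>col_rows j. x (i, j) * Y (v + vec (i, j)) t)"
    using A_bounds by (intro sum.mono_neutral_cong_right) (auto simp: col_rows_def)
  also have "\<dots> = (\<Sum>a\<in>A. if snd a = j then x a * Y (v + vec a) t else 0)"
    by (rule sum_A_col[symmetric])
  also have "\<dots> = (\<Sum>a\<in>A. of_int (vec a (Inr j)) * x a * Y (v + vec a) t)"
    using assms(1) by (intro sum.cong) auto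
  finally show ?thesis .
qed (simp add: nab_def Y_outside)


section \<open>Evaluation and exact functions\<close>

text \<open>\<open>ev\<close> maps \<open>W\<close> onto \<open>E\<close>, which will be the space
  of all admissible rational functions; \<open>R\<close> will be the preimage of the exact ones, so
  the top cohomology becomes \<open>W\<close> modulo \<open>R\<close>.\<close>

abbreviation W :: "(expo \<Rightarrow> complex) set"
  where "W \<equiv> fs.span (delta ` expos)"

abbreviation R :: "(expo \<Rightarrow> complex) set"
  where "R \<equiv> fs.span (rels x \<tau> expos)"

abbreviation E :: "((nat \<Rightarrow> complex) \<Rightarrow> complex) set"
  where "E \<equiv> fs.span (Y ` expos)"

text \<open>For infinite support the sum is 0 by convention, so linearity is available on
  \<open>W\<close> only.\<close>

definition ev :: "(expo \<Rightarrow> complex) \<Rightarrow> (nat \<Rightarrow> complex) \<Rightarrow> complex"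
  where "ev c t = (\<Sum>v | c v \<noteq> 0. c v * Y v t)"

lemma W_support: "c \<in> W \<Longrightarrow> finite {v. c v \<noteq> 0} \<and> {v. c v \<noteq> 0} \<subseteq> expos"
proof (induction rule: fs.span_induct_alt)
  case base
  show ?case by simp
next
  case (step a b y)
  then obtain v where v: "v \<in> expos" "b = delta v" by blast
  have "{w. (cscale a b + y) w \<noteq> 0} \<subseteq> insert v {w. y w \<noteq> 0}"
    using v by (auto simp: delta_apply)
  with step v show ?case by (meson finite_insert finite_subset insert_subset order_trans)
qed

lemma ev_eq:
  assumes "finite V" "{v. c v \<noteq> 0} \<subseteq> V"
  shows "ev c t = (\<Sum>v\<in>V. c v * Y v t)"
  unfolding ev_def using assms by (intro sum.mono_neutral_left) auto

lemma ev_add: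
  assumes "c \<in> W" "d \<in> W"
  shows "ev (c + d) = ev c + ev d"
proof
  fix t
  let ?V = "{v. c v \<noteq> 0} \<union> {v. d v \<noteq> 0}"
  have fin: "finite ?V" using W_support assms by blast
  have "ev (c + d) t = (\<Sum>v\<in>?V. (c + d) v * Y v t)" by (rule ev_eq[OF fin]) auto
  also have "\<dots> = (\<Sum>v\<in>?V. c v * Y v t) + (\<Sum>v\<in>?V. d v * Y v t)"
    by (simp add: distrib_right sum.distrib)
  also have "(\<Sum>v\<in>?V. c v * Y v t) = ev c t" by (rule ev_eq[OF fin, symmetric]) auto
  also have "(\<Sum>v\<in>?V. d v * Y v t) = ev d t" by (rule ev_eq[OF fin, symmetric]) auto
  finally show "ev (c + d) t = (ev c + ev d) t" unfolding plus_fun_apply[of "ev c" "ev d" t] .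
qed

lemma ev_cscale:
  assumes "c \<in> W"
  shows "ev (cscale a c) = cscale a (ev c)"
proof
  fix t
  have "ev (cscale a c) t = (\<Sum>v | c v \<noteq> 0. cscale a c v * Y v t)"
    by (rule ev_eq) (use W_support[OF assms] in auto)
  then show "ev (cscale a c) t = cscale a (ev c) t"
    by (simp add: ev_def sum_distrib_left mult.assoc)
qed

lemma ev_zero: "ev 0 = 0"
  by (rule ext) (simp add: ev_def)

lemma ev_delta: "ev (delta v) = Y v"
proof
  fix t
  have "ev (delta v) t = (\<Sum>w\<in>{v}. delta v w * Y w t)"
    by (rule ev_eq) (auto simp: delta_apply)
  then show "ev (delta v) t = Y v t" by (simp add: delta_apply)
qed

lemma delta_W: "v \<in> expos \<Longrightarrow> delta v \<in> W"
  by (intro fs.span_base imageI)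

lemma expos_add: "v \<in> expos \<Longrightarrow> a \<in> A \<Longrightarrow> v + vec a \<in> expos"
  using supported_vec[of a] by (simp add: expos_def supported_def)

lemma lead_W: "v \<in> expos \<Longrightarrow> lead x k v \<in> W"
  unfolding lead_def by (intro fs.span_sum fs.span_scale delta_W expos_add)

lemma opr_W: "v \<in> expos \<Longrightarrow> opr x \<tau> k (delta v) \<in> W"
  unfolding opr_delta by (intro fs.span_add fs.span_scale delta_W lead_W)

lemma ev_lead:
  assumes "v \<in> expos"
  shows "ev (lead x k v) t = (\<Sum>a\<in>A. of_int (vec a k) * x a * Y (v + vec a) t)"
proof -
  have "B \<subseteq> A \<Longrightarrow> (\<Sum>a\<in>B. cscale (of_int (vec a k) * x a) (delta (v + vec a))) \<in> W \<and>
      ev (\<Sum>a\<in>B. cscale (of_int (vec a k) * x a) (delta (v + vec a))) t =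
      (\<Sum>a\<in>B. of_int (vec a k) * x a * Y (v + vec a) t)" if "finite B" for B
    using that
  proof (induction B rule: finite_induct)
    case empty
    have "ev 0 t = 0" by (simp add: ev_def)
    then show ?case unfolding sum.empty by (blast intro: fs.span_zero)
  next
    case (insert b B)
    let ?s = "\<Sum>a\<in>B. cscale (of_int (vec a k) * x a) (delta (v + vec a))"
    have b: "delta (v + vec b) \<in> W" using insert.prems assms by (intro delta_W expos_add) auto
    have s: "?s \<in> W" "ev ?s t = (\<Sum>a\<in>B. of_int (vec a k) * x a * Y (v + vec a) t)"
      using insert by blast+
    have "cscale (of_int (vec b k) * x b) (delta (v + vec b)) + ?s \<in> W"
      using b s by (intro fs.span_add fs.span_scale)
    moreover have "ev (cscale (of_int (vec b k) * x b) (delta (v + vec b)) + ?s) t =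
        of_int (vec b k) * x b * Y (v + vec b) t + (\<Sum>a\<in>B. of_int (vec a k) * x a * Y (v + vec a) t)"
      by (simp only: ev_add[OF fs.span_scale[OF b] s(1)] ev_cscale[OF b] ev_delta plus_fun_apply cscale_apply s(2))
    ultimately show ?case
      unfolding sum.insert[OF insert.hyps] by blast
  qed
  from this[OF finite_A] show ?thesis by (simp only: lead_def order_refl)
qed

lemma ev_opr:
  assumes "v \<in> expos"
  shows "ev (opr x \<tau> k (delta v)) t = (of_int (v k) - \<tau> k) * Y v t +
    (\<Sum>a\<in>A. of_int (vec a k) * x a * Y (v + vec a) t)"
  by (simp only: opr_delta ev_add[OF fs.span_scale[OF delta_W[OF assms]] lead_W[OF assms]]
      ev_cscale[OF delta_W[OF assms]] ev_delta ev_lead[OF assms] plus_fun_apply cscale_apply)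

lemma ev_opr_Inl: "v \<in> expos \<Longrightarrow> i \<le> p \<Longrightarrow> ev (opr x \<tau> (Inl i) (delta v)) = 0"
  by (rule ext) (simp only: ev_opr row_relation zero_fun_apply)

lemma ev_opr_Inr:
  "v \<in> expos \<Longrightarrow> 1 \<le> j \<Longrightarrow> j \<le> q \<Longrightarrow> ev (opr x \<tau> (Inr j) (delta v)) = nab j (Y (v + unit (Inr j)))"
  by (rule ext) (simp only: ev_opr nab_Y)

lemma ev_E: "c \<in> W \<Longrightarrow> ev c \<in> E"
proof -
  assume "c \<in> W"
  then have "c \<in> W \<and> ev c \<in> E"
  proof (induction rule: fs.span_induct_alt)
    case base
    show ?case unfolding ev_zero by (intro conjI fs.span_zero)
  next
    case (step a b y)
    then obtain v where v: "v \<in> expos" "b = delta v" by blast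
    have b: "b \<in> W" unfolding v(2) by (rule delta_W[OF v(1)])
    have "ev (cscale a b + y) = cscale a (Y v) + ev y"
      using step b by (simp only: ev_add fs.span_scale ev_cscale v(2) ev_delta)
    moreover have "Y v \<in> E" using v by (intro fs.span_base imageI)
    ultimately show ?case
      using step b by (simp only: fs.span_add fs.span_scale simp_thms)
  qed
  then show ?thesis ..
qed

lemma E_ev: "g \<in> E \<Longrightarrow> \<exists>c\<in>W. g = ev c"
proof (induction rule: fs.span_induct_alt)
  case base
  show ?case by (intro bexI[where x = 0] ev_zero[symmetric] fs.span_zero)
next
  case (step a b y)
  then obtain v c where v: "v \<in> expos" "b = Y v" and c: "c \<in> W" "y = ev c" by blast
  have "cscale a b + y = ev (cscale a (delta v) + c)"
    by (simp only: ev_add[OF fs.span_scale[OF delta_W[OF v(1)]] c(1)] ev_cscale[OF delta_W[OF v(1)]] ev_delta v(2) c(2))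
  moreover have "cscale a (delta v) + c \<in> W"
    by (intro fs.span_add fs.span_scale delta_W v c)
  ultimately show ?case by blast
qed

lemma E_differentiable:
  assumes "t \<in> U" "1 \<le> j" "j \<le> q" "g \<in> E"
  shows "(\<lambda>w. g (t(j := w))) field_differentiable at (t j)"
  using assms(4)
proof (induction rule: fs.span_induct_alt)
  case base
  show ?case by (simp only: zero_fun_apply field_differentiable_const)
next
  case (step a b y)
  then obtain v where v: "b = Y v" by blast
  have "(\<lambda>w. b (t(j := w))) field_differentiable at (t j)"
    unfolding v using Y_has_derivative[OF assms(1-3)] field_differentiable_def by blast
  with step have "(\<lambda>w. a * b (t(j := w)) + y (t(j := w))) field_differentiable at (t j)"
    by (intro field_differentiable_add field_differentiable_mult field_differentiable_const)
  then show ?case by (simp only: plus_fun_apply cscale_apply)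
qed

lemma nab_add:
  assumes "1 \<le> j" "j \<le> q" "g \<in> E" "h \<in> E"
  shows "nab j (g + h) = nab j g + nab j h"
proof
  fix t
  show "nab j (g + h) t = (nab j g + nab j h) t"
  proof (cases "t \<in> U")
    case True
    have "deriv (\<lambda>w. g (t(j := w)) + h (t(j := w))) (t j) = deriv (\<lambda>w. g (t(j := w))) (t j) + deriv (\<lambda>w. h (t(j := w))) (t j)"
      by (intro deriv_add E_differentiable True assms)
    then show ?thesis using True by (simp only: nab_def plus_fun_apply if_True) (simp add: algebra_simps)
  qed (simp add: nab_def)
qed

lemma nab_cscale:
  assumes "1 \<le> j" "j \<le> q" "g \<in> E"
  shows "nab j (cscale a g) = cscale a (nab j g)"
proof
  fix t
  show "nab j (cscale a g) t = cscale a (nab j g) t"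
  proof (cases "t \<in> U")
    case True
    have "deriv (\<lambda>w. a * g (t(j := w))) (t j) = a * deriv (\<lambda>w. g (t(j := w))) (t j)"
      by (intro deriv_cmult E_differentiable True assms)
    then show ?thesis using True by (simp only: nab_def cscale_apply if_True) (simp add: algebra_simps)
  qed (simp add: nab_def)
qed

lemma nab_zero: "nab j 0 = 0"
  by (rule ext) (simp add: nab_def)

lemma R_W: "c \<in> R \<Longrightarrow> c \<in> W"
  by (erule span_in_span) (use opr_W in \<open>auto simp: rels_def\<close>)

text \<open>Row relations evaluate to 0 and column relations to some \<open>nab j\<close>.
  Membership in \<open>R\<close> is carried through the induction because \<open>ev\<close> is
  additive on \<open>W\<close> only.\<close>

lemma ev_R_exact:
  "c \<in> R \<Longrightarrow> c \<in> R \<and> (\<exists>G. (\<forall>j. G j \<in> E) \<and> ev c = (\<Sum>j=1..q. nab j (G j)))"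
proof (induction rule: fs.span_induct_alt)
  case base
  show ?case
    by (intro exI[of _ "\<lambda>_. 0"] conjI allI fs.span_zero) (simp only: nab_zero ev_zero sum.neutral_const)
next
  case (step a b y)
  have R: "cscale a b + y \<in> R"
    by (rule fs.span_add[OF fs.span_scale[OF fs.span_base[OF step.hyps]] conjunct1[OF step.IH]])
  obtain k v where kv: "b = opr x \<tau> k (delta v)" "k \<in> Idx" "v \<in> expos"
    using step.hyps by (auto simp: rels_def)
  obtain G where G: "\<And>j. G j \<in> E" "ev y = (\<Sum>j=1..q. nab j (G j))" using step.IH by blast
  have W: "b \<in> W" "y \<in> W" unfolding kv(1) using opr_W[OF kv(3)] R_W[OF conjunct1[OF step.IH]] by blast+
  have ev: "ev (cscale a b + y) = cscale a (ev b) + ev y"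
    by (simp only: ev_add[OF fs.span_scale[OF W(1)] W(2)] ev_cscale[OF W(1)])
  from kv(2) consider i where "k = Inl i" "i \<le> p" | j where "k = Inr j" "1 \<le> j" "j \<le> q"
    by (auto simp: Idx_def)
  then show ?case
  proof cases
    case (1 i)
    have evb: "ev b = 0" unfolding kv(1) 1(1) by (rule ev_opr_Inl[OF kv(3) 1(2)])
    have "ev (cscale a b + y) = ev y"
      by (simp only: ev evb fs.scale_zero_right add_0)
    with G R show ?thesis by metis
  next
    case (2 j)
    let ?Y = "Y (v + unit (Inr j))"
    have evb: "ev b = nab j ?Y" unfolding kv(1) 2(1) by (rule ev_opr_Inr[OF kv(3) 2(2,3)])
    have "v + unit (Inr j) \<in> expos"
      using kv(2,3) 2 by (auto simp: expos_def supported_def unit_def)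
    then have Y: "?Y \<in> E" by (intro fs.span_base imageI)
    define G' where "G' l = (if l = j then cscale a ?Y + G l else G l)" for l
    have "(\<Sum>l=1..q. nab l (G' l)) = (\<Sum>l=1..q. (if l = j then cscale a (nab j ?Y) else 0) + nab l (G l))"
    proof (rule sum.cong[OF refl])
      fix l assume "l \<in> {1..q}"
      show "nab l (G' l) = (if l = j then cscale a (nab j ?Y) else 0) + nab l (G l)"
      proof (cases "l = j")
        case True
        have "nab j (cscale a ?Y + G j) = cscale a (nab j ?Y) + nab j (G j)"
          by (simp only: nab_add[OF 2(2,3) fs.span_scale[OF Y] G(1)] nab_cscale[OF 2(2,3) Y])
        then show ?thesis by (simp only: True G'_def if_True refl)
      qed (simp only: G'_def if_False add_0)
    qed
    also have "\<dots> = cscale a (nab j ?Y) + (\<Sum>l=1..q. nab l (G l))"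
      using 2 by (subst sum.distrib, subst sum.delta) auto
    also have "\<dots> = ev (cscale a b + y)"
      by (simp only: ev evb G(2))
    finally have "ev (cscale a b + y) = (\<Sum>l=1..q. nab l (G' l))" ..
    moreover have "G' l \<in> E" for l
      unfolding G'_def using G(1) Y by (auto intro: fs.span_add fs.span_scale)
    ultimately show ?thesis using R by blast
  qed
qed

text \<open>Every exponent may be lowered by a unit in direction j, so each \<open>Y v\<close> has
  the form t_j times another such function, to which the column relation applies.\<close>

lemma nab_ev_R:
  assumes "1 \<le> j" "j \<le> q"
  shows "g \<in> E \<Longrightarrow> g \<in> E \<and> (\<exists>c\<in>R. nab j g = ev c)"
proof (induction rule: fs.span_induct_alt)
  case base
  show ?case unfolding nab_zero by (intro conjI fs.span_zero bexI[where x = 0] ev_zero[symmetric] fs.span_zero)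
next
  case (step a b y)
  then obtain v c where v: "v \<in> expos" "b = Y v" and c: "y \<in> E" "c \<in> R" "nab j y = ev c" by blast
  let ?v = "v - unit (Inr j)"
  have ex: "?v \<in> expos"
    using v(1) assms by (auto simp: expos_def supported_def unit_def Idx_def)
  let ?d = "opr x \<tau> (Inr j) (delta ?v)"
  have "ev ?d = nab j (Y (?v + unit (Inr j)))"
    by (rule ev_opr_Inr[OF ex assms])
  then have ev_d: "ev ?d = nab j b" by (simp only: diff_add_cancel v(2))
  have b: "b \<in> E" unfolding v(2) using v(1) by (intro fs.span_base imageI)
  have "Inr j \<in> Idx" using assms by (simp add: Idx_def)
  then have d: "?d \<in> R" using ex unfolding rels_def by (intro fs.span_base) blast
  have "nab j (cscale a b + y) = cscale a (nab j b) + nab j y"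
    by (simp only: nab_add[OF assms fs.span_scale[OF b] c(1)] nab_cscale[OF assms b])
  also have "\<dots> = ev (cscale a ?d + c)"
    by (simp only: ev_add[OF fs.span_scale[OF R_W[OF d]] R_W[OF c(2)]] ev_cscale[OF R_W[OF d]] ev_d c(3))
  finally show ?case using b c d by (blast intro: fs.span_add fs.span_scale)
qed

lemma sum_nab_ev_R:
  assumes "\<And>j. j \<in> {1..q} \<Longrightarrow> G j \<in> E"
  shows "\<exists>c\<in>R. (\<Sum>j=1..q. nab j (G j)) = ev c"
proof -
  have "finite J \<Longrightarrow> J \<subseteq> {1..q} \<Longrightarrow> \<exists>c\<in>R. (\<Sum>j\<in>J. nab j (G j)) = ev c" for J
  proof (induction J rule: finite_induct)
    case empty
    show ?case unfolding sum.empty by (intro bexI[where x = 0] ev_zero[symmetric] fs.span_zero)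
  next
    case (insert j J)
    then obtain c where c: "c \<in> R" "(\<Sum>j\<in>J. nab j (G j)) = ev c" by blast
    obtain d where d: "d \<in> R" "nab j (G j) = ev d"
      using nab_ev_R[of j "G j"] insert.prems assms[of j] by auto
    have "(\<Sum>j\<in>insert j J. nab j (G j)) = ev (d + c)"
      by (simp only: sum.insert[OF insert.hyps] ev_add[OF R_W[OF d(1)] R_W[OF c(1)]] c(2) d(2))
    moreover have "d + c \<in> R" by (rule fs.span_add[OF d(1) c(1)])
    ultimately show ?case by blast
  qed
  then show ?thesis by blast
qed

section \<open>Reduction to a common denominator\<close>

definition row_rels :: "(expo \<Rightarrow> complex) set"
  where "row_rels = {opr x \<tau> (Inl i) (delta v) | i v. i \<le> p \<and> v \<in> expos}"

text \<open>Functions of one level share the denominator, so that only the Laurent monomials in t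
  differ.\<close>

definition level :: "int \<Rightarrow> expo set"
  where "level n = {v \<in> expos. \<forall>i\<le>p. v (Inl i) = n}"

lemma row_rels_subset: "row_rels \<subseteq> rels x \<tau> expos"
proof -
  have "Inl i \<in> Idx" if "i \<le> p" for i using that by (simp add: Idx_def)
  then show ?thesis unfolding row_rels_def rels_def by blast
qed

lemma ev_row_rels: "c \<in> fs.span row_rels \<Longrightarrow> c \<in> W \<and> ev c = 0"
proof (induction rule: fs.span_induct_alt)
  case base
  show ?case by (intro conjI fs.span_zero ev_zero)
next
  case (step a b y)
  then have b: "b \<in> W" "ev b = 0" using opr_W ev_opr_Inl unfolding row_rels_def by blast+
  have y: "y \<in> W" "ev y = 0" using step by blast+
  have "ev (cscale a b + y) = 0"
    by (simp only: ev_add[OF fs.span_scale[OF b(1)] y(1)] ev_cscale[OF b(1)] b(2) y(2) fs.scale_zero_right add_0)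
  then show ?case using b y by (blast intro: fs.span_add fs.span_scale)
qed

text \<open>Expanding the numerator \<open>F i\<close> of \<open>F i\<close> / \<open>F i\<close>
  raises the power in the denominator. The row relation does this after division by
  \<open>v - \<tau>\<close>, which is nonzero because \<tau> is not an integer on rows.\<close>

lemma delta_level:
  "v \<in> expos \<Longrightarrow> (\<And>i. i \<le> p \<Longrightarrow> v (Inl i) \<le> n) \<Longrightarrow> delta v \<in> fs.span (delta ` level n \<union> row_rels)"
proof (induction "\<Sum>i=0..p. nat (n - v (Inl i))" arbitrary: v rule: less_induct)
  case less
  let ?X = "fs.span (delta ` level n \<union> row_rels)"
  show ?case
  proof (cases "v \<in> level n")
    case True
    then show ?thesis by (intro fs.span_base) blast
  next
    case False
    then obtain i where i: "i \<le> p" "v (Inl i) < n"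
      using less.prems unfolding level_def by fastforce
    let ?z = "of_int (v (Inl i)) - \<tau> (Inl i)"
    have "?z \<noteq> 0" using \<tau>_Inl[OF i(1)] by (metis Ints_of_int eq_iff_diff_eq_0)
    have "lead x (Inl i) v \<in> ?X"
      unfolding lead_def
    proof (intro fs.span_sum)
      fix a assume a: "a \<in> A"
      show "cscale (of_int (vec a (Inl i)) * x a) (delta (v + vec a)) \<in> ?X"
      proof (cases "fst a = i")
        case True
        have "(\<Sum>l=0..p. nat (n - (v + vec a) (Inl l))) < (\<Sum>l=0..p. nat (n - v (Inl l)))"
          using i True by (intro sum_strict_mono_ex1) (auto intro!: bexI[of _ i])
        moreover have "(v + vec a) (Inl l) \<le> n" if "l \<le> p" for l
          using less.prems(2)[OF that] i True by auto
        ultimately show ?thesis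
          by (intro fs.span_scale less.hyps expos_add less.prems(1) a)
      next
        case False
        then have "cscale (of_int (vec a (Inl i)) * x a) (delta (v + vec a)) = 0"
          by (intro ext) simp
        then show ?thesis by (simp only: fs.span_zero)
      qed
    qed
    moreover have "opr x \<tau> (Inl i) (delta v) \<in> ?X"
      using less.prems(1) i by (intro fs.span_base) (auto simp: row_rels_def)
    ultimately have "cscale ?z (delta v) \<in> ?X"
      unfolding opr_delta using fs.span_add_eq2 by blast
    then have "cscale (1 / ?z) (cscale ?z (delta v)) \<in> ?X" by (rule fs.span_scale)
    then show ?thesis using \<open>?z \<noteq> 0\<close> by (simp only: fs.scale_scale) simp
  qed
qed

lemma W_level:
  assumes "c \<in> W"
  shows "\<exists>n. c \<in> fs.span (delta ` level n \<union> row_rels)"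
proof -
  have fin: "finite {v. c v \<noteq> 0}" and ex: "{v. c v \<noteq> 0} \<subseteq> expos" using W_support[OF assms] by auto
  define n where "n = Max ((\<lambda>(v, i). v (Inl i)) ` ({v. c v \<noteq> 0} \<times> {..p}))"
  have le: "v (Inl i) \<le> n" if "c v \<noteq> 0" "i \<le> p" for v i
    unfolding n_def using fin that by (intro Max_ge) (auto intro!: rev_image_eqI[of "(v, i)"])
  have "c = (\<Sum>v | c v \<noteq> 0. cscale (c v) (delta v))"
  proof
    fix w
    show "c w = (\<Sum>v | c v \<noteq> 0. cscale (c v) (delta v)) w"
    proof (cases "c w = 0")
      case True
      have "(\<Sum>v | c v \<noteq> 0. cscale (c v) (delta v)) w = 0"
        unfolding sum_fun_apply by (rule sum.neutral) (use True in \<open>auto simp: delta_apply\<close>)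
      then show ?thesis using True by simp
    next
      case False
      show ?thesis
      proof -
        have z: "(\<Sum>v\<in>{v. c v \<noteq> 0} - {w}. c v * delta v w) = 0"
          by (rule sum.neutral) (auto simp: delta_apply)
        have "(\<Sum>v | c v \<noteq> 0. cscale (c v) (delta v)) w = (\<Sum>v | c v \<noteq> 0. c v * delta v w)"
          by (simp only: sum_fun_apply cscale_apply)
        also have "\<dots> = c w * delta w w"
          using False by (subst sum.remove[OF fin, of w]) (simp_all only: z mem_Collect_eq not_False_eq_True add_0_right)
        finally show ?thesis by (simp add: delta_apply)
      qed
    qed
  qed
  also have "\<dots> \<in> fs.span (delta ` level n \<union> row_rels)"
    using ex le by (intro fs.span_sum fs.span_scale delta_level) auto
  finally show ?thesis by blast
qed

end

section \<open>Kronecker substitution and the kernel of evaluation\<close>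

lemma digits_bound:
  fixes a :: "nat \<Rightarrow> int"
  assumes "\<And>j. j \<in> {1..n} \<Longrightarrow> \<bar>a j\<bar> < M" "0 < M"
  shows "\<bar>\<Sum>j=1..n. a j * M ^ j\<bar> < M ^ Suc n"
  using assms(1)
proof (induction n)
  case (Suc n)
  have "\<bar>\<Sum>j=1..Suc n. a j * M ^ j\<bar> \<le> \<bar>\<Sum>j=1..n. a j * M ^ j\<bar> + \<bar>a (Suc n)\<bar> * M ^ Suc n"
    using abs_triangle_ineq[of "\<Sum>j=1..n. a j * M ^ j" "a (Suc n) * M ^ Suc n"] assms(2)
    by (simp add: abs_mult)
  also have "\<dots> < M ^ Suc n + (M - 1) * M ^ Suc n"
    using Suc.IH Suc.prems assms(2) by (intro add_less_le_mono mult_right_mono) auto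
  also have "\<dots> = M ^ Suc (Suc n)" by (simp add: algebra_simps)
  finally show ?case .
qed (use assms(2) in simp)

text \<open>Uniqueness of signed digits in base \<open>M\<close>: a nonzero top digit contributes at
  least \<open>M ^ n\<close> in absolute value, more than the lower ones can cancel.\<close>

lemma digits_zero:
  fixes a :: "nat \<Rightarrow> int"
  assumes "\<And>j. j \<in> {1..n} \<Longrightarrow> \<bar>a j\<bar> < M" "0 < M" "(\<Sum>j=1..n. a j * M ^ j) = 0"
  shows "\<forall>j\<in>{1..n}. a j = 0"
  using assms(1,3)
proof (induction n)
  case (Suc n)
  have bound: "\<bar>\<Sum>j=1..n. a j * M ^ j\<bar> < M ^ Suc n"
    using Suc.prems assms(2) by (intro digits_bound) auto
  have eq: "(\<Sum>j=1..n. a j * M ^ j) = - (a (Suc n) * M ^ Suc n)"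
    using Suc.prems(2) by simp
  have "a (Suc n) = 0"
  proof (rule ccontr)
    assume "a (Suc n) \<noteq> 0"
    then have "1 * M ^ Suc n \<le> \<bar>a (Suc n)\<bar> * M ^ Suc n"
      using assms(2) by (intro mult_right_mono) auto
    then show False using bound unfolding eq using assms(2) by (simp add: abs_mult)
  qed
  moreover have "\<forall>j\<in>{1..n}. a j = 0"
    using Suc.prems \<open>a (Suc n) = 0\<close> by (intro Suc.IH) auto
  ultimately show ?case by (auto simp: le_Suc_eq)
qed simp

context arrangement
begin

text \<open>Kronecker substitution: for large \<open>M\<close> it separates finitely many given Laurent monomials.\<close>

definition curve :: "nat \<Rightarrow> complex \<Rightarrow> nat \<Rightarrow> complex"
  where "curve M z = (\<lambda>j\<in>{1..q}. z ^ M ^ j)"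

text \<open>On the curve \<open>F i\<close> is a polynomial in z whose terms have distinct
  exponents, so its nonzero coefficients survive and it has finitely many roots.\<close>

lemma curve_in_U:
  assumes "2 \<le> M"
  shows "finite {z. z \<noteq> 0 \<and> curve M z \<notin> U}"
proof -
  define P where "P i = (\<Sum>j\<in>row_cols i. monom (x (i, j)) (if j = 0 then 0 else M ^ j))" for i
  have poly_P: "poly (P i) z = F i (curve M z)" for i z
    using A_bounds by (auto simp: P_def F_def poly_sum poly_monom tt_def curve_def row_cols_def intro!: sum.cong)
  have inj: "(if j = 0 then 0 else M ^ j) = (if l = 0 then 0 else M ^ l) \<longleftrightarrow> j = l" for j l :: nat
    using assms by (auto simp: power_inject_exp)
  have "P i \<noteq> 0" if "i \<le> p" for i
  proof -
    let ?j = "j_sharp A i"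
    have j: "?j \<in> row_cols i" using j_sharp_in[OF that] by (simp add: row_cols_def)
    have "coeff (P i) (if ?j = 0 then 0 else M ^ ?j) = (\<Sum>j\<in>row_cols i. if j = ?j then x (i, j) else 0)"
      unfolding P_def coeff_sum coeff_monom inj by (rule refl)
    also have "\<dots> = x (i, ?j)" using j finite_row_cols by simp
    also have "\<dots> \<noteq> 0" using x_nonzero j_sharp_in[OF that] by simp
    finally show ?thesis by auto
  qed
  then have "finite (\<Union>i\<in>{..p}. {z. poly (P i) z = 0})"
    by (intro finite_UN_I poly_roots_finite) auto
  moreover have "{z. z \<noteq> 0 \<and> curve M z \<notin> U} \<subseteq> (\<Union>i\<in>{..p}. {z. poly (P i) z = 0})"
    unfolding poly_P by (auto simp: U_iff curve_def)
  ultimately show ?thesis by (rule finite_subset[rotated])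
qed

text \<open>On the curve distinct monomials become distinct powers of z, and a polynomial vanishing
  at all but finitely many points is 0.\<close>

lemma laurent_independent:
  fixes V :: "expo set"
  assumes "finite V" and inj: "\<And>v w. v \<in> V \<Longrightarrow> w \<in> V \<Longrightarrow> (\<forall>j\<in>{1..q}. v (Inr j) = w (Inr j)) \<Longrightarrow> v = w"
    and zero: "\<And>t. t \<in> U \<Longrightarrow> (\<Sum>v\<in>V. e v * (\<Prod>j=1..q. t j powi v (Inr j))) = 0"
    and "v0 \<in> V"
  shows "e v0 = 0"
proof -
  define B where "B = (\<Sum>v\<in>V. \<Sum>j=1..q. nat \<bar>v (Inr j)\<bar>)"
  have B: "\<bar>v (Inr j)\<bar> \<le> int B" if "v \<in> V" "j \<in> {1..q}" for v j
  proof -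
    have "nat \<bar>v (Inr j)\<bar> \<le> (\<Sum>j=1..q. nat \<bar>v (Inr j)\<bar>)" using that by (intro member_le_sum) auto
    also have "\<dots> \<le> B" unfolding B_def using that assms(1) by (intro member_le_sum) auto
    finally show ?thesis by simp
  qed
  \<comment> \<open>Differences of two exponents are at most 2 B, hence valid digits in base
    \<open>M\<close>; moreover \<open>M\<close> is at least 2, as the curve requires.\<close>
  define M where "M = 2 * B + 2"
  define s where "s v = (\<Sum>j=1..q. v (Inr j) * int M ^ j)" for v :: expo
  have s_inj: "v = w" if "v \<in> V" "w \<in> V" "s v = s w" for v w
  proof (rule inj[OF that(1,2)])
    have "\<forall>j\<in>{1..q}. v (Inr j) - w (Inr j) = 0"
    proof (rule digits_zero)
      show "\<bar>v (Inr j) - w (Inr j)\<bar> < int M" if "j \<in> {1..q}" for j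
        using B[OF \<open>v \<in> V\<close> that] B[OF \<open>w \<in> V\<close> that] by (simp add: M_def)
      show "(\<Sum>j=1..q. (v (Inr j) - w (Inr j)) * int M ^ j) = 0"
        using that(3) by (simp add: s_def left_diff_distrib sum_subtractf)
    qed (simp add: M_def)
    then show "\<forall>j\<in>{1..q}. v (Inr j) = w (Inr j)" by simp
  qed
  \<comment> \<open>Multiplication by \<open>z ^ K\<close> clears the negative powers.\<close>
  define K where "K = (\<Sum>v\<in>V. nat \<bar>s v\<bar>)"
  have K: "0 \<le> s v + int K" if "v \<in> V" for v
  proof -
    have "nat \<bar>s v\<bar> \<le> K" unfolding K_def using that assms(1) by (intro member_le_sum) auto
    then show ?thesis by linarith
  qed
  define P where "P = (\<Sum>v\<in>V. monom (e v) (nat (s v + int K)))"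
  have "poly P z = 0" if "z \<noteq> 0" "curve M z \<in> U" for z
  proof -
    have "z ^ nat (s v + int K) = z ^ K * (\<Prod>j=1..q. curve M z j powi v (Inr j))" if "v \<in> V" for v
    proof -
      have "z ^ nat (s v + int K) = z powi (s v + int K)"
        using K[OF that] by (simp add: power_int_def)
      also have "\<dots> = z ^ K * z powi s v"
        using \<open>z \<noteq> 0\<close> by (simp add: power_int_add)
      also have "z powi s v = (\<Prod>j=1..q. z powi (v (Inr j) * int M ^ j))"
        unfolding s_def using \<open>z \<noteq> 0\<close> by (induction q) (simp_all add: power_int_add)
      also have "\<dots> = (\<Prod>j=1..q. curve M z j powi v (Inr j))"
      proof (rule prod.cong[OF refl])
        fix j assume "j \<in> {1..q}"
        have "z powi (v (Inr j) * int (M ^ j)) = (z ^ M ^ j) powi v (Inr j)"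
          by (simp only: mult.commute[of "v (Inr j)"] power_int_mult power_int_of_nat)
        then show "z powi (v (Inr j) * int M ^ j) = curve M z j powi v (Inr j)"
          using \<open>j \<in> {1..q}\<close> by (simp add: curve_def)
      qed
      finally show ?thesis .
    qed
    then have "poly P z = z ^ K * (\<Sum>v\<in>V. e v * (\<Prod>j=1..q. curve M z j powi v (Inr j)))"
      by (simp add: P_def poly_sum poly_monom sum_distrib_left mult.left_commute)
    then show ?thesis using zero[OF that(2)] by simp
  qed
  then have "- ({0} \<union> {z. z \<noteq> 0 \<and> curve M z \<notin> U}) \<subseteq> {z. poly P z = 0}" by blast
  moreover have "infinite (- ({0} \<union> {z. z \<noteq> 0 \<and> curve M z \<notin> U}))"
    using curve_in_U[of M] infinite_UNIV_char_0 by (subst finite_compl) (auto simp: M_def Compl_eq_Diff_UNIV)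
  ultimately have "P = 0" using poly_roots_finite finite_subset by blast
  then have "0 = coeff P (nat (s v0 + int K))" by simp
  also have "\<dots> = (\<Sum>v\<in>V. if v = v0 then e v else 0)"
    unfolding P_def coeff_sum coeff_monom
  proof (rule sum.cong[OF refl])
    fix v assume v: "v \<in> V"
    have "nat (s v + int K) = nat (s v0 + int K) \<longleftrightarrow> v = v0"
      using s_inj[OF v assms(4)] K[OF v] K[OF assms(4)] by (auto simp: nat_eq_iff)
    then show "(if nat (s v + int K) = nat (s v0 + int K) then e v else 0) = (if v = v0 then e v else 0)" by simp
  qed
  also have "\<dots> = e v0" using assms(1,4) by simp
  finally show ?thesis by simp
qed

text \<open>Row relations bring everything to a common denominator, and what remains is a Laurent
  polynomial in t that vanishes on \<open>U\<close>. Hence all linear relations between the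
  functions \<open>Y v\<close> come from rows.\<close>

lemma ev_kernel:
  assumes "c \<in> W" "ev c = 0"
  shows "c \<in> R"
proof -
  obtain n where "c \<in> fs.span (delta ` level n \<union> row_rels)" using W_level[OF assms(1)] by blast
  then obtain d r where dr: "c = d + r" "d \<in> fs.span (delta ` level n)" "r \<in> fs.span row_rels"
    unfolding fs.span_Un by blast
  have dW: "d \<in> W" using dr(2) fs.span_mono[of "delta ` level n" "delta ` expos"] by (auto simp: level_def)
  have r: "r \<in> W" "ev r = 0" using ev_row_rels[OF dr(3)] by blast+
  have "ev d = 0"
    using assms(2) unfolding dr(1) ev_add[OF dW r(1)] r(2) by (simp only: add_0_right)
  have supp: "{v. d v \<noteq> 0} \<subseteq> level n"
    using dr(2)
  proof (induction rule: fs.span_induct_alt)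
    case base
    show ?case by simp
  next
    case (step a b y)
    then obtain v where v: "v \<in> level n" "b = delta v" by blast
    show ?case
    proof
      fix w assume "w \<in> {w. (cscale a b + y) w \<noteq> 0}"
      then show "w \<in> level n"
        using step.IH v by (cases "w = v") (auto simp: delta_apply)
    qed
  qed
  have fin: "finite {v. d v \<noteq> 0}" using W_support[OF dW] by blast
  have "d v = 0" for v
  proof (rule ccontr)
    assume v: "d v \<noteq> 0"
    have "d v * kappa v = 0"
    proof (rule laurent_independent[OF fin, of "\<lambda>v. d v * kappa v"])
      show "v \<in> {v. d v \<noteq> 0}" using v by simp
      show "v = w" if "v \<in> {v. d v \<noteq> 0}" "w \<in> {v. d v \<noteq> 0}" "\<forall>j\<in>{1..q}. v (Inr j) = w (Inr j)" for v w
      proof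
        fix k
        have vw: "v \<in> level n" "w \<in> level n" using that(1,2) supp by auto
        then have "v k = 0 \<and> w k = 0" if "k \<notin> Idx" using that by (auto simp: level_def expos_def supported_def)
        moreover have "v k = w k" if "k \<in> Idx"
          using that vw \<open>\<forall>j\<in>{1..q}. v (Inr j) = w (Inr j)\<close> by (auto simp: Idx_def level_def)
        ultimately show "v k = w k" by (cases "k \<in> Idx") auto
      qed
      fix t assume t: "t \<in> U"
      have "0 = ev d t" using \<open>ev d = 0\<close> by (simp only: zero_fun_apply)
      also have "\<dots> = (\<Sum>v | d v \<noteq> 0. d v * kappa v * (\<Prod>j=1..q. t j powi v (Inr j)) * (\<Prod>i=0..p. F i t powi (- n)))"
        unfolding ev_def
      proof (rule sum.cong[OF refl])
        fix v assume "v \<in> {v. d v \<noteq> 0}"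
        then have "v \<in> level n" using supp by blast
        then have "(\<Prod>i=0..p. F i t powi (- v (Inl i))) = (\<Prod>i=0..p. F i t powi (- n))"
          by (intro prod.cong) (auto simp: level_def)
        then show "d v * Y v t = d v * kappa v * (\<Prod>j=1..q. t j powi v (Inr j)) * (\<Prod>i=0..p. F i t powi (- n))"
          using t by (simp add: Y_def mon_def)
      qed
      also have "\<dots> = (\<Sum>v | d v \<noteq> 0. d v * kappa v * (\<Prod>j=1..q. t j powi v (Inr j))) * (\<Prod>i=0..p. F i t powi (- n))"
        by (rule sum_distrib_right[symmetric])
      finally show "(\<Sum>v | d v \<noteq> 0. d v * kappa v * (\<Prod>j=1..q. t j powi v (Inr j))) = 0"
        using U_D(2)[OF t] by (auto simp: power_int_eq_0_iff)
    qed
    then show False using v kappa_nonzero[of v] by simp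
  qed
  then have "d = 0" by (intro ext) (simp only: zero_fun_apply)
  then have "c = r" using dr(1) by (simp only: add_0)
  then show ?thesis using dr(3) fs.span_mono[OF row_rels_subset] by blast
qed

lemma ev_diff:
  assumes "c \<in> W" "d \<in> W"
  shows "ev (c - d) = ev c - ev d"
  using ev_add[OF fs.span_diff[OF assms] assms(2)] by (simp only: diff_add_cancel add_diff_cancel_right')

lemma exact_iff_R:
  assumes "c \<in> W"
  shows "(\<exists>G. (\<forall>j. G j \<in> E) \<and> ev c = (\<Sum>j=1..q. nab j (G j))) \<longleftrightarrow> c \<in> R"
proof
  assume "\<exists>G. (\<forall>j. G j \<in> E) \<and> ev c = (\<Sum>j=1..q. nab j (G j))"
  then obtain G where G: "\<And>j. G j \<in> E" "ev c = (\<Sum>j=1..q. nab j (G j))" by blast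
  obtain d where d: "d \<in> R" "(\<Sum>j=1..q. nab j (G j)) = ev d" using sum_nab_ev_R[of G] G(1) by blast
  have "ev (c - d) = 0"
    by (simp only: ev_diff[OF assms R_W[OF d(1)]] G(2) d(2) diff_self)
  then have "c - d \<in> R"
    by (intro ev_kernel fs.span_diff[OF assms R_W[OF d(1)]])
  then have "(c - d) + d \<in> R" using d(1) by (rule fs.span_add)
  then show "c \<in> R" by (simp only: diff_add_cancel)
qed (use ev_R_exact in blast)

end


section \<open>Twisted cohomology\<close>


lemma poly_fun_sum: "finite I \<Longrightarrow> (\<And>i. i \<in> I \<Longrightarrow> poly_fun m (f i)) \<Longrightarrow> poly_fun m (\<lambda>t. \<Sum>i\<in>I. f i t)"
  by (induction I rule: finite_induct) (auto intro: poly_fun.intros)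

lemma poly_fun_prod: "finite I \<Longrightarrow> (\<And>i. i \<in> I \<Longrightarrow> poly_fun m (f i)) \<Longrightarrow> poly_fun m (\<lambda>t. \<Prod>i\<in>I. f i t)"
  by (induction I rule: finite_induct) (auto intro: poly_fun.intros)

lemma poly_fun_power: "poly_fun m f \<Longrightarrow> poly_fun m (\<lambda>t. f t ^ n)"
  by (induction n) (auto intro: poly_fun.intros)

lemma chain_poly_update:
  assumes "finite {j. (i, j) \<in> A}"
  shows "chain_poly A (Suc i) (y(a := w)) t =
    chain_poly A (Suc i) y t + (if a \<in> A \<and> fst a = i then (if snd a = 0 then 1 else t (snd a)) * (w - y a) else 0)"
proof -
  have "chain_poly A (Suc i) (y(a := w)) t - chain_poly A (Suc i) y t =
      (\<Sum>j | (i, j) \<in> A. if (i, j) = a then (if snd a = 0 then 1 else t (snd a)) * (w - y a) else 0)"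
    unfolding chain_poly_def sum_subtractf[symmetric] diff_Suc_1
    by (intro sum.cong refl) (auto simp: algebra_simps)
  also have "\<dots> = (if a \<in> A \<and> fst a = i then (if snd a = 0 then 1 else t (snd a)) * (w - y a) else 0)"
  proof (cases "fst a = i")
    case True
    then have "(i, j) = a \<longleftrightarrow> j = snd a" for j by (cases a) auto
    then show ?thesis using assms True by (cases a) auto
  next
    case False
    then have "(i, j) \<noteq> a" for j by auto
    then show ?thesis using False by simp
  qed
  finally show ?thesis by (simp add: algebra_simps)
qed

context arrangement
begin

lemma poly_fun_tt: "j \<le> q \<Longrightarrow> poly_fun q (\<lambda>t. tt t j)"
  by (cases "j = 0") (auto simp: tt_def intro: poly_fun.intros)

lemma poly_fun_F: "poly_fun q (F i)"
proof -
  have "poly_fun q (\<lambda>t. \<Sum>j\<in>row_cols i. x (i, j) * tt t j)"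
    using A_bounds by (intro poly_fun_sum finite_row_cols poly_fun.intros poly_fun_tt) (auto simp: row_cols_def)
  then show ?thesis by (simp add: F_def[abs_def])
qed

lemma poly_fun_Qr: "poly_fun q Qr"
proof -
  have "poly_fun q (\<lambda>t. (\<Prod>j=1..q. t j) * (\<Prod>i=0..p. F i t))"
    by (intro poly_fun.intros poly_fun_prod poly_fun_F) auto
  then show ?thesis by (simp add: Qr_eq[abs_def])
qed

text \<open>Multiplication by t_j moves exponents by a unit, so \<open>E\<close> is a module over
  the polynomials.\<close>

lemma poly_fun_mult_E: "poly_fun q h \<Longrightarrow> g \<in> E \<Longrightarrow> (\<lambda>t. h t * g t) \<in> E"
proof (induction arbitrary: g rule: poly_fun.induct)
  case (poly_fun_const c)
  then have "cscale c g \<in> E" by (rule fs.span_scale)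
  then show ?case unfolding cscale_def[of c g] .
next
  case (poly_fun_coord j)
  define L :: "((nat \<Rightarrow> complex) \<Rightarrow> complex) \<Rightarrow> (nat \<Rightarrow> complex) \<Rightarrow> complex" where "L g = (\<lambda>t. t j * g t)" for g
  have "L g \<in> E"
  proof (rule span_image_linear[OF poly_fun_coord.prems])
    show "L 0 = 0" by (rule ext) (simp add: L_def)
    show "L (g + h) = L g + L h" for g h by (rule ext) (simp add: L_def distrib_left)
    show "L (cscale c g) = cscale c (L g)" for g c by (rule ext) (simp add: L_def)
    fix g assume "g \<in> Y ` expos"
    then obtain v where v: "g = Y v" "v \<in> expos" by blast
    have "L g = Y (v + unit (Inr j))"
    proof
      fix t show "L g t = Y (v + unit (Inr j)) t"
        using Y_add_unit_Inr[of t j v] poly_fun_coord.hyps by (cases "t \<in> U") (simp_all add: L_def v(1) Y_outside)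
    qed
    moreover have "v + unit (Inr j) \<in> expos"
      using v(2) poly_fun_coord.hyps by (auto simp: expos_def supported_def unit_def Idx_def)
    ultimately show "L g \<in> E" by (simp only: fs.span_base imageI)
  qed
  then show ?case by (simp only: L_def)
next
  case (poly_fun_add h k)
  have "(\<lambda>t. h t * g t) + (\<lambda>t. k t * g t) \<in> E"
    by (intro fs.span_add poly_fun_add.IH poly_fun_add.prems)
  then show ?case by (simp only: plus_fun_def distrib_right)
next
  case (poly_fun_mult h k)
  then have "(\<lambda>t. h t * (k t * g t)) \<in> E" by blast
  then show ?case by (simp only: mult.assoc)
qed

lemma rational_in_E:
  assumes "rational_fun q Qr g"
  shows "g \<in> E"
proof -
  obtain h N where h: "poly_fun q h" and g: "g = (\<lambda>t. if t \<in> U then h t / Qr t ^ N else 0)"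
    using assms by (auto simp: rational_fun_def U_def)
  \<comment> \<open>The exponent of 1 / Q'^N, so that g is a polynomial times a multiple of
    \<open>Y v\<close>.\<close>
  define v :: expo where "v k = (if k \<in> Idx then (case k of Inl _ \<Rightarrow> int N | Inr _ \<Rightarrow> - int N) else 0)" for k
  have ex: "v \<in> expos" by (simp add: expos_def supported_def v_def)
  have "mon v t = 1 / Qr t ^ N" if "t \<in> U" for t
  proof -
    have "(\<Prod>j=1..q. t j powi v (Inr j)) = (\<Prod>j=1..q. inverse (t j ^ N))"
      by (rule prod.cong) (auto simp: v_def Idx_def power_int_minus)
    moreover have "(\<Prod>i=0..p. F i t powi (- v (Inl i))) = (\<Prod>i=0..p. inverse (F i t ^ N))"
      by (rule prod.cong) (auto simp: v_def Idx_def power_int_minus)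
    ultimately show ?thesis
      by (simp add: mon_def Qr_eq prod_inversef[unfolded o_def] power_mult_distrib prod_power_distrib divide_inverse)
  qed
  then have "g = (\<lambda>t. h t * cscale (1 / kappa v) (Y v) t)"
    unfolding g by (intro ext) (simp add: Y_def kappa_nonzero)
  moreover have "cscale (1 / kappa v) (Y v) \<in> E"
    using ex by (intro fs.span_scale fs.span_base imageI)
  ultimately show ?thesis using poly_fun_mult_E[OF h] by metis
qed

lemma Y_rational: "rational_fun q Qr (Y v)"
proof -
  define N where "N = (\<Sum>i=0..p. nat \<bar>v (Inl i)\<bar>) + (\<Sum>j=1..q. nat \<bar>v (Inr j)\<bar>)"
  have N1: "\<bar>v (Inl i)\<bar> \<le> int N" if "i \<in> {0..p}" for i
  proof -
    have "nat \<bar>v (Inl i)\<bar> \<le> (\<Sum>i=0..p. nat \<bar>v (Inl i)\<bar>)" using that by (intro member_le_sum) auto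
    then show ?thesis unfolding N_def by linarith
  qed
  have N2: "\<bar>v (Inr j)\<bar> \<le> int N" if "j \<in> {1..q}" for j
  proof -
    have "nat \<bar>v (Inr j)\<bar> \<le> (\<Sum>j=1..q. nat \<bar>v (Inr j)\<bar>)" using that by (intro member_le_sum) auto
    then show ?thesis unfolding N_def by linarith
  qed
  define h where "h t = kappa v * ((\<Prod>j=1..q. t j ^ nat (v (Inr j) + int N)) * (\<Prod>i=0..p. F i t ^ nat (int N - v (Inl i))))" for t
  have "poly_fun q h"
    unfolding h_def[abs_def] by (intro poly_fun.intros poly_fun_prod poly_fun_power poly_fun_F) auto
  moreover have "Y v t = h t / Qr t ^ N" if t: "t \<in> U" for t
  proof -
    have "(\<Prod>j=1..q. t j ^ nat (v (Inr j) + int N)) = (\<Prod>j=1..q. t j powi v (Inr j) * t j ^ N)"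
    proof (rule prod.cong[OF refl])
      fix j assume j: "j \<in> {1..q}"
      have "t j ^ nat (v (Inr j) + int N) = t j powi (v (Inr j) + int N)"
        using N2[OF j] by (simp add: power_int_def)
      then show "t j ^ nat (v (Inr j) + int N) = t j powi v (Inr j) * t j ^ N"
        using U_D(1)[OF t, of j] j by (simp add: power_int_add)
    qed
    moreover have "(\<Prod>i=0..p. F i t ^ nat (int N - v (Inl i))) = (\<Prod>i=0..p. F i t powi (- v (Inl i)) * F i t ^ N)"
    proof (rule prod.cong[OF refl])
      fix i assume i: "i \<in> {0..p}"
      have "F i t ^ nat (int N - v (Inl i)) = F i t powi (- v (Inl i) + int N)"
        using N1[OF i] by (simp add: power_int_def)
      also have "\<dots> = F i t powi (- v (Inl i)) * F i t ^ N"
        using U_D(2)[OF t, of i] i by (subst power_int_add) auto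
      finally show "F i t ^ nat (int N - v (Inl i)) = F i t powi (- v (Inl i)) * F i t ^ N" .
    qed
    ultimately have "h t = kappa v * mon v t * Qr t ^ N"
      by (simp add: h_def mon_def Qr_eq prod.distrib power_mult_distrib prod_power_distrib)
    moreover have "Qr t \<noteq> 0" using t by (simp add: U_def compl_locus_def)
    ultimately show ?thesis using t by (simp add: Y_def)
  qed
  ultimately show ?thesis
    unfolding rational_fun_def U_def[symmetric]
    by (intro exI[of _ h] exI[of _ N] conjI ext) (simp_all add: Y_outside)
qed

lemma rational_add:
  assumes "rational_fun q Qr g" "rational_fun q Qr h"
  shows "rational_fun q Qr (cscale c g + h)"
proof -
  obtain a m where a: "poly_fun q a" "g = (\<lambda>t. if t \<in> U then a t / Qr t ^ m else 0)"
    using assms(1) by (auto simp: rational_fun_def U_def)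
  obtain b n where b: "poly_fun q b" "h = (\<lambda>t. if t \<in> U then b t / Qr t ^ n else 0)"
    using assms(2) by (auto simp: rational_fun_def U_def)
  have "poly_fun q (\<lambda>t. c * a t * Qr t ^ n + b t * Qr t ^ m)"
    using a b by (intro poly_fun.intros poly_fun_power poly_fun_Qr)
  moreover have "Qr t \<noteq> 0" if "t \<in> U" for t using that by (simp add: U_def compl_locus_def)
  then have "(cscale c g + h) t = (if t \<in> U then (c * a t * Qr t ^ n + b t * Qr t ^ m) / Qr t ^ (m + n) else 0)" for t
    by (simp add: a b power_add field_simps)
  ultimately show ?thesis
    unfolding rational_fun_def U_def[symmetric]
    by (intro exI[of _ "\<lambda>t. c * a t * Qr t ^ n + b t * Qr t ^ m"] exI[of _ "m + n"] conjI ext)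
qed

lemma E_rational: "g \<in> E \<Longrightarrow> rational_fun q Qr g"
proof (induction rule: fs.span_induct_alt)
  case base
  show ?case
    unfolding rational_fun_def
    by (intro exI[of _ "\<lambda>_. 0"] exI[of _ 0] conjI poly_fun.intros) (auto simp: fun_eq_iff)
next
  case (step c x y)
  then show ?case using rational_add Y_rational by blast
qed

lemma rational_iff_E: "rational_fun q Qr g \<longleftrightarrow> g \<in> E"
  using rational_in_E E_rational by blast

section \<open>Forms of top degree\<close>

definition tf :: "((nat \<Rightarrow> complex) \<Rightarrow> complex) \<Rightarrow> form"
  where "tf g = (\<lambda>K. if K = {1..q} then g else (\<lambda>t. 0))"

lemma tf_inj: "tf g = tf h \<Longrightarrow> g = h"
  unfolding tf_def by (drule fun_cong[of _ _ "{1..q}"]) simp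

lemma full_subset: "K \<subseteq> {1..q} \<and> card K = q \<longleftrightarrow> K = {1..q}"
  using card_subset_eq[of "{1..q}" K] by auto

lemma rational_forms_top: "\<omega> \<in> rational_forms q Qr q \<longleftrightarrow> (\<exists>g\<in>E. \<omega> = tf g)"
proof
  assume "\<omega> \<in> rational_forms q Qr q"
  then have *: "if K = {1..q} then rational_fun q Qr (\<omega> K) else \<omega> K = (\<lambda>t. 0)" for K
    unfolding rational_forms_def full_subset by blast
  have "\<omega> = tf (\<omega> {1..q})"
  proof
    fix K show "\<omega> K = tf (\<omega> {1..q}) K" using *[of K] by (cases "K = {1..q}") (simp_all add: tf_def)
  qed
  moreover have "\<omega> {1..q} \<in> E" using *[of "{1..q}"] rational_iff_E by simp
  ultimately show "\<exists>g\<in>E. \<omega> = tf g" by blast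
next
  assume "\<exists>g\<in>E. \<omega> = tf g"
  then obtain g where g: "g \<in> E" "\<omega> = tf g" by blast
  have "if K = {1..q} then rational_fun q Qr (\<omega> K) else \<omega> K = (\<lambda>t. 0)" for K
    using E_rational[OF g(1)] by (simp add: g(2) tf_def)
  then show "\<omega> \<in> rational_forms q Qr q"
    unfolding rational_forms_def full_subset by blast
qed

lemma rational_forms_codim:
  assumes "\<omega> \<in> rational_forms q Qr l" "K \<subseteq> {1..q}" "card K = l"
  shows "\<omega> K \<in> E"
proof -
  have "if K \<subseteq> {1..q} \<and> card K = l then rational_fun q Qr (\<omega> K) else \<omega> K = (\<lambda>t. 0)"
    using assms(1) unfolding rational_forms_def by blast
  then show ?thesis using assms(2,3) rational_in_E by (simp only: if_True simp_thms)
qed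

lemma rational_forms_zero:
  assumes "\<omega> \<in> rational_forms q Qr l" "card K \<noteq> l"
  shows "\<omega> K = (\<lambda>t. 0)"
proof -
  have "if K \<subseteq> {1..q} \<and> card K = l then rational_fun q Qr (\<omega> K) else \<omega> K = (\<lambda>t. 0)"
    using assms(1) unfolding rational_forms_def by blast
  then show ?thesis using assms(2) by (simp only: if_False simp_thms)
qed

lemma closed_forms_top: "\<omega> \<in> closed_forms q Qr theta q \<longleftrightarrow> (\<exists>g\<in>E. \<omega> = tf g)"
proof -
  have "twisted_diff q Qr theta (tf g) = (\<lambda>K t. 0)" for g
  proof (intro ext)
    fix K t
    have "K - {j} \<noteq> {1..q}" if "K \<subseteq> {1..q}" "j \<in> K" for j using that by blast
    then show "twisted_diff q Qr theta (tf g) K t = 0"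
      by (auto simp: twisted_diff_def tf_def intro!: sum.neutral)
  qed
  then show ?thesis unfolding closed_forms_def using rational_forms_top by blast
qed

definition sg :: "nat \<Rightarrow> complex"
  where "sg j = (- 1) ^ card {i \<in> {1..q}. i < j}"

lemma sg_square: "sg j * sg j = 1"
  by (simp add: sg_def flip: power_add mult_2)

text \<open>A form of degree q - 1 has one component for each omitted index j. The signs are
  constants, so they can be moved into the functions \<open>G j\<close> and back.\<close>

lemma exact_forms_top:
  assumes "1 \<le> q"
  shows "\<omega> \<in> exact_forms q Qr theta q \<longleftrightarrow> (\<exists>G. (\<forall>j. G j \<in> E) \<and> \<omega> = tf (\<Sum>j=1..q. nab j (G j)))"
proof -
  obtain l where l: "q = Suc l" using assms by (cases q) auto
  have exact: "exact_forms q Qr theta q = twisted_diff q Qr theta ` rational_forms q Qr l"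
    unfolding exact_forms_def by (simp only: l nat.case)
  have td: "twisted_diff q Qr theta \<omega> = tf (\<Sum>j=1..q. nab j (cscale (sg j) (\<omega> ({1..q} - {j}))))"
    if \<omega>: "\<omega> \<in> rational_forms q Qr l" for \<omega>
  proof (intro ext)
    fix K t
    have rat: "\<omega> ({1..q} - {j}) \<in> E" if "j \<in> {1..q}" for j
    proof -
      have "card ({1..q} - {j}) = l" using that l by simp
      then show ?thesis by (intro rational_forms_codim[OF \<omega>]) auto
    qed
    show "twisted_diff q Qr theta \<omega> K t = tf (\<Sum>j=1..q. nab j (cscale (sg j) (\<omega> ({1..q} - {j})))) K t"
    proof (cases "K = {1..q}")
      case True
      have "twisted_diff q Qr theta \<omega> {1..q} t = (\<Sum>j=1..q. sg j * nab j (\<omega> ({1..q} - {j})) t)"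
        by (auto simp: twisted_diff_def sg_def nab_def U_def)
      also have "\<dots> = (\<Sum>j=1..q. nab j (cscale (sg j) (\<omega> ({1..q} - {j}))) t)"
      proof (rule sum.cong[OF refl])
        fix j assume "j \<in> {1..q}"
        then show "sg j * nab j (\<omega> ({1..q} - {j})) t = nab j (cscale (sg j) (\<omega> ({1..q} - {j}))) t"
          using nab_cscale[of j "\<omega> ({1..q} - {j})" "sg j"] rat[of j] by (simp only: atLeastAtMost_iff cscale_apply)
      qed
      finally show ?thesis using True by (simp only: tf_def refl if_True sum_fun_apply)
    next
      case False
      have "\<omega> (K - {j}) = (\<lambda>t. 0)" if "K \<subseteq> {1..q}" "j \<in> K" for j
      proof -
        have "finite K" using that(1) finite_subset by blast
        moreover have "card K \<noteq> q" using False that(1) full_subset by blast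
        moreover have "card K > 0" using \<open>finite K\<close> that(2) card_gt_0_iff by blast
        ultimately have "card (K - {j}) \<noteq> l" using that(2) l by simp
        then show ?thesis by (rule rational_forms_zero[OF \<omega>])
      qed
      then show ?thesis using False by (auto simp: twisted_diff_def tf_def intro!: sum.neutral)
    qed
  qed
  show ?thesis
  proof
    assume "\<omega> \<in> exact_forms q Qr theta q"
    then obtain \<eta> where \<eta>: "\<eta> \<in> rational_forms q Qr l" "\<omega> = twisted_diff q Qr theta \<eta>"
      unfolding exact by blast
    \<comment> \<open>The value 0 outside 1..q serves the demand that every \<open>G j\<close> lie
      in \<open>E\<close>.\<close>
    define G where "G j = (if j \<in> {1..q} then cscale (sg j) (\<eta> ({1..q} - {j})) else 0)" for j
    have "G j \<in> E" for j
    proof (cases "j \<in> {1..q}")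
      case True
      then have "card ({1..q} - {j}) = l" using l by simp
      then have "\<eta> ({1..q} - {j}) \<in> E"
        by (intro rational_forms_codim[OF \<eta>(1)]) auto
      then show ?thesis unfolding G_def if_P[OF True] by (rule fs.span_scale)
    next
      case False
      show ?thesis unfolding G_def if_not_P[OF False] by (rule fs.span_zero)
    qed
    moreover have "(\<Sum>j=1..q. nab j (G j)) = (\<Sum>j=1..q. nab j (cscale (sg j) (\<eta> ({1..q} - {j}))))"
      by (rule sum.cong) (simp_all only: G_def if_True)
    ultimately show "\<exists>G. (\<forall>j. G j \<in> E) \<and> \<omega> = tf (\<Sum>j=1..q. nab j (G j))"
      using td[OF \<eta>(1)] \<eta>(2) by metis
  next
    assume "\<exists>G. (\<forall>j. G j \<in> E) \<and> \<omega> = tf (\<Sum>j=1..q. nab j (G j))"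
    then obtain G where G: "\<And>j. G j \<in> E" "\<omega> = tf (\<Sum>j=1..q. nab j (G j))" by blast
    \<comment> \<open>For a set of q - 1 indices the minimum just names the one that is
      missing.\<close>
    define \<eta> :: form where "\<eta> K = (if K \<subseteq> {1..q} \<and> card K = l
        then cscale (sg (Min ({1..q} - K))) (G (Min ({1..q} - K))) else (\<lambda>t. 0))" for K
    have "if K \<subseteq> {1..q} \<and> card K = l then rational_fun q Qr (\<eta> K) else \<eta> K = (\<lambda>t. 0)" for K
      using E_rational[OF fs.span_scale[OF G(1)]] by (simp only: \<eta>_def if_True if_False split: if_split) blast
    then have \<eta>: "\<eta> \<in> rational_forms q Qr l" unfolding rational_forms_def by blast
    have "nab j (cscale (sg j) (\<eta> ({1..q} - {j}))) = nab j (G j)" if j: "j \<in> {1..q}" for j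
    proof -
      have "{1..q} - ({1..q} - {j}) = {j}" using j by blast
      then have "\<eta> ({1..q} - {j}) = cscale (sg j) (G j)" using j l by (simp add: \<eta>_def)
      then show ?thesis by (simp only: fs.scale_scale sg_square fs.scale_one)
    qed
    then have "(\<Sum>j=1..q. nab j (cscale (sg j) (\<eta> ({1..q} - {j})))) = (\<Sum>j=1..q. nab j (G j))"
      by (rule sum.cong[OF refl])
    then have "\<omega> = twisted_diff q Qr theta \<eta>" unfolding td[OF \<eta>] G(2) by (simp only:)
    then show "\<omega> \<in> exact_forms q Qr theta q" unfolding exact using \<eta> by blast
  qed
qed

lemma exact_tf_iff:
  assumes "1 \<le> q" "c \<in> W"
  shows "tf (ev c) \<in> exact_forms q Qr theta q \<longleftrightarrow> c \<in> R"
  unfolding exact_forms_top[OF assms(1)] exact_iff_R[OF assms(2), symmetric]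
  using tf_inj by metis

lemma tf_diff: "(\<lambda>K t. tf g K t - tf h K t) = tf (g - h)"
  by (intro ext) (simp add: tf_def)

section \<open>Derivatives of the multivalued function\<close>

definition branch :: "(nat \<Rightarrow> complex) \<Rightarrow> (nat \<times> nat \<Rightarrow> complex) \<Rightarrow> complex"
  where "branch t y = Q_branch (p + 1) q (chain_poly A) (\<lambda>i. \<beta> (Inl i)) (\<lambda>j. \<beta> (Inr j)) x t y t"

definition ratio :: "(nat \<Rightarrow> complex) \<Rightarrow> (nat \<times> nat \<Rightarrow> complex) \<Rightarrow> nat \<Rightarrow> complex"
  where "ratio t y i = chain_poly A (Suc i) y t / F i t"

lemma branch_eq:
  assumes "t \<in> U"
  shows "branch t y = (\<Prod>i=0..p. ratio t y i powr \<tau> (Inl i))"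
proof -
  have "(\<Prod>n=1..p+1. (chain_poly A n y t / chain_poly A n x t) powr \<beta> (Inl n)) = (\<Prod>i=0..p. ratio t y i powr \<tau> (Inl i))"
    using prod.shift_bounds_cl_Suc_ivl[of "\<lambda>n. (chain_poly A n y t / chain_poly A n x t) powr \<beta> (Inl n)" 0 p]
    by (simp add: chain_poly_eq_F ratio_def \<tau>_simps)
  moreover have "(\<Prod>j=1..q. (t j / t j) powr \<beta> (Inr j)) = 1"
    using U_D(1)[OF assms] by (intro prod.neutral) auto
  ultimately show ?thesis by (simp add: branch_def Q_branch_def)
qed

definition coef :: "(nat \<Rightarrow> complex) \<Rightarrow> (nat \<times> nat) list \<Rightarrow> complex"
  where "coef t u = (\<Prod>(i, j)\<leftarrow>u. \<tau> (Inl i) * tt t j / F i t)"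

text \<open>The derivatives belong to distinct rows, so each acts on its own factor, whose base is
  affine in the variable. The formula is proved at all y with ratios off the cut, since the next
  derivative needs it in a neighbourhood.\<close>

lemma iterated_partial:
  assumes t: "t \<in> U"
  shows "set u \<subseteq> A \<Longrightarrow> distinct (map fst u) \<Longrightarrow> (\<And>i. i \<le> p \<Longrightarrow> ratio t y i \<notin> \<real>\<^sub>\<le>\<^sub>0) \<Longrightarrow>
    foldr partial_x u (branch t) y =
      coef t u * (\<Prod>i=0..p. ratio t y i powr (\<tau> (Inl i) - of_bool (i \<in> fst ` set u)))"
proof (induction u arbitrary: y)
  case Nil
  then show ?case by (simp add: branch_eq[OF t] coef_def)
next
  case (Cons a u)
  obtain i j where a: "a = (i, j)" by fastforce
  have ij: "(i, j) \<in> A" "i \<le> p" "j \<le> q" "i \<notin> fst ` set u"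
    using Cons.prems a A_bounds[of i j] by auto
  let ?e = "\<lambda>l. \<tau> (Inl l) - of_bool (l \<in> fst ` set u)"
  define r where "r l w = ratio t (y(a := w)) l" for l w
  have r: "r l w = ratio t y l + (if l = i then tt t j / F i t * (w - y a) else 0)" for l w
  proof -
    have "finite {j. (l, j) \<in> A}" using finite_row_cols[of l] by (simp add: row_cols_def)
    then show ?thesis
      using ij(1) by (auto simp: r_def ratio_def chain_poly_update a tt_def add_divide_distrib)
  qed
  have dr: "(r l has_field_derivative (if l = i then tt t j / F i t else 0)) (at w)" for l w
    unfolding r[abs_def] using U_D(2)[OF t ij(2)] by (auto intro!: derivative_eq_intros)
  have ry: "r l (y a) = ratio t y l" for l by (simp add: r)
  have "\<forall>\<^sub>F w in nhds (y a). \<forall>l\<in>{..p}. r l w \<in> - \<real>\<^sub>\<le>\<^sub>0"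
  proof (intro eventually_ball_finite ballI)
    fix l assume l: "l \<in> {..p}"
    have "isCont (r l) (y a)" using dr DERIV_isCont by blast
    then have "(r l \<longlongrightarrow> r l (y a)) (nhds (y a))" by (simp add: continuous_at tendsto_nhds_iff isCont_def)
    moreover have "open (- \<real>\<^sub>\<le>\<^sub>0 :: complex set)" by (simp add: open_Compl)
    moreover have "r l (y a) \<in> - \<real>\<^sub>\<le>\<^sub>0" using Cons.prems(3) l by (simp add: ry)
    ultimately show "\<forall>\<^sub>F w in nhds (y a). r l w \<in> - \<real>\<^sub>\<le>\<^sub>0" by (rule topological_tendstoD)
  qed simp
  then have ev: "\<forall>\<^sub>F w in nhds (y a). foldr partial_x u (branch t) (y(a := w)) = coef t u * (\<Prod>l=0..p. r l w powr ?e l)"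
  proof eventually_elim
    case (elim w)
    have "foldr partial_x u (branch t) (y(a := w)) = coef t u * (\<Prod>l=0..p. ratio t (y(a := w)) l powr ?e l)"
      using Cons.prems elim by (intro Cons.IH) (auto simp: r_def simp del: fun_upd_apply)
    then show ?case by (simp add: r_def)
  qed
  have rest: "(\<Prod>l\<in>{0..p}. r l w powr ?e l) = r i w powr \<tau> (Inl i) * (\<Prod>l\<in>{0..p} - {i}. ratio t y l powr ?e l)" for w
  proof -
    have "(\<Prod>l\<in>{0..p} - {i}. r l w powr ?e l) = (\<Prod>l\<in>{0..p} - {i}. ratio t y l powr ?e l)"
      by (rule prod.cong) (auto simp: r)
    then show ?thesis using ij by (subst prod.remove[of _ i]) auto
  qed
  have "((\<lambda>w. r i w powr \<tau> (Inl i)) has_field_derivative \<tau> (Inl i) * ratio t y i powr (\<tau> (Inl i) - 1) * (tt t j / F i t)) (at (y a))"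
    using has_field_derivative_powr[THEN DERIV_chain2, OF _ dr[of i "y a"], of "\<tau> (Inl i)"] Cons.prems(3)[OF ij(2)]
    by (simp add: ry)
  then have "((\<lambda>w. coef t u * (\<Prod>l\<in>{0..p}. r l w powr ?e l)) has_field_derivative
      coef t u * (\<tau> (Inl i) * ratio t y i powr (\<tau> (Inl i) - 1) * (tt t j / F i t) * (\<Prod>l\<in>{0..p} - {i}. ratio t y l powr ?e l))) (at (y a))"
    unfolding rest by (intro DERIV_cmult DERIV_cmult_right)
  then have "deriv (\<lambda>w. coef t u * (\<Prod>l\<in>{0..p}. r l w powr ?e l)) (y a) =
      coef t u * (\<tau> (Inl i) * ratio t y i powr (\<tau> (Inl i) - 1) * (tt t j / F i t) * (\<Prod>l\<in>{0..p} - {i}. ratio t y l powr ?e l))"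
    by (rule DERIV_imp_deriv)
  moreover have "foldr partial_x (a # u) (branch t) y = deriv (\<lambda>w. foldr partial_x u (branch t) (y(a := w))) (y a)"
    by (simp add: partial_x_def)
  moreover have "\<dots> = deriv (\<lambda>w. coef t u * (\<Prod>l\<in>{0..p}. r l w powr ?e l)) (y a)"
    by (rule deriv_cong_ev[OF ev refl])
  moreover have "(\<Prod>l\<in>{0..p}. ratio t y l powr (\<tau> (Inl l) - of_bool (l \<in> fst ` set (a # u)))) =
      ratio t y i powr (\<tau> (Inl i) - 1) * (\<Prod>l\<in>{0..p} - {i}. ratio t y l powr ?e l)"
  proof -
    have "(\<Prod>l\<in>{0..p} - {i}. ratio t y l powr (\<tau> (Inl l) - of_bool (l \<in> fst ` set (a # u)))) =
        (\<Prod>l\<in>{0..p} - {i}. ratio t y l powr ?e l)"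
      by (rule prod.cong) (auto simp: a)
    then show ?thesis using ij a by (subst prod.remove[of _ i]) auto
  qed
  ultimately show ?case by (simp add: coef_def a mult_ac)
qed

lemma Y_zero: "t \<in> U \<Longrightarrow> Y 0 t = 1"
  using kap_0[OF \<tau>_Inl] by (simp add: Y_def mon_def kappa_def)

text \<open>Since rows do not repeat, the exponent in row i is still 0 when its cell is added, and
  the normalisation contributes exactly \<tau>.\<close>

lemma Y_deg:
  assumes t: "t \<in> U"
  shows "set u \<subseteq> A \<Longrightarrow> distinct (map fst u) \<Longrightarrow> Y (deg (mset u)) t = coef t u"
proof (induction u)
  case Nil
  have "deg (mset []) = 0" by (simp only: mset.simps deg_simps)
  then show ?case by (simp only: Y_zero[OF t] coef_def list.map prod_list.Nil)
next
  case (Cons a u)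
  obtain i j where a: "a = (i, j)" by fastforce
  have "\<not> 0 < deg (mset u) (Inl i)"
    unfolding deg_Inl_pos_iff using Cons.prems a by force
  then have z: "deg (mset u) (Inl i) = 0" using deg_nonneg[of "mset u" "Inl i"] by simp
  have "deg (mset (a # u)) = deg (mset u) + vec (i, j)"
    by (simp only: mset.simps deg_simps a add.commute)
  moreover have "Y (deg (mset u) + vec (i, j)) t = \<tau> (Inl i) * tt t j / F i t * Y (deg (mset u)) t"
    using Y_add_vec[OF t, of i j "deg (mset u)"] Cons.prems a z by simp
  moreover have "Y (deg (mset u)) t = coef t u" using Cons by simp
  ultimately show ?case by (simp only: coef_def a list.map prod_list.Cons prod.case)
qed

lemma Q_quotient_eq:
  assumes "u \<in> S" "t \<in> U"
  shows "Q_quotient (p + 1) q (chain_poly A) (\<lambda>i. \<beta> (Inl i)) (\<lambda>j. \<beta> (Inr j)) x u t = Y (deg (mset u)) t"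
proof -
  have one: "ratio t x i = 1" if "i \<le> p" for i
    using U_D(2)[OF assms(2) that] by (simp add: ratio_def chain_poly_eq_F)
  have "foldr partial_x u (branch t) x = coef t u * (\<Prod>i=0..p. ratio t x i powr (\<tau> (Inl i) - of_bool (i \<in> fst ` set u)))"
    using S_set[OF assms(1)] S_fst_distinct[OF assms(1)] one by (intro iterated_partial assms(2)) auto
  also have "(\<Prod>i=0..p. ratio t x i powr (\<tau> (Inl i) - of_bool (i \<in> fst ` set u))) = 1"
    using one by (intro prod.neutral) auto
  finally show ?thesis
    using Y_deg[OF assms(2) S_set[OF assms(1)] S_fst_distinct[OF assms(1)]]
    by (simp add: Q_quotient_def branch_def[abs_def])
qed

lemma top_form_Q_quotient:
  assumes "u \<in> S"
  shows "top_form q Qr (Q_quotient (p + 1) q (chain_poly A) (\<lambda>i. \<beta> (Inl i)) (\<lambda>j. \<beta> (Inr j)) x u) = tf (ev (Sdelta u))"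
  unfolding Sdelta_def ev_delta
  by (intro ext) (auto simp: top_form_def tf_def U_def[symmetric] Y_outside
      Q_quotient_eq[OF assms, unfolded Suc_eq_plus1[symmetric]])

lemma Sdelta_W: "u \<in> S \<Longrightarrow> Sdelta u \<in> W"
  unfolding Sdelta_def using supported_deg[of "mset u"] S_set by (intro delta_W) (auto simp: expos_def)

lemma ev_sum:
  assumes "finite J" "\<And>u. u \<in> J \<Longrightarrow> d u \<in> W"
  shows "(\<Sum>u\<in>J. cscale (s u) (d u)) \<in> W \<and> ev (\<Sum>u\<in>J. cscale (s u) (d u)) = (\<Sum>u\<in>J. cscale (s u) (ev (d u)))"
  using assms
proof (induction J rule: finite_induct)
  case empty
  show ?case unfolding sum.empty by (intro conjI fs.span_zero ev_zero)
next
  case (insert u J)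
  have u: "d u \<in> W" using insert.prems by blast
  have J: "(\<Sum>u\<in>J. cscale (s u) (d u)) \<in> W"
    "ev (\<Sum>u\<in>J. cscale (s u) (d u)) = (\<Sum>u\<in>J. cscale (s u) (ev (d u)))" using insert by blast+
  show ?case
    unfolding sum.insert[OF insert.hyps] ev_add[OF fs.span_scale[OF u] J(1)] ev_cscale[OF u] J(2)
    by (intro conjI fs.span_add fs.span_scale u J(1) refl)
qed

text \<open>All classes are transported to \<open>W\<close> modulo \<open>R\<close>, where
  independence and spanning are already known.\<close>

theorem cohomology_basis_S:
  assumes "1 \<le> q" "good x" "nonresonant \<tau>"
  shows "cohomology_basis q Qr theta q S
    (\<lambda>u. top_form q Qr (Q_quotient (p + 1) q (chain_poly A) (\<lambda>i. \<beta> (Inl i)) (\<lambda>j. \<beta> (Inr j)) x u))"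
    (is "cohomology_basis _ _ _ _ _ ?\<omega>")
proof -
  let ?L = "\<lambda>c. \<Sum>u\<in>S. cscale (c u) (Sdelta u)"
  have L: "?L c \<in> W" "ev (?L c) = (\<Sum>u\<in>S. cscale (c u) (ev (Sdelta u)))" for c
    using ev_sum[OF finite_S, of Sdelta c, OF Sdelta_W] by blast+
  have lincomb: "form_lincomb S c ?\<omega> = tf (ev (?L c))" for c
  proof (intro ext)
    fix K t
    have "form_lincomb S c ?\<omega> K t = (\<Sum>u\<in>S. c u * tf (ev (Sdelta u)) K t)"
      unfolding form_lincomb_def by (rule sum.cong) (simp_all only: top_form_Q_quotient)
    also have "\<dots> = tf (ev (?L c)) K t"
      unfolding L(2) by (cases "K = {1..q}") (simp_all only: tf_def refl if_True if_False sum_fun_apply cscale_apply mult_zero_right sum.neutral_const)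
    finally show "form_lincomb S c ?\<omega> K t = tf (ev (?L c)) K t" .
  qed
  have zero: "(\<lambda>K t. 0) = tf (ev 0)"
    by (intro ext) (simp add: tf_def ev_def)
  have exact_diff: "(\<lambda>K t. tf (ev c) K t - tf (ev d) K t) \<in> exact_forms q Qr theta q \<longleftrightarrow> c - d \<in> R"
    if "c \<in> W" "d \<in> W" for c d
    unfolding tf_diff ev_diff[OF that, symmetric] by (rule exact_tf_iff[OF assms(1) fs.span_diff[OF that]])
  have closed: "tf (ev c) \<in> closed_forms q Qr theta q" if "c \<in> W" for c
    using closed_forms_top ev_E[OF that] by blast
  have closedE: "\<exists>c\<in>W. \<eta> = tf (ev c)" if "\<eta> \<in> closed_forms q Qr theta q" for \<eta>
    using that closed_forms_top E_ev by metis
  show ?thesis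
    unfolding cohomology_basis_def
  proof (intro conjI ballI allI impI)
    show "finite S" by (rule finite_S)
    show "?\<omega> u \<in> closed_forms q Qr theta q" if "u \<in> S" for u
      unfolding top_form_Q_quotient[OF that] by (rule closed[OF Sdelta_W[OF that]])
    show "c u = 0" if eq: "cohomology_class q Qr theta q (form_lincomb S c ?\<omega>) = cohomology_class q Qr theta q (\<lambda>K t. 0)"
      and u: "u \<in> S" for c u
    proof -
      have "?L c - ?L c \<in> R" by (simp only: diff_self fs.span_zero)
      then have "tf (ev (?L c)) \<in> cohomology_class q Qr theta q (tf (ev (?L c)))"
        unfolding cohomology_class_def using exact_diff[OF L(1) L(1)] closed[OF L(1)] by blast
      then have "tf (ev (?L c)) \<in> cohomology_class q Qr theta q (tf (ev 0))"
        using eq unfolding lincomb zero by blast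
      then have "?L c - 0 \<in> R"
        unfolding cohomology_class_def using exact_diff[OF L(1) fs.span_zero] by blast
      then have "?L c \<in> R" by (simp only: diff_0_right)
      then show "c u = 0" using S_independent[OF assms(2,3)] u by blast
    qed
    fix X assume "X \<in> cohomology q Qr theta q"
    then obtain \<eta> where \<eta>: "\<eta> \<in> closed_forms q Qr theta q" "X = cohomology_class q Qr theta q \<eta>"
      unfolding cohomology_def by blast
    obtain d where d: "d \<in> W" "\<eta> = tf (ev d)" using closedE[OF \<eta>(1)] by blast
    have "d \<in> fs.span (Sdelta ` S \<union> rels x \<tau> expos)"
      using d(1) by (rule span_in_span) (use S_spanning[OF assms(2,3)] in blast)
    then obtain a r where ar: "d = a + r" "a \<in> fs.span (Sdelta ` S)" "r \<in> R"
      unfolding fs.span_Un by blast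
    obtain c where c: "a = ?L c" using ar(2) span_image_explicit[OF finite_S] by blast
    have "cohomology_class q Qr theta q \<eta> = cohomology_class q Qr theta q (form_lincomb S c ?\<omega>)"
      unfolding lincomb d(2)
    proof (rule set_eqI)
      fix \<zeta>
      show "\<zeta> \<in> cohomology_class q Qr theta q (tf (ev d)) \<longleftrightarrow> \<zeta> \<in> cohomology_class q Qr theta q (tf (ev (?L c)))"
      proof (cases "\<zeta> \<in> closed_forms q Qr theta q")
        case True
        then obtain z where z: "z \<in> W" "\<zeta> = tf (ev z)" using closedE by blast
        \<comment> \<open>The two representatives differ by \<open>r\<close>, an element of
          \<open>R\<close>, so their classes have the same members.\<close>
        have "z - ?L c = (z - d) + r" unfolding ar(1) c by (simp only: diff_diff_eq[symmetric] diff_add_cancel)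
        then have "z - d \<in> R \<longleftrightarrow> z - ?L c \<in> R"
          using fs.span_add_eq2[OF ar(3)] by metis
        then show ?thesis
          unfolding cohomology_class_def z(2) using exact_diff[OF z(1) d(1)] exact_diff[OF z(1) L(1)] by blast
      qed (simp add: cohomology_class_def)
    qed
    then show "\<exists>c. X = cohomology_class q Qr theta q (form_lincomb S c ?\<omega>)"
      using \<eta>(2) by blast
  qed
qed

end


section \<open>Posets and generic exponents\<close>


lemma poset_ideal_Int:
  assumes "poset_ideal P I" "poset_ideal P J"
  shows "poset_ideal P (I \<inter> J)"
  unfolding poset_ideal_def
proof (intro conjI ballI impI IntI)
  show "I \<inter> J \<subseteq> P" using assms(1) by (simp add: poset_ideal_def le_infI1)
  fix a b assume "a \<in> I \<inter> J" "b \<in> P" "b \<le> a"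
  then show "b \<in> I" "b \<in> J"
    using assms unfolding poset_ideal_def by (metis IntD1, metis IntD2)
qed

lemma poset_ideal_Un: "poset_ideal P I \<Longrightarrow> poset_ideal P J \<Longrightarrow> poset_ideal P (I \<union> J)"
  unfolding poset_ideal_def by (simp add: ball_Un)

lemma ideal_pairs_converse: "(ideal_pairs P p a q b)\<inverse> = ideal_pairs P q b p a"
  by (auto simp: ideal_pairs_def Un_commute)

text \<open>If deleting the top element of one chain destroys the ideal, that element lies below
  something that is kept; this cannot come from its own chain.\<close>

lemma ideal_pairs_obstruction:
  fixes P :: "'a::order set"
  assumes "strict_mono_on {1..p} a" "(i, j) \<in> ideal_pairs P p a q b" "0 < i" "(i - 1, j) \<notin> ideal_pairs P p a q b"
  shows "\<exists>l\<in>{1..j}. a i \<le> b l"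
proof -
  let ?I = "a ` {1..i} \<union> b ` {1..j}" and ?J = "a ` {1..i - 1} \<union> b ` {1..j}"
  have I: "poset_ideal P ?I" "i \<le> p" "j \<le> q" using assms(2) by (auto simp: ideal_pairs_def)
  have I_eq: "?I = insert (a i) ?J"
  proof -
    have "{1..i} = insert i {1..i - 1}" using assms(3) by auto
    then show ?thesis by simp
  qed
  have no: "\<not> poset_ideal P ?J" using assms(4) I by (simp add: ideal_pairs_def)
  have "?J \<subseteq> P" using I(1) I_eq unfolding poset_ideal_def by (metis insert_subset)
  with no obtain x y where xy: "x \<in> ?J" "y \<in> P" "y \<le> x" "y \<notin> ?J"
    unfolding poset_ideal_def by (metis (no_types))
  have "x \<in> ?I" using xy(1) I_eq by (metis insertI2)
  then have "y \<in> ?I" using I(1) xy(2,3) unfolding poset_ideal_def by (metis (no_types))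
  then have y: "y = a i" using xy(4) I_eq by (metis insertE)
  have "x \<notin> a ` {1..i - 1}"
  proof
    assume "x \<in> a ` {1..i - 1}"
    then obtain l where l: "l \<in> {1..i - 1}" "x = a l" by blast
    then have "a l < a i" using I(2) by (intro strict_mono_onD[OF assms(1)]) auto
    then show False using xy(3) l y by simp
  qed
  then show ?thesis using xy(1,3) y by auto
qed

lemma ladder_ideal_pairs:
  fixes P :: "'a::order set"
  assumes a: "strict_mono_on {1..p} a" and b: "strict_mono_on {1..q} b"
    and P: "P = a ` {1..p} \<union> b ` {1..q}" and disj: "a ` {1..p} \<inter> b ` {1..q} = {}"
  shows "ladder p q (ideal_pairs P p a q b)"
proof
  let ?A = "ideal_pairs P p a q b"
  show "i \<le> p \<and> j \<le> q" if "(i, j) \<in> ?A" for i j using that by (simp add: ideal_pairs_def)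
  show "(p, q) \<in> ?A" using P by (auto simp: ideal_pairs_def poset_ideal_def)
  show "(i, j') \<in> ?A \<and> (i', j) \<in> ?A"
    if ij: "(i, j) \<in> ?A" "(i', j') \<in> ?A" "i \<le> i'" "j' \<le> j" for i j i' j'
  proof -
    let ?I = "a ` {1..i} \<union> b ` {1..j}" and ?I' = "a ` {1..i'} \<union> b ` {1..j'}"
    have I: "poset_ideal P ?I" "poset_ideal P ?I'" "i' \<le> p" "j \<le> q"
      using ij by (auto simp: ideal_pairs_def)
    have sub: "a ` {1..i} \<subseteq> a ` {1..i'}" "b ` {1..j'} \<subseteq> b ` {1..j}" using ij by auto
    have "a ` {1..i'} \<subseteq> a ` {1..p}" "b ` {1..j} \<subseteq> b ` {1..q}" using I by auto
    \<comment> \<open>Without disjointness the intersection of the two ideals could contain more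
      than the two shorter initial segments.\<close>
    then have "a ` {1..i'} \<inter> b ` {1..j} = {}" using disj by blast
    then have meet: "a ` {1..i} \<union> b ` {1..j'} = ?I \<inter> ?I'"
      using sub by blast
    have join: "a ` {1..i'} \<union> b ` {1..j} = ?I \<union> ?I'"
      using sub by blast
    have "poset_ideal P (a ` {1..i} \<union> b ` {1..j'})"
      unfolding meet by (rule poset_ideal_Int[OF I(1,2)])
    moreover have "poset_ideal P (a ` {1..i'} \<union> b ` {1..j})"
      unfolding join by (rule poset_ideal_Un[OF I(1,2)])
    ultimately show ?thesis using ij I by (simp add: ideal_pairs_def)
  qed
  show "0 < i \<and> (i - 1, j) \<in> ?A \<or> 0 < j \<and> (i, j - 1) \<in> ?A" if ij: "(i, j) \<in> ?A" "(i, j) \<noteq> (0, 0)" for i j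
  \<comment> \<open>If neither top element can be deleted, then a_i is below some b_l, hence below
    b_j, and b_j is likewise below a_i. They coincide, contradicting disjointness.\<close>
  proof (rule ccontr)
    assume no: "\<not> ?thesis"
    have le: "i \<le> p" "j \<le> q" using ij by (auto simp: ideal_pairs_def)
    have ij': "(j, i) \<in> ideal_pairs P q b p a" using ij(1) ideal_pairs_converse[of P p a q b] by blast
    have 1: "\<exists>l\<in>{1..j}. a i \<le> b l" if "0 < i"
      using ideal_pairs_obstruction[OF a ij(1) that] no that by blast
    have 2: "\<exists>l\<in>{1..i}. b j \<le> a l" if "0 < j"
      using ideal_pairs_obstruction[OF b ij' that] no that ideal_pairs_converse[of P p a q b] by blast
    have pos: "0 < i" "0 < j" using 1 2 ij(2) by force+
    obtain l where l: "l \<in> {1..j}" "a i \<le> b l" using 1 pos by blast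
    obtain m where m: "m \<in> {1..i}" "b j \<le> a m" using 2 pos by blast
    have "b l \<le> b j"
      using l le strict_mono_onD[OF b, of l j] by (cases "l = j") (auto simp: less_le)
    moreover have "a m \<le> a i"
      using m le strict_mono_onD[OF a, of m i] by (cases "m = i") (auto simp: less_le)
    ultimately have "a i = b j" using l(2) m(2) by simp
    moreover have "a i \<in> a ` {1..p}" "b j \<in> b ` {1..q}" using pos le by auto
    ultimately show False using disj by (metis IntI empty_iff)
  qed
qed

context ladder
begin

text \<open>A hyperplane for each facet and each integer; these countably many form the exceptional
  set of exponents.\<close>

definition resonance :: "expo \<Rightarrow> int \<Rightarrow> (nat + nat \<Rightarrow> complex) set"
  where "resonance c n = {\<beta> \<in> cspace ({1..p+1} <+> {1..q}). pairing c (shifted \<beta>) - of_int n = 0}"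

lemma resonance_proper:
  assumes "c \<in> facets"
  shows "proper_analytic_subset ({1..p+1} <+> {1..q}) (resonance c n)"
proof -
  let ?I = "{1..p+1} <+> {1..q}"
  have coord: "holomorphic_in ?I (cspace ?I) (\<lambda>\<beta>. shifted \<beta> k)" if "k \<in> Idx" for k
  proof (cases k)
    case (Inl i)
    then have "Inl (Suc i) \<in> ?I" using that by (auto simp: Idx_def)
    then show ?thesis using Inl by (simp add: shifted_def holomorphic_in_coord)
  next
    case (Inr j)
    then have "Inr j \<in> ?I" using that by (auto simp: Idx_def)
    then have "holomorphic_in ?I (cspace ?I) (\<lambda>\<beta>. 0 - \<beta> (Inr j) - 1)"
      by (intro holomorphic_in_diff holomorphic_in_const holomorphic_in_coord)
    then show ?thesis using Inr by (simp add: shifted_def)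
  qed
  have holo: "holomorphic_in ?I (cspace ?I) (\<lambda>\<beta>. pairing c (shifted \<beta>) - of_int n)"
    unfolding pairing_def
    by (intro holomorphic_in_diff holomorphic_in_const holomorphic_in_sum finite_Idx holomorphic_in_mult coord)
  obtain a where "0 < pairing c (vec a)" using facet_pos[OF assms] by blast
  then obtain k where k: "k \<in> Idx" "c k \<noteq> 0"
    unfolding pairing_def by (metis (no_types, lifting) less_irrefl mult_zero_left of_int_0 sum.neutral)
  \<comment> \<open>A parameter with pairing n + 1, supported at one index where \<open>c\<close> is
    nonzero, hence a point off the hyperplane.\<close>
  define z where "z l = (if l = k then (of_int n + 1) / of_int (c k) else 0 :: complex)" for l
  define \<beta> where "\<beta> = restrict (\<lambda>l. case l of Inl i \<Rightarrow> z (Inl (i - 1)) | Inr j \<Rightarrow> - z (Inr j) - 1) ?I"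
  have "shifted \<beta> l = z l" if "l \<in> Idx" for l
    using that by (auto simp: shifted_def \<beta>_def Idx_def)
  then have "pairing c (shifted \<beta>) = (\<Sum>l\<in>Idx. if l = k then of_int n + 1 else 0)"
    unfolding pairing_def using k(2) by (intro sum.cong) (auto simp: z_def)
  also have "\<dots> = of_int n + 1" using k(1) finite_Idx by simp
  finally have "pairing c (shifted \<beta>) - of_int n \<noteq> 0" by simp
  moreover have "\<beta> \<in> cspace ?I" unfolding \<beta>_def by simp
  ultimately show ?thesis
    unfolding resonance_def using proper_analytic_subset_zeros[OF holo] by blast
qed

lemma nonresonant_outside:
  assumes "\<beta> \<in> cspace ({1..p+1} <+> {1..q}) - \<Union>{resonance c n | c n. c \<in> facets}"
  shows "nonresonant (shifted \<beta>)"
  unfolding nonresonant_def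
proof (intro ballI notI)
  fix c assume c: "c \<in> facets" "pairing c (shifted \<beta>) \<in> \<int>"
  then obtain n where "pairing c (shifted \<beta>) = of_int n" by (auto elim: Ints_cases)
  then have "\<beta> \<in> resonance c n" using assms by (simp add: resonance_def)
  then show False using assms c(1) by blast
qed

text \<open>The exceptional set in x is the zero set of the function from
  \<open>generic_good\<close>; it is the same for all exponents.\<close>

lemma generic_basis:
  assumes "1 \<le> q"
  shows "\<exists>Z. countable Z \<and> (\<forall>W\<in>Z. proper_analytic_subset ({1..p+1} <+> {1..q}) W) \<and>
    (\<forall>\<beta>\<in>cspace ({1..p+1} <+> {1..q}) - \<Union>Z. \<exists>V. proper_analytic_subset A V \<and>
      (\<forall>x\<in>cspace A - V. cohomology_basis q (Q_reduced (p + 1) q (chain_poly A) x)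
         (Q_twist (p + 1) q (chain_poly A) (\<lambda>i. \<beta> (Inl i)) (\<lambda>j. \<beta> (Inr j)) x) q S
         (\<lambda>u. top_form q (Q_reduced (p + 1) q (chain_poly A) x)
           (Q_quotient (p + 1) q (chain_poly A) (\<lambda>i. \<beta> (Inl i)) (\<lambda>j. \<beta> (Inr j)) x u))))"
proof -
  let ?Z = "{resonance c n | c n. c \<in> facets}"
  have "?Z = (\<lambda>(c, n). resonance c n) ` (facets \<times> UNIV)" by auto
  then have count: "countable ?Z"
    using finite_facets by (simp add: countable_finite)
  have Z: "proper_analytic_subset ({1..p+1} <+> {1..q}) W" if "W \<in> ?Z" for W
    using that resonance_proper by blast
  obtain D x0 where D: "holomorphic_in A (cspace A) D" "x0 \<in> cspace A" "D x0 \<noteq> 0"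
      "\<And>x. D x \<noteq> 0 \<Longrightarrow> good x \<and> (\<forall>a\<in>A. x a \<noteq> 0)"
    using generic_good by blast
  define V where "V = {x \<in> cspace A. D x = 0}"
  have V: "proper_analytic_subset A V"
    unfolding V_def by (rule proper_analytic_subset_zeros[OF D(1-3)])
  have basis: "cohomology_basis q (Q_reduced (p + 1) q (chain_poly A) x)
         (Q_twist (p + 1) q (chain_poly A) (\<lambda>i. \<beta> (Inl i)) (\<lambda>j. \<beta> (Inr j)) x) q S
         (\<lambda>u. top_form q (Q_reduced (p + 1) q (chain_poly A) x)
           (Q_quotient (p + 1) q (chain_poly A) (\<lambda>i. \<beta> (Inl i)) (\<lambda>j. \<beta> (Inr j)) x u))"
    if \<beta>: "\<beta> \<in> cspace ({1..p+1} <+> {1..q}) - \<Union>?Z" and x: "x \<in> cspace A - V" for \<beta> x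
  proof -
    have good: "good x" "\<And>a. a \<in> A \<Longrightarrow> x a \<noteq> 0"
      using D(4)[of x] x by (auto simp: V_def)
    have nonres: "nonresonant (shifted \<beta>)" by (rule nonresonant_outside[OF \<beta>])
    have "\<beta> (Inl (Suc i)) \<notin> \<int>" if "i \<le> p" for i
    proof -
      have "Inl i \<in> Idx" using that by (simp add: Idx_def)
      then have "pairing (coord (Inl i)) (shifted \<beta>) \<notin> \<int>"
        using nonres unfolding nonresonant_def facets_def by blast
      then show ?thesis using pairing_coord[OF \<open>Inl i \<in> Idx\<close>, of "shifted \<beta>"] by (simp add: shifted_def)
    qed
    then interpret arrangement p q A x \<beta>
      using good(2) by unfold_locales
    show ?thesis
      using cohomology_basis_S[OF assms good(1) nonres] unfolding Qr_def theta_def .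
  qed
  show ?thesis
    by (intro exI[of _ ?Z] conjI ballI exI[of _ V] count V) (erule Z, erule (1) basis)
qed

end

theorem theorem4:
  fixes P :: "'a::order set" and a b :: "nat \<Rightarrow> 'a" and p q :: nat
  assumes "finite P" and "p \<ge> 1" and "q \<ge> 1"
    and "strict_mono_on {1..p} a" and "strict_mono_on {1..q} b"
    and "P = a ` {1..p} \<union> b ` {1..q}" and "a ` {1..p} \<inter> b ` {1..q} = {}"
  shows "\<exists>Z. countable Z \<and> (\<forall>W\<in>Z. proper_analytic_subset ({1..p+1} <+> {1..q}) W) \<and>
    (\<forall>\<beta>\<in>cspace ({1..p+1} <+> {1..q}) - \<Union>Z.
      \<exists>V. proper_analytic_subset (ideal_pairs P p a q b) V \<and>
        (\<forall>x\<in>cspace (ideal_pairs P p a q b) - V.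
          let A = ideal_pairs P p a q b; k = p + 1; m = q; f = chain_poly A;
              \<alpha> = (\<lambda>i. \<beta> (Inl i)); \<gamma> = (\<lambda>j. \<beta> (Inr j))
          in cohomology_basis m (Q_reduced k m f x) (Q_twist k m f \<alpha> \<gamma> x) m
               (standard_monomials p q A)
               (\<lambda>u. top_form m (Q_reduced k m f x) (Q_quotient k m f \<alpha> \<gamma> x u))))"
proof -
  interpret ladder p q "ideal_pairs P p a q b"
    by (rule ladder_ideal_pairs) (use assms in blast)+
  show ?thesis
    unfolding Let_def using generic_basis assms(3) by simp
qed

end
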